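(* Let $\mathscr{A}$ be a separable $C^*$-algebra and fix an $R$-bounded generating tuple $a=(a_i)_{i\in I}$ of $\mathscr{A}$, where $I$ is countable and $R$ is strictly larger than the norm of each $a_i$. Then $$h^{\mathrm{top}}(\mathscr{A})=h^{\mathrm{top}}(a)\le h(L_a)=h(\mathscr{A}).$$
   Context: Conventions: $C^*$-algebras are unital, a trace is a tracial state, and the $C^*$-algebras considered are assumed to admit a trace. A tuple $(x_i)_i$ is $R$-bounded if $\|x_i\|\le R$ for all $i$; "generating" means generating as a unital $C^*$-algebra. $\mathbb{C}^*\langle T_i\mid i\in I\rangle$ is the unital $*$-algebra of noncommutative complex polynomials in free variables $T_i$ and their formal adjoints. $\log0=-\infty$. Definition of $h$. $\Sigma_{R,I}$ is the set of linear functionals $\ell$ on $\mathbb{C}^*\langle T_i\mid i\in I\rangle$ with $\ell(P^*P)\ge 0$, $\ell(1)=1$, $\ell(PQ)=\ell(QP)$ for all $P,Q$, and $\ell((T_j^*T_j)^k)\le R^{2k}$ for all $k\in\mathbb{N}$, $j\in I$, with the weak-$*$ topology. For an $R$-bounded $A\in M_N(\mathbb{C})^I$ let $\ell_A(P)=\frac1N\mathrm{Tr}(P(A))$; for $\mathcal{O}\subset\Sigma_{R,I}$ open, $\Gamma_R^{(N)}(\mathcal{O})=\{A\in M_N(\mathbb{C})^I:\|A_i\|\le R\ \forall i,\ \ell_A\in\mathcal{O}\}$. Let $\|A\|_2=(\frac1N\mathrm{Tr}(A^*A))^{1/2}$ on $M_N(\mathbb{C})$. For $\Omega\subset M_N(\mathbb{C})^I$,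 $F\subset I$ finite, $\epsilon>0$, $K^{\mathrm{orb}}_{F,\epsilon}(\Omega)$ is the minimal cardinality of $\Omega_0\subset\Omega$ such that for each $C\in\Omega$ there are $B\in\Omega_0$, $U\in U(N)$ with $\|C_i-UB_iU^*\|_2<\epsilon$ for all $i\in F$. For $K\subset\Sigma_{R,I}$ compact convex, $h(K)=\sup_{F,\epsilon}\inf_{\mathcal{O}\supset K}\limsup_{N\to\infty}\frac1{N^2}\log K^{\mathrm{orb}}_{F,\epsilon}(\Gamma_R^{(N)}(\mathcal{O}))$ over finite $F\subset I$, $\epsilon>0$, and weak-$*$ open neighborhoods $\mathcal{O}$ of $K$ in $\Sigma_{R,I}$. With $\mathscr{T}(\mathscr{A})$ the set of all traces on $\mathscr{A}$, $L_a=\{P\mapsto\tau(P(a)):\tau\in\mathscr{T}(\mathscr{A})\}\subset\Sigma_{R,I}$, and $h(\mathscr{A})$ (the $1$-bounded entropy of the universal tracial completion of $\mathscr{A}$) is $h(L_a)$ for any bounded generating tuple $a$; it does not depend on the choice of $R$ and $a$. Definition of $h^{\mathrm{top}}$. For finite $Q\subset\mathbb{C}^*\langle T_i\mid i\in I\rangle$ and $\delta>0$, $\Gamma_R^{(N,\mathrm{top})}(a;Q,\delta)=\{A\in M_N(\mathbb{C})^I:\|A_i\|\le R\ \forall i,\ \|P(A)\|\le\|P(a)\|+\delta\ \forall P\in Q\}$ (operator norm). $K^{\mathrm{orb}}_{F,\epsilon}(\Omega,\|\cdot\|)$ is defined like $K^{\mathrm{orb}}_{F,\epsilon}(\Omega)$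 with the operator norm in place of $\|\cdot\|_2$. Then $h^{\mathrm{top}}(a)=\sup_{\epsilon,F}\inf_{\delta,Q}\limsup_{N\to\infty}\frac1{N^2}\log K^{\mathrm{orb}}_{F,\epsilon}(\Gamma_R^{(N,\mathrm{top})}(a;Q,\delta),\|\cdot\|)$ over $\epsilon>0$, finite $F\subset I$, $\delta>0$ and finite $Q$. It does not depend on the choice of $R$ and the bounded generating tuple $a$, and is denoted $h^{\mathrm{top}}(\mathscr{A})$. *)

theory Defs
  imports
    "HOL-Analysis.Abstract_Topological_Spaces"
    "HOL-Analysis.Function_Topology"
    "HOL-Library.Extended_Real"
    "HOL-Library.Liminf_Limsup"
    "HOL-Library.Poly_Mapping"
    "Jordan_Normal_Form.Schur_Decomposition"
begin

section \<open>Unital C*-algebras\<close>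

text \<open>
  The class \<^class>\<open>real_normed_algebra_1\<close> includes \<open>norm 1 = 1\<close>, which in a C*-algebra
  only excludes the zero algebra (an algebra that admits no tracial state).
\<close>

class cstar_algebra = real_normed_algebra_1 + banach +
  fixes scaleC :: "complex \<Rightarrow> 'a \<Rightarrow> 'a" (infixr "*\<^sub>C" 75)
    and adj :: "'a \<Rightarrow> 'a"
  assumes scaleC_add_right: "c *\<^sub>C (x + y) = c *\<^sub>C x + c *\<^sub>C y"
    and scaleC_add_left: "(c + d) *\<^sub>C x = c *\<^sub>C x + d *\<^sub>C x"
    and scaleC_scaleC: "c *\<^sub>C d *\<^sub>C x = (c * d) *\<^sub>C x"
    and scaleC_of_real: "complex_of_real r *\<^sub>C x = r *\<^sub>R x"
    and norm_scaleC: "norm (c *\<^sub>C x) = cmod c * norm x"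
    and mult_scaleC_left: "(c *\<^sub>C x) * y = c *\<^sub>C (x * y)"
    and mult_scaleC_right: "x * (c *\<^sub>C y) = c *\<^sub>C (x * y)"
    and adj_add: "adj (x + y) = adj x + adj y"
    and adj_scaleC: "adj (c *\<^sub>C x) = cnj c *\<^sub>C adj x"
    and adj_mult: "adj (x * y) = adj y * adj x"
    and adj_adj: "adj (adj x) = x"
    and cstar_identity: "norm (adj x * x) = (norm x)\<^sup>2"

definition unital_cstar_subalgebra :: "'a::cstar_algebra set \<Rightarrow> bool" where
  "unital_cstar_subalgebra S \<longleftrightarrow>
     closed S \<and> 1 \<in> S \<and>
     (\<forall>x\<in>S. \<forall>y\<in>S. x + y \<in> S \<and> x * y \<in> S) \<and>
     (\<forall>c. \<forall>x\<in>S. c *\<^sub>C x \<in> S) \<and> (\<forall>x\<in>S. adj x \<in> S)"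

definition generating :: "'i set \<Rightarrow> ('i \<Rightarrow> 'a::cstar_algebra) \<Rightarrow> bool" where
  "generating I a \<longleftrightarrow> (\<forall>S. unital_cstar_subalgebra S \<and> a ` I \<subseteq> S \<longrightarrow> S = UNIV)"

definition R_bounded :: "real \<Rightarrow> 'i set \<Rightarrow> ('i \<Rightarrow> 'a::cstar_algebra) \<Rightarrow> bool" where
  "R_bounded R I a \<longleftrightarrow> (\<forall>i\<in>I. norm (a i) \<le> R)"

text \<open>
  Inequalities between complex numbers refer to the order of
  \<^theory>\<open>HOL-Library.Complex_Order\<close>: \<open>z \<le> w\<close> means \<open>Re z \<le> Re w \<and> Im z = Im w\<close>.
\<close>

definition tracial_state :: "('a::cstar_algebra \<Rightarrow> complex) \<Rightarrow> bool" where
  "tracial_state \<tau> \<longleftrightarrow>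
     (\<forall>x y. \<tau> (x + y) = \<tau> x + \<tau> y) \<and> (\<forall>c x. \<tau> (c *\<^sub>C x) = c * \<tau> x) \<and>
     (\<forall>x. 0 \<le> \<tau> (adj x * x)) \<and> \<tau> 1 = 1 \<and> (\<forall>x y. \<tau> (x * y) = \<tau> (y * x))"


section \<open>Noncommutative *-polynomials\<close>

text \<open>
  A word is a finite sequence of letters \<open>(i, False)\<close>, standing for \<open>T\<^sub>i\<close>, and \<open>(i, True)\<close>,
  standing for the formal adjoint of \<open>T\<^sub>i\<close>.  Words form a monoid under concatenation, written
  additively so that \<^typ>\<open>('w \<Rightarrow>\<^sub>0 complex)\<close> for the type \<open>'w\<close> of words is the monoid algebra,
  with convolution as multiplication.
\<close>

datatype 'i ncword = NCWord (letters: "('i \<times> bool) list")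

instantiation ncword :: (type) monoid_add
begin

definition zero_ncword :: "'a ncword" where "0 = NCWord []"

definition plus_ncword :: "'a ncword \<Rightarrow> 'a ncword \<Rightarrow> 'a ncword" where
  "v + w = NCWord (letters v @ letters w)"

instance
  by standard (simp_all add: zero_ncword_def plus_ncword_def)

end

type_synonym 'i ncpoly = "'i ncword \<Rightarrow>\<^sub>0 complex"

definition ncpolys :: "'i set \<Rightarrow> 'i ncpoly set" where
  "ncpolys I = {P. \<forall>w\<in>Poly_Mapping.keys P. fst ` set (letters w) \<subseteq> I}"

definition ncconst :: "complex \<Rightarrow> 'i ncpoly" where
  "ncconst c = Poly_Mapping.single 0 c"

definition ncvar :: "'i \<Rightarrow> 'i ncpoly" where
  "ncvar i = Poly_Mapping.single (NCWord [(i, False)]) 1"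

definition word_adj :: "'i ncword \<Rightarrow> 'i ncword" where
  "word_adj w = NCWord (rev (map (\<lambda>(i, s). (i, \<not> s)) (letters w)))"

definition ncadj :: "'i ncpoly \<Rightarrow> 'i ncpoly" where
  "ncadj P = (\<Sum>w\<in>Poly_Mapping.keys P.
     Poly_Mapping.single (word_adj w) (cnj (Poly_Mapping.lookup P w)))"

definition word_eval :: "('i \<Rightarrow> 'a::cstar_algebra) \<Rightarrow> 'i ncword \<Rightarrow> 'a" where
  "word_eval a w = prod_list (map (\<lambda>(i, s). if s then adj (a i) else a i) (letters w))"

definition nceval :: "('i \<Rightarrow> 'a::cstar_algebra) \<Rightarrow> 'i ncpoly \<Rightarrow> 'a" where
  "nceval a P = (\<Sum>w\<in>Poly_Mapping.keys P. Poly_Mapping.lookup P w *\<^sub>C word_eval a w)"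


section \<open>Matrices\<close>

text \<open>
  The C*-algebra of complex \<open>N \<times> N\<close> matrices, with \<open>N\<close> a term, is the carrier set
  \<^term>\<open>carrier_mat N N :: complex mat set\<close>.
\<close>

definition mat_word_eval :: "nat \<Rightarrow> ('i \<Rightarrow> complex mat) \<Rightarrow> 'i ncword \<Rightarrow> complex mat" where
  "mat_word_eval N A w =
     foldr (\<lambda>(i, s) M. (if s then mat_adjoint (A i) else A i) * M) (letters w) (1\<^sub>m N)"

text \<open>The linear combination is formed entrywise because the type of matrices of all sizes
  is not an additive monoid.\<close>

definition mat_nceval :: "nat \<Rightarrow> ('i \<Rightarrow> complex mat) \<Rightarrow> 'i ncpoly \<Rightarrow> complex mat" where
  "mat_nceval N A P = mat N N (\<lambda>rc.
     \<Sum>w\<in>Poly_Mapping.keys P. Poly_Mapping.lookup P w * (mat_word_eval N A w $$ rc))"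

definition mat_tr :: "nat \<Rightarrow> complex mat \<Rightarrow> complex" where
  "mat_tr N A = (\<Sum>i<N. A $$ (i, i))"

definition vec_norm2 :: "complex vec \<Rightarrow> real" where
  "vec_norm2 v = sqrt (Re (v \<bullet>c v))"

definition mat_opnorm :: "nat \<Rightarrow> complex mat \<Rightarrow> real" where
  "mat_opnorm N A = (SUP v\<in>{v \<in> carrier_vec N. vec_norm2 v \<le> 1}. vec_norm2 (A *\<^sub>v v))"

definition mat_norm2 :: "nat \<Rightarrow> complex mat \<Rightarrow> real" where
  "mat_norm2 N A = sqrt (Re (mat_tr N (mat_adjoint A * A)) / real N)"

definition unitary_mats :: "nat \<Rightarrow> complex mat set" where
  "unitary_mats N =
     {U \<in> carrier_mat N N. mat_adjoint U * U = 1\<^sub>m N \<and> U * mat_adjoint U = 1\<^sub>m N}"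

definition mat_tuples :: "nat \<Rightarrow> real \<Rightarrow> 'i set \<Rightarrow> ('i \<Rightarrow> complex mat) set" where
  "mat_tuples N R I = {A \<in> I \<rightarrow>\<^sub>E carrier_mat N N. \<forall>i\<in>I. mat_opnorm N (A i) \<le> R}"


section \<open>Orbital covering numbers\<close>

text \<open>The value is \<^term>\<open>\<infinity> :: enat\<close> if there is no finite \<open>\<Omega>\<^sub>0\<close>, and \<open>0\<close> iff \<open>\<Omega>\<close> is empty.\<close>

definition K_orb :: "(nat \<Rightarrow> complex mat \<Rightarrow> real) \<Rightarrow> nat \<Rightarrow> 'i set \<Rightarrow> real \<Rightarrow>
    ('i \<Rightarrow> complex mat) set \<Rightarrow> enat" where
  "K_orb nrm N F \<epsilon> \<Omega> =
     (INF \<Omega>\<^sub>0\<in>{\<Omega>\<^sub>0. finite \<Omega>\<^sub>0 \<and> \<Omega>\<^sub>0 \<subseteq> \<Omega> \<and>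
        (\<forall>C\<in>\<Omega>. \<exists>B\<in>\<Omega>\<^sub>0. \<exists>U\<in>unitary_mats N.
           \<forall>i\<in>F. nrm N (C i - U * B i * mat_adjoint U) < \<epsilon>)}.
      enat (card \<Omega>\<^sub>0))"

definition log_enat :: "enat \<Rightarrow> ereal" where
  "log_enat n = (case n of enat k \<Rightarrow> if k = 0 then -\<infinity> else ereal (ln (real k)) | \<infinity> \<Rightarrow> \<infinity>)"


section \<open>1-bounded entropy\<close>

text \<open>
  Functionals on the *-algebra of polynomials with variables in \<open>I\<close> are extensional functions on
  \<^term>\<open>ncpolys I\<close>.  The weak-* topology is that of pointwise convergence.
\<close>

definition law_space :: "real \<Rightarrow> 'i set \<Rightarrow> ('i ncpoly \<Rightarrow> complex) set" where
  "law_space R I = {l \<in> extensional (ncpolys I).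
     (\<forall>P\<in>ncpolys I. \<forall>Q\<in>ncpolys I. l (P + Q) = l P + l Q) \<and>
     (\<forall>c. \<forall>P\<in>ncpolys I. l (ncconst c * P) = c * l P) \<and>
     (\<forall>P\<in>ncpolys I. 0 \<le> l (ncadj P * P)) \<and> l 1 = 1 \<and>
     (\<forall>P\<in>ncpolys I. \<forall>Q\<in>ncpolys I. l (P * Q) = l (Q * P)) \<and>
     (\<forall>j\<in>I. \<forall>k::nat. l ((ncadj (ncvar j) * ncvar j) ^ k) \<le> complex_of_real (R ^ (2 * k)))}"

definition law_topology :: "real \<Rightarrow> 'i set \<Rightarrow> ('i ncpoly \<Rightarrow> complex) topology" where
  "law_topology R I =
     subtopology (product_topology (\<lambda>_. euclidean) (ncpolys I)) (law_space R I)"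

definition mat_law :: "nat \<Rightarrow> 'i set \<Rightarrow> ('i \<Rightarrow> complex mat) \<Rightarrow> 'i ncpoly \<Rightarrow> complex" where
  "mat_law N I A =
     restrict (\<lambda>P. mat_tr N (mat_nceval N A P) / of_nat N) (ncpolys I)"

definition microstates :: "nat \<Rightarrow> real \<Rightarrow> 'i set \<Rightarrow> ('i ncpoly \<Rightarrow> complex) set \<Rightarrow>
    ('i \<Rightarrow> complex mat) set" where
  "microstates N R I \<O> = {A \<in> mat_tuples N R I. mat_law N I A \<in> \<O>}"

definition h_laws :: "real \<Rightarrow> 'i set \<Rightarrow> ('i ncpoly \<Rightarrow> complex) set \<Rightarrow> ereal" where
  "h_laws R I K =
     (SUP (F, \<epsilon>)\<in>{(F, \<epsilon>). finite F \<and> F \<subseteq> I \<and> 0 < \<epsilon>}.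
      INF \<O>\<in>{\<O>. openin (law_topology R I) \<O> \<and> K \<subseteq> \<O>}.
        limsup (\<lambda>N. ereal (1 / (real N)\<^sup>2) *
          log_enat (K_orb mat_norm2 N F \<epsilon> (microstates N R I \<O>))))"

definition trace_laws :: "'i set \<Rightarrow> ('i \<Rightarrow> 'a::cstar_algebra) \<Rightarrow> ('i ncpoly \<Rightarrow> complex) set" where
  "trace_laws I a = {restrict (\<lambda>P. \<tau> (nceval a P)) (ncpolys I) | \<tau>. tracial_state \<tau>}"

text \<open>
  The entropy of the algebra is the common value over all bounded generating tuples; that there is
  such a value is not built into the definition.  Tuples indexed by sets of natural numbers suffice
  to define it for a separable algebra.
\<close>

definition h_alg :: "'a::cstar_algebra itself \<Rightarrow> ereal" where
  "h_alg _ = (THE v. \<forall>R (I :: nat set) (a :: nat \<Rightarrow> 'a).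
     R_bounded R I a \<and> generating I a \<longrightarrow> h_laws R I (trace_laws I a) = v)"


section \<open>Topological 1-bounded entropy\<close>

definition top_microstates :: "nat \<Rightarrow> real \<Rightarrow> 'i set \<Rightarrow> ('i \<Rightarrow> 'a::cstar_algebra) \<Rightarrow>
    'i ncpoly set \<Rightarrow> real \<Rightarrow> ('i \<Rightarrow> complex mat) set" where
  "top_microstates N R I a Q \<delta> = {A \<in> mat_tuples N R I.
     \<forall>P\<in>Q. mat_opnorm N (mat_nceval N A P) \<le> norm (nceval a P) + \<delta>}"

definition h_top :: "real \<Rightarrow> 'i set \<Rightarrow> ('i \<Rightarrow> 'a::cstar_algebra) \<Rightarrow> ereal" where
  "h_top R I a =
     (SUP (\<epsilon>, F)\<in>{(\<epsilon>, F). 0 < \<epsilon> \<and> finite F \<and> F \<subseteq> I}.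
      INF (\<delta>, Q)\<in>{(\<delta>, Q). 0 < \<delta> \<and> finite Q \<and> Q \<subseteq> ncpolys I}.
        limsup (\<lambda>N. ereal (1 / (real N)\<^sup>2) *
          log_enat (K_orb mat_opnorm N F \<epsilon> (top_microstates N R I a Q \<delta>))))"

text \<open>As for \<^const>\<open>h_alg\<close>, this is the common value over all bounded generating tuples.\<close>

definition h_top_alg :: "'a::cstar_algebra itself \<Rightarrow> ereal" where
  "h_top_alg _ = (THE v. \<forall>R (I :: nat set) (a :: nat \<Rightarrow> 'a).
     R_bounded R I a \<and> generating I a \<longrightarrow> h_top R I a = v)"

end

theory Submission
  imports
    Defs
    "HOL-Analysis.L2_Norm"
    "HOL-Computational_Algebra.Formal_Power_Series"
begin

text \<open>
  Both entropies are instances of one quantity.  A norm \<open>nrm\<close> on matrices measures distances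
  between orbits, and a functional \<open>\<mu>\<close> selects the microstates, by the conditions
  \<open>\<mu> (P(A)) \<le> \<parallel>P(a)\<parallel> + \<delta>\<close> for finitely many polynomials \<open>P\<close>.  For the topological entropy \<open>nrm\<close>
  and \<open>\<mu>\<close> are the operator norm.  For the entropy of the set of trace laws \<open>nrm\<close> is the normalised
  Hilbert-Schmidt norm and \<open>\<mu>\<close> the absolute value of the normalised trace: a law \<open>\<ell>\<close> with
  \<open>|\<ell>(P)| \<le> \<parallel>P(a)\<parallel>\<close> for all \<open>P\<close> extends to a trace by continuity (\<open>law_of_trace\<close>), so by
  Tychonoff's theorem finitely many inequalities \<open>|\<ell>(P)| \<le> \<parallel>P(a)\<parallel> + \<delta>\<close> describe arbitrarily small
  neighbourhoods of the set of trace laws (\<open>trace_laws_neighbourhood\<close>).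

  The common quantity does not depend on the generators (\<open>size_entropy_independent\<close>).  Let \<open>a\<close> and
  \<open>b\<close> generate, choose polynomials with \<open>f\<^sub>j(a) \<approx> b\<^sub>j\<close> and \<open>g\<^sub>i(b) \<approx> a\<^sub>i\<close>, and let \<open>A\<close> be a
  microstate for \<open>a\<close>.  Then \<open>f(A)\<close> is nearly a microstate for \<open>b\<close>, except that its norms may
  be too large.  The conditions on high powers of \<open>f\<^sub>j(A)\<^sup>* f\<^sub>j(A)\<close> show that only a small
  proportion of the singular values is too large; cutting them off changes \<open>f(A)\<close> little in
  \<open>nrm\<close> (\<open>moment_truncation\<close>) and yields a microstate \<open>B\<close> for \<open>b\<close> with \<open>g(B) \<approx> A\<close>
  (\<open>microstates_transfer\<close>).  As \<open>g\<close> is Lipschitz on bounded sets and commutes with unitary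
  conjugation, an orbital cover for \<open>b\<close> gives one for \<open>a\<close>.

  Since the normalised trace is bounded by the operator norm, topological microstates satisfy the
  weaker conditions on traces.  What separates the two entropies is that covers in operator norm
  are larger.  But a difference of two bounded matrices that is small in the normalised
  Hilbert-Schmidt norm is, up to a small operator norm, of rank at most \<open>\<kappa>N\<close> with small \<open>\<kappa>\<close>
  (\<open>low_rank_approximation\<close>), and bounded matrices of that rank have nets of cardinality
  \<open>exp (O(\<kappa>N\<^sup>2))\<close> in operator norm (\<open>opnorm_net\<close>).  So passing to the operator norm costs
  \<open>O(\<kappa>)\<close> in the entropy, and \<open>\<kappa>\<close> tends to \<open>0\<close> with the Hilbert-Schmidt radius
  (\<open>K_orb_opnorm_le\<close>, \<open>size_entropy_opnorm_le_norm2\<close>).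
\<close>

text \<open>In this theory \<open>$\<close> refers to entries of vectors whose dimension is a term.\<close>

unbundle no vec_syntax

section \<open>Matrix norms\<close>

lemma dim_row_mat_adjoint [simp]: "dim_row (mat_adjoint A) = dim_col A"
  and dim_col_mat_adjoint [simp]: "dim_col (mat_adjoint A) = dim_row A"
  by (simp_all add: mat_adjoint_def)

lemma mat_adjoint_carrier [simp, intro]:
  "A \<in> carrier_mat m n \<Longrightarrow> mat_adjoint A \<in> carrier_mat n m"
  by (rule carrier_matI) auto

lemma mat_adjoint_index [simp]:
  "i < dim_col A \<Longrightarrow> j < dim_row A \<Longrightarrow> mat_adjoint A $$ (i, j) = cnj (A $$ (j, i))"
  for A :: "complex mat"
  by (simp add: mat_adjoint_def mat_of_rows_index)

lemma mat_adjoint_adjoint [simp]: "mat_adjoint (mat_adjoint A) = A" for A :: "complex mat"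
  by (intro eq_matI) auto

lemma mat_adjoint_one [simp]: "mat_adjoint (1\<^sub>m n) = (1\<^sub>m n :: complex mat)"
  by (intro eq_matI) auto

lemma mat_adjoint_mult:
  "A \<in> carrier_mat m n \<Longrightarrow> B \<in> carrier_mat n p \<Longrightarrow>
    mat_adjoint (A * B) = mat_adjoint B * mat_adjoint A" for A :: "complex mat"
  by (intro eq_matI) (auto simp: scalar_prod_def mult.commute intro!: sum.cong)

lemma mat_adjoint_minus:
  "A \<in> carrier_mat m n \<Longrightarrow> B \<in> carrier_mat m n \<Longrightarrow>
    mat_adjoint (A - B) = mat_adjoint A - mat_adjoint B" for A :: "complex mat"
  by (intro eq_matI) auto

lemma mult_mat_vec_adjoint:
  assumes "A \<in> carrier_mat m n" "v \<in> carrier_vec n" "w \<in> carrier_vec m"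
  shows "(A *\<^sub>v v) \<bullet>c (w :: complex vec) = v \<bullet>c (mat_adjoint A *\<^sub>v w)"
proof -
  have "(A *\<^sub>v v) \<bullet>c w = (\<Sum>i<m. \<Sum>j<n. A $$ (i, j) * v $ j * cnj (w $ i))"
    using assms by (simp add: scalar_prod_def sum_distrib_right lessThan_atLeast0)
  also have "\<dots> = (\<Sum>j<n. \<Sum>i<m. A $$ (i, j) * v $ j * cnj (w $ i))"
    by (rule sum.swap)
  also have "\<dots> = v \<bullet>c (mat_adjoint A *\<^sub>v w)"
    using assms by (simp add: scalar_prod_def sum_distrib_left lessThan_atLeast0 mult_ac)
  finally show ?thesis .
qed

lemma vec_norm2_eq_L2_set: "vec_norm2 v = L2_set (\<lambda>i. cmod (v $ i)) {..<dim_vec v}"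
  by (simp add: vec_norm2_def L2_set_def scalar_prod_def cmod_power2 sum.distrib lessThan_atLeast0
      flip: power2_eq_square)

lemma vec_norm2_nonneg [simp]: "0 \<le> vec_norm2 v"
  by (simp add: vec_norm2_eq_L2_set)

lemma vec_norm2_power2: "(vec_norm2 v)\<^sup>2 = (\<Sum>i<dim_vec v. (cmod (v $ i))\<^sup>2)"
  by (simp add: vec_norm2_eq_L2_set L2_set_def sum_nonneg)

lemma vec_norm2_square: "v \<bullet>c v = complex_of_real ((vec_norm2 v)\<^sup>2)"
  unfolding vec_norm2_power2
  by (simp add: scalar_prod_def complex_norm_square lessThan_atLeast0 del: of_real_power)

lemma vec_norm2_zero [simp]: "vec_norm2 (0\<^sub>v n) = 0"
  by (simp add: vec_norm2_eq_L2_set L2_set_def)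

lemma vec_norm2_smult: "vec_norm2 (c \<cdot>\<^sub>v v) = cmod c * vec_norm2 v"
proof -
  have "vec_norm2 (c \<cdot>\<^sub>v v) = L2_set (\<lambda>i. cmod c * cmod (v $ i)) {..<dim_vec v}"
    unfolding vec_norm2_eq_L2_set by (auto simp: norm_mult intro!: L2_set_cong)
  then show ?thesis by (simp add: L2_set_right_distrib vec_norm2_eq_L2_set)
qed

lemma vec_norm2_triangle:
  assumes "v \<in> carrier_vec n" "w \<in> carrier_vec n"
  shows "vec_norm2 (v + w) \<le> vec_norm2 v + vec_norm2 w"
proof -
  have "vec_norm2 (v + w) = L2_set (\<lambda>i. cmod (v $ i + w $ i)) {..<n}"
    using assms unfolding vec_norm2_eq_L2_set by (auto intro!: L2_set_cong)
  also have "\<dots> \<le> L2_set (\<lambda>i. cmod (v $ i) + cmod (w $ i)) {..<n}"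
    by (intro L2_set_mono) (auto intro: norm_triangle_ineq)
  also have "\<dots> \<le> vec_norm2 v + vec_norm2 w"
    using L2_set_triangle_ineq[of _ _ "{..<n}"] assms by (simp add: vec_norm2_eq_L2_set)
  finally show ?thesis .
qed

lemma cscalar_prod_le:
  assumes "v \<in> carrier_vec n" "w \<in> carrier_vec n"
  shows "cmod (v \<bullet>c w) \<le> vec_norm2 v * vec_norm2 w"
proof -
  have "cmod (v \<bullet>c w) \<le> (\<Sum>i<n. cmod (v $ i) * cmod (w $ i))"
    using assms by (auto simp: scalar_prod_def lessThan_atLeast0 norm_mult intro!: sum_norm_le)
  also have "\<dots> \<le> vec_norm2 v * vec_norm2 w"
    using L2_set_mult_ineq[of "\<lambda>i. cmod (v $ i)" "\<lambda>i. cmod (w $ i)" "{..<n}"] assms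
    by (simp add: vec_norm2_eq_L2_set)
  finally show ?thesis .
qed

definition fro_norm :: "complex mat \<Rightarrow> real" where
  "fro_norm A = L2_set (\<lambda>(i, j). cmod (A $$ (i, j))) ({..<dim_row A} \<times> {..<dim_col A})"

lemma fro_norm_nonneg [simp]: "0 \<le> fro_norm A"
  by (simp add: fro_norm_def)

lemma fro_norm_power2:
  "(fro_norm A)\<^sup>2 = (\<Sum>i<dim_row A. \<Sum>j<dim_col A. (cmod (A $$ (i, j)))\<^sup>2)"
  by (simp add: fro_norm_def L2_set_def sum_nonneg sum.cartesian_product split_def)

lemma fro_norm_power2_cols:
  "(fro_norm A)\<^sup>2 = (\<Sum>j<dim_col A. (vec_norm2 (col A j))\<^sup>2)"
  unfolding fro_norm_power2 by (subst sum.swap) (auto simp: vec_norm2_power2)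

lemma fro_norm_adjoint [simp]: "fro_norm (mat_adjoint A) = fro_norm A"
proof -
  have "(fro_norm (mat_adjoint A))\<^sup>2 = (fro_norm A)\<^sup>2"
    unfolding fro_norm_power2 by (subst sum.swap) simp
  then show ?thesis by simp
qed

lemma fro_norm_triangle:
  assumes "A \<in> carrier_mat m n" "B \<in> carrier_mat m n"
  shows "fro_norm (A + B) \<le> fro_norm A + fro_norm B"
proof -
  let ?D = "{..<m} \<times> {..<n}"
  have "fro_norm (A + B) = L2_set (\<lambda>(i, j). cmod (A $$ (i, j) + B $$ (i, j))) ?D"
    using assms unfolding fro_norm_def by (auto intro!: L2_set_cong)
  also have "\<dots> \<le> L2_set (\<lambda>p. cmod (A $$ p) + cmod (B $$ p)) ?D"
    by (intro L2_set_mono) (auto intro: norm_triangle_ineq)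
  also have "\<dots> \<le> fro_norm A + fro_norm B"
    using L2_set_triangle_ineq[of _ _ ?D] assms by (simp add: fro_norm_def split_def)
  finally show ?thesis .
qed

lemma fro_norm_smult: "fro_norm (c \<cdot>\<^sub>m A) = cmod c * fro_norm A"
proof -
  have "fro_norm (c \<cdot>\<^sub>m A) =
      L2_set (\<lambda>p. cmod c * cmod (A $$ p)) ({..<dim_row A} \<times> {..<dim_col A})"
    unfolding fro_norm_def by (auto simp: norm_mult intro!: L2_set_cong)
  then show ?thesis
    by (simp add: L2_set_right_distrib fro_norm_def split_def)
qed

lemma vec_norm2_mult_mat_vec_le_fro:
  assumes "A \<in> carrier_mat m n" "v \<in> carrier_vec n"
  shows "vec_norm2 (A *\<^sub>v v) \<le> fro_norm A * vec_norm2 v"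
proof -
  have row: "(cmod ((A *\<^sub>v v) $ i))\<^sup>2 \<le> (\<Sum>j<n. (cmod (A $$ (i, j)))\<^sup>2) * (vec_norm2 v)\<^sup>2"
    if "i < m" for i
  proof -
    have "cmod ((A *\<^sub>v v) $ i) \<le> (\<Sum>j<n. cmod (A $$ (i, j)) * cmod (v $ j))"
      using assms that by (auto simp: scalar_prod_def lessThan_atLeast0 norm_mult intro!: sum_norm_le)
    then have "(cmod ((A *\<^sub>v v) $ i))\<^sup>2 \<le> (\<Sum>j<n. cmod (A $$ (i, j)) * cmod (v $ j))\<^sup>2"
      by (intro power_mono) auto
    also have "\<dots> \<le> (\<Sum>j<n. (cmod (A $$ (i, j)))\<^sup>2) * (\<Sum>j<n. (cmod (v $ j))\<^sup>2)"
      by (rule Cauchy_Schwarz_ineq_sum)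
    finally show ?thesis using assms by (simp add: vec_norm2_power2)
  qed
  have "(vec_norm2 (A *\<^sub>v v))\<^sup>2 \<le> (\<Sum>i<m. (\<Sum>j<n. (cmod (A $$ (i, j)))\<^sup>2) * (vec_norm2 v)\<^sup>2)"
    unfolding vec_norm2_power2[of "A *\<^sub>v v"] using assms row by (auto intro!: sum_mono)
  also have "\<dots> = (fro_norm A * vec_norm2 v)\<^sup>2"
    using assms by (simp add: fro_norm_power2 power_mult_distrib sum_distrib_right)
  finally show ?thesis
    by (rule power2_le_imp_le) simp
qed

lemma bdd_above_opnorm:
  assumes "A \<in> carrier_mat m n"
  shows "bdd_above ((\<lambda>v. vec_norm2 (A *\<^sub>v v)) ` {v \<in> carrier_vec n. vec_norm2 v \<le> 1})"
proof (rule bdd_aboveI2)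
  fix v assume v: "v \<in> {v \<in> carrier_vec n. vec_norm2 v \<le> 1}"
  have "vec_norm2 (A *\<^sub>v v) \<le> fro_norm A * vec_norm2 v"
    using v assms by (intro vec_norm2_mult_mat_vec_le_fro) auto
  also have "\<dots> \<le> fro_norm A" using v by (simp add: mult_left_le)
  finally show "vec_norm2 (A *\<^sub>v v) \<le> fro_norm A" .
qed

lemma opnorm_nonneg [simp]:
  assumes "A \<in> carrier_mat m n"
  shows "0 \<le> mat_opnorm n A"
proof -
  have "vec_norm2 (A *\<^sub>v 0\<^sub>v n) \<le> mat_opnorm n A"
    unfolding mat_opnorm_def by (rule cSUP_upper[OF _ bdd_above_opnorm[OF assms]]) auto
  then show ?thesis using vec_norm2_nonneg order_trans by blast
qed

lemma opnorm_bound: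
  assumes A: "A \<in> carrier_mat m n" and v: "v \<in> carrier_vec n"
  shows "vec_norm2 (A *\<^sub>v v) \<le> mat_opnorm n A * vec_norm2 v"
proof (cases "vec_norm2 v = 0")
  case True
  have "vec_norm2 (A *\<^sub>v v) \<le> fro_norm A * vec_norm2 v"
    by (rule vec_norm2_mult_mat_vec_le_fro[OF A v])
  with True show ?thesis by simp
next
  case False
  then have pos: "0 < vec_norm2 v" by (simp add: order_less_le)
  let ?u = "complex_of_real (1 / vec_norm2 v) \<cdot>\<^sub>v v"
  have "vec_norm2 (A *\<^sub>v ?u) \<le> mat_opnorm n A"
    unfolding mat_opnorm_def
    by (rule cSUP_upper[OF _ bdd_above_opnorm[OF A]])
      (use v pos in \<open>auto simp: vec_norm2_smult norm_divide\<close>)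
  also have "A *\<^sub>v ?u = complex_of_real (1 / vec_norm2 v) \<cdot>\<^sub>v (A *\<^sub>v v)"
    using A v by (rule mult_mat_vec)
  finally show ?thesis using pos by (simp add: vec_norm2_smult norm_divide divide_simps)
qed

lemma opnorm_le:
  assumes "A \<in> carrier_mat m n" "0 \<le> c"
    and "\<And>v. v \<in> carrier_vec n \<Longrightarrow> vec_norm2 (A *\<^sub>v v) \<le> c * vec_norm2 v"
  shows "mat_opnorm n A \<le> c"
  unfolding mat_opnorm_def
proof (rule cSUP_least)
  show "{v \<in> carrier_vec n. vec_norm2 v \<le> 1} \<noteq> {}"
    by (auto intro!: exI[of _ "0\<^sub>v n"])
next
  fix v assume v: "v \<in> {v \<in> carrier_vec n. vec_norm2 v \<le> 1}"
  then have "vec_norm2 (A *\<^sub>v v) \<le> c * vec_norm2 v" using assms by auto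
  also have "\<dots> \<le> c" using v assms by (simp add: mult_left_le)
  finally show "vec_norm2 (A *\<^sub>v v) \<le> c" .
qed

lemma opnorm_triangle:
  assumes A: "A \<in> carrier_mat m n" and B: "B \<in> carrier_mat m n"
  shows "mat_opnorm n (A + B) \<le> mat_opnorm n A + mat_opnorm n B"
proof (rule opnorm_le[where m = m])
  fix v :: "complex vec" assume v: "v \<in> carrier_vec n"
  have "vec_norm2 ((A + B) *\<^sub>v v) = vec_norm2 (A *\<^sub>v v + B *\<^sub>v v)"
    using A B v by (simp add: add_mult_distrib_mat_vec[OF A B v])
  also have "\<dots> \<le> vec_norm2 (A *\<^sub>v v) + vec_norm2 (B *\<^sub>v v)"
    using A B v by (intro vec_norm2_triangle[where n = m]) auto
  also have "\<dots> \<le> mat_opnorm n A * vec_norm2 v + mat_opnorm n B * vec_norm2 v"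
    by (intro add_mono opnorm_bound[OF A v] opnorm_bound[OF B v])
  finally show "vec_norm2 ((A + B) *\<^sub>v v) \<le> (mat_opnorm n A + mat_opnorm n B) * vec_norm2 v"
    by (simp add: distrib_right)
qed (use A B opnorm_nonneg[OF A] opnorm_nonneg[OF B] in auto)

lemma opnorm_smult_le:
  assumes A: "A \<in> carrier_mat m n"
  shows "mat_opnorm n (c \<cdot>\<^sub>m A) \<le> cmod c * mat_opnorm n A"
proof (rule opnorm_le[where m = m])
  fix v :: "complex vec" assume v: "v \<in> carrier_vec n"
  have "vec_norm2 ((c \<cdot>\<^sub>m A) *\<^sub>v v) = vec_norm2 (c \<cdot>\<^sub>v (A *\<^sub>v v))"
    using A v by (intro arg_cong[of _ _ vec_norm2] eq_vecI) auto
  also have "\<dots> \<le> cmod c * (mat_opnorm n A * vec_norm2 v)"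
    unfolding vec_norm2_smult by (intro mult_left_mono opnorm_bound[OF A v]) auto
  finally show "vec_norm2 ((c \<cdot>\<^sub>m A) *\<^sub>v v) \<le> cmod c * mat_opnorm n A * vec_norm2 v"
    by (simp add: mult_ac)
qed (use A opnorm_nonneg[OF A] in auto)

lemma opnorm_mult:
  assumes A: "A \<in> carrier_mat m n" and B: "B \<in> carrier_mat n p"
  shows "mat_opnorm p (A * B) \<le> mat_opnorm n A * mat_opnorm p B"
proof (rule opnorm_le[where m = m])
  fix v :: "complex vec" assume v: "v \<in> carrier_vec p"
  have "vec_norm2 (A * B *\<^sub>v v) = vec_norm2 (A *\<^sub>v (B *\<^sub>v v))"
    using A B v by simp
  also have "\<dots> \<le> mat_opnorm n A * vec_norm2 (B *\<^sub>v v)"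
    using A B v by (intro opnorm_bound[where m = m]) auto
  also have "\<dots> \<le> mat_opnorm n A * (mat_opnorm p B * vec_norm2 v)"
    using A B v by (intro mult_left_mono opnorm_bound) auto
  finally show "vec_norm2 (A * B *\<^sub>v v) \<le> mat_opnorm n A * mat_opnorm p B * vec_norm2 v"
    by (simp add: mult_ac)
qed (use A B in auto)

lemma opnorm_one_le: "mat_opnorm n (1\<^sub>m n) \<le> 1"
  by (rule opnorm_le[where m = n]) auto

lemma opnorm_adjoint_le:
  assumes A: "A \<in> carrier_mat m n"
  shows "mat_opnorm m (mat_adjoint A) \<le> mat_opnorm n A"
proof (rule opnorm_le[where m = n])
  fix v :: "complex vec" assume v: "v \<in> carrier_vec m"
  let ?w = "mat_adjoint A *\<^sub>v v"
  have w: "?w \<in> carrier_vec n"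
    using A v by (intro mult_mat_vec_carrier[where n = m]) auto
  have "(vec_norm2 ?w)\<^sup>2 = cmod (?w \<bullet>c ?w)"
    by (simp add: vec_norm2_square norm_power)
  also have "\<dots> = cmod ((A *\<^sub>v ?w) \<bullet>c v)"
    using mult_mat_vec_adjoint[OF A w v] by simp
  also have "\<dots> \<le> vec_norm2 (A *\<^sub>v ?w) * vec_norm2 v"
    using A v w by (intro cscalar_prod_le[where n = m]) auto
  also have "\<dots> \<le> mat_opnorm n A * vec_norm2 ?w * vec_norm2 v"
    by (intro mult_right_mono opnorm_bound[OF A w]) auto
  finally have "vec_norm2 ?w * vec_norm2 ?w \<le> mat_opnorm n A * vec_norm2 v * vec_norm2 ?w"
    by (simp add: power2_eq_square mult_ac)
  then show "vec_norm2 ?w \<le> mat_opnorm n A * vec_norm2 v"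
    using A by (cases "vec_norm2 ?w = 0") (auto simp: order_less_le)
qed (use A in auto)

lemma opnorm_adjoint:
  assumes A: "A \<in> carrier_mat m n"
  shows "mat_opnorm m (mat_adjoint A) = mat_opnorm n A"
  using opnorm_adjoint_le[OF A] opnorm_adjoint_le[of "mat_adjoint A" n m] A by auto

text \<open>The inequality comes from \<open>|A v|\<^sup>2 = \<langle>A\<^sup>* A v, v\<rangle>\<close>.\<close>

lemma opnorm_cstar_le:
  assumes A: "A \<in> carrier_mat m n"
  shows "(mat_opnorm n A)\<^sup>2 \<le> mat_opnorm n (mat_adjoint A * A)"
proof -
  let ?B = "mat_adjoint A * A"
  have B: "?B \<in> carrier_mat n n" using A by auto
  have "mat_opnorm n A \<le> sqrt (mat_opnorm n ?B)"
  proof (rule opnorm_le[OF A])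
    fix v :: "complex vec" assume v: "v \<in> carrier_vec n"
    have Av: "A *\<^sub>v v \<in> carrier_vec m" using A v by auto
    have "(vec_norm2 (A *\<^sub>v v))\<^sup>2 = cmod ((A *\<^sub>v v) \<bullet>c (A *\<^sub>v v))"
      by (simp add: vec_norm2_square norm_power)
    also have "\<dots> = cmod (v \<bullet>c (?B *\<^sub>v v))"
      using mult_mat_vec_adjoint[OF A v Av] assoc_mult_mat_vec[OF mat_adjoint_carrier[OF A] A v]
      by simp
    also have "\<dots> \<le> vec_norm2 v * vec_norm2 (?B *\<^sub>v v)"
      using B v by (intro cscalar_prod_le[where n = n]) auto
    also have "\<dots> \<le> vec_norm2 v * (mat_opnorm n ?B * vec_norm2 v)"
      by (intro mult_left_mono opnorm_bound[OF B v]) auto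
    also have "\<dots> = (sqrt (mat_opnorm n ?B) * vec_norm2 v)\<^sup>2"
      using B by (simp add: power_mult_distrib power2_eq_square)
    finally show "vec_norm2 (A *\<^sub>v v) \<le> sqrt (mat_opnorm n ?B) * vec_norm2 v"
      by (rule power2_le_imp_le) (use B in auto)
  qed (use B in auto)
  then have "(mat_opnorm n A)\<^sup>2 \<le> (sqrt (mat_opnorm n ?B))\<^sup>2"
    using A by (intro power_mono) auto
  then show ?thesis using B by simp
qed

lemma fro_norm_mult_left:
  assumes A: "A \<in> carrier_mat m n" and B: "B \<in> carrier_mat n p"
  shows "fro_norm (A * B) \<le> mat_opnorm n A * fro_norm B"
proof -
  have "(fro_norm (A * B))\<^sup>2 = (\<Sum>j<p. (vec_norm2 (col (A * B) j))\<^sup>2)"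
    unfolding fro_norm_power2_cols using B by (simp only: index_mult_mat carrier_matD)
  also have "\<dots> = (\<Sum>j<p. (vec_norm2 (A *\<^sub>v col B j))\<^sup>2)"
    by (intro sum.cong refl) (simp only: lessThan_iff col_mult2[OF A B])
  also have "\<dots> \<le> (\<Sum>j<p. (mat_opnorm n A * vec_norm2 (col B j))\<^sup>2)"
    using A B by (intro sum_mono power_mono opnorm_bound) auto
  also have "\<dots> = (mat_opnorm n A * fro_norm B)\<^sup>2"
    using B by (simp add: power_mult_distrib fro_norm_power2_cols sum_distrib_left)
  finally show ?thesis by (rule power2_le_imp_le) (use A in auto)
qed

lemma fro_norm_mult_right:
  assumes A: "A \<in> carrier_mat m n" and B: "B \<in> carrier_mat n p"
  shows "fro_norm (A * B) \<le> fro_norm A * mat_opnorm p B"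
proof -
  have "fro_norm (A * B) = fro_norm (mat_adjoint B * mat_adjoint A)"
    using mat_adjoint_mult[OF A B] fro_norm_adjoint[of "A * B"] by simp
  also have "\<dots> \<le> mat_opnorm n (mat_adjoint B) * fro_norm (mat_adjoint A)"
    using A B by (intro fro_norm_mult_left[where m = p and p = m]) auto
  also have "\<dots> = fro_norm A * mat_opnorm p B"
    using opnorm_adjoint[OF B] by (simp add: mult.commute)
  finally show ?thesis .
qed

section \<open>The normalised trace\<close>

lemma mat_norm2_eq_fro:
  assumes A: "A \<in> carrier_mat N N"
  shows "mat_norm2 N A = fro_norm A / sqrt (real N)"
proof -
  have "Re (mat_tr N (mat_adjoint A * A)) = (\<Sum>j<N. \<Sum>i<N. (cmod (A $$ (i, j)))\<^sup>2)"
    using A by (simp add: mat_tr_def scalar_prod_def lessThan_atLeast0 cmod_power2 sum.distrib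
        flip: power2_eq_square)
  also have "\<dots> = (fro_norm A)\<^sup>2"
    using A unfolding fro_norm_power2 by (subst sum.swap) auto
  finally show ?thesis
    by (simp add: mat_norm2_def real_sqrt_divide)
qed

lemma mat_tr_commute:
  assumes "A \<in> carrier_mat N N" "B \<in> carrier_mat N N"
  shows "mat_tr N (A * B) = mat_tr N (B * A)"
proof -
  have "mat_tr N (A * B) = (\<Sum>i<N. \<Sum>j<N. A $$ (i, j) * B $$ (j, i))"
    using assms by (auto simp: mat_tr_def scalar_prod_def lessThan_atLeast0)
  also have "\<dots> = (\<Sum>j<N. \<Sum>i<N. A $$ (i, j) * B $$ (j, i))"
    by (rule sum.swap)
  also have "\<dots> = mat_tr N (B * A)"
    using assms by (auto simp: mat_tr_def scalar_prod_def lessThan_atLeast0 mult.commute)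
  finally show ?thesis .
qed

definition abs_ntr :: "nat \<Rightarrow> complex mat \<Rightarrow> real" where
  "abs_ntr N X = cmod (mat_tr N X / of_nat N)"

lemma mat_tr_add:
  "A \<in> carrier_mat N N \<Longrightarrow> B \<in> carrier_mat N N \<Longrightarrow> mat_tr N (A + B) = mat_tr N A + mat_tr N B"
  by (simp add: mat_tr_def sum.distrib)

lemma mat_tr_le_fro:
  assumes A: "A \<in> carrier_mat N N"
  shows "cmod (mat_tr N A) \<le> sqrt (real N) * fro_norm A"
proof -
  have "(cmod (mat_tr N A))\<^sup>2 \<le> (\<Sum>i<N. 1 * cmod (A $$ (i, i)))\<^sup>2"
    unfolding mat_tr_def by (intro power_mono) (auto intro: norm_sum)
  also have "\<dots> \<le> (\<Sum>i<N. 1\<^sup>2) * (\<Sum>i<N. (cmod (A $$ (i, i)))\<^sup>2)"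
    by (rule Cauchy_Schwarz_ineq_sum)
  also have "\<dots> \<le> (\<Sum>i<N. 1\<^sup>2) * (\<Sum>i<N. \<Sum>j<N. (cmod (A $$ (i, j)))\<^sup>2)"
    by (intro mult_left_mono sum_mono member_le_sum) auto
  also have "\<dots> = (sqrt (real N) * fro_norm A)\<^sup>2"
    using A by (simp add: power_mult_distrib fro_norm_power2)
  finally show ?thesis by (rule power2_le_imp_le) simp
qed

lemma abs_ntr_le_norm2:
  assumes A: "A \<in> carrier_mat N N"
  shows "abs_ntr N A \<le> mat_norm2 N A"
proof (cases "N = 0")
  case False
  have "abs_ntr N A = cmod (mat_tr N A) / real N"
    by (simp add: abs_ntr_def norm_divide)
  also have "\<dots> \<le> sqrt (real N) * fro_norm A / (sqrt (real N) * sqrt (real N))"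
    using mat_tr_le_fro[OF A] by (simp add: divide_right_mono)
  also have "\<dots> = mat_norm2 N A"
    unfolding mat_norm2_eq_fro[OF A] using False by (subst mult_divide_mult_cancel_left) auto
  finally show ?thesis .
qed (use A in \<open>simp add: abs_ntr_def mat_norm2_def\<close>)

lemma mat_norm2_le_opnorm:
  assumes A: "A \<in> carrier_mat N N"
  shows "mat_norm2 N A \<le> mat_opnorm N A"
proof -
  have "(fro_norm (1\<^sub>m N))\<^sup>2 = real N"
    by (simp add: fro_norm_power2 if_distrib[where f = "\<lambda>x. (cmod x)\<^sup>2"] cong: if_cong)
  then have "fro_norm (1\<^sub>m N) = sqrt (real N)"
    by (metis fro_norm_nonneg real_sqrt_unique)
  then have "fro_norm A \<le> mat_opnorm N A * sqrt (real N)"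
    using fro_norm_mult_left[OF A one_carrier_mat] A by simp
  then have "0 < N \<Longrightarrow> mat_norm2 N A \<le> mat_opnorm N A"
    by (simp add: mat_norm2_eq_fro[OF A] divide_simps)
  then show ?thesis
    using opnorm_nonneg[OF A] by (cases "N = 0") (auto simp: mat_norm2_def)
qed

section \<open>Truncation of singular values\<close>

lemma isometry_iff:
  fixes W :: "complex mat"
  assumes W: "W \<in> carrier_mat n k"
  shows "mat_adjoint W * W = 1\<^sub>m k \<longleftrightarrow>
    (\<forall>i<k. \<forall>j<k. (\<Sum>r<n. cnj (W $$ (r, i)) * W $$ (r, j)) = (if i = j then 1 else 0))"
proof -
  have "(mat_adjoint W * W) $$ (i, j) = (\<Sum>r<n. cnj (W $$ (r, i)) * W $$ (r, j))"
    if "i < k" "j < k" for i j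
    using W that by (simp add: scalar_prod_def lessThan_atLeast0)
  then show ?thesis
    using W by (auto simp: mat_eq_iff)
qed

lemma isometry_vec_norm2:
  assumes W: "W \<in> carrier_mat n k" and iso: "mat_adjoint W * W = 1\<^sub>m k" and v: "v \<in> carrier_vec k"
  shows "vec_norm2 (W *\<^sub>v v) = vec_norm2 v"
proof -
  have Wv: "W *\<^sub>v v \<in> carrier_vec n" using W v by auto
  have "complex_of_real ((vec_norm2 (W *\<^sub>v v))\<^sup>2) = v \<bullet>c (mat_adjoint W *\<^sub>v (W *\<^sub>v v))"
    using mult_mat_vec_adjoint[OF W v Wv] by (simp only: vec_norm2_square)
  also have "\<dots> = complex_of_real ((vec_norm2 v)\<^sup>2)"
    using assoc_mult_mat_vec[OF mat_adjoint_carrier[OF W] W v] iso v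
    by (simp add: vec_norm2_square)
  finally have "(vec_norm2 (W *\<^sub>v v))\<^sup>2 = (vec_norm2 v)\<^sup>2"
    by (simp only: of_real_eq_iff)
  then show ?thesis by simp
qed

lemma isometry_opnorm_le:
  assumes "W \<in> carrier_mat n k" "mat_adjoint W * W = 1\<^sub>m k"
  shows "mat_opnorm k W \<le> 1"
  by (rule opnorm_le[OF assms(1)]) (simp_all add: isometry_vec_norm2[OF assms])

text \<open>Bessel's inequality for the columns of an isometry.\<close>

lemma isometry_stretch_le_fro:
  assumes X: "X \<in> carrier_mat m n" and W: "W \<in> carrier_mat n k" and iso: "mat_adjoint W * W = 1\<^sub>m k"
    and large: "\<And>j. j < k \<Longrightarrow> t \<le> vec_norm2 (X *\<^sub>v col W j)" and t: "0 \<le> t"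
  shows "real k * t\<^sup>2 \<le> (fro_norm X)\<^sup>2"
proof -
  have "real k * t\<^sup>2 = (\<Sum>j<k. t\<^sup>2)" by simp
  also have "\<dots> \<le> (\<Sum>j<k. (vec_norm2 (X *\<^sub>v col W j))\<^sup>2)"
    using t large by (intro sum_mono power_mono) auto
  also have "\<dots> = (\<Sum>j<k. (vec_norm2 (col (X * W) j))\<^sup>2)"
    by (intro sum.cong refl) (simp only: lessThan_iff col_mult2[OF X W])
  also have "\<dots> = (fro_norm (X * W))\<^sup>2"
    unfolding fro_norm_power2_cols using W by (simp only: index_mult_mat carrier_matD)
  also have "\<dots> \<le> (fro_norm X * mat_opnorm k W)\<^sup>2"
    by (intro power_mono fro_norm_mult_right[OF X W]) auto
  also have "\<dots> \<le> (fro_norm X)\<^sup>2"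
    using isometry_opnorm_le[OF W iso] opnorm_nonneg[OF W]
    by (intro power_mono) (auto simp: mult_left_le)
  finally show ?thesis .
qed

text \<open>A maximal family of orthonormal vectors that \<open>X\<close> stretches by more than \<open>t\<close> plays the part
  of the spectral projection of \<open>X\<^sup>* X\<close> for \<open>(t\<^sup>2, \<infinity>)\<close>: a vector orthogonal to the
  family and stretched by more than \<open>t\<close> could be added to it.\<close>

lemma greedy_orthonormal:
  assumes X: "X \<in> carrier_mat m n" and t: "0 < t"
  obtains W k where "W \<in> carrier_mat n k" "mat_adjoint W * W = 1\<^sub>m k"
    "\<And>j. j < k \<Longrightarrow> t < vec_norm2 (X *\<^sub>v col W j)"
    "mat_opnorm n (X - X * W * mat_adjoint W) \<le> t"
proof -
  define Good where "Good k W \<longleftrightarrow> W \<in> carrier_mat n k \<and> mat_adjoint W * W = 1\<^sub>m k \<and>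
    (\<forall>j<k. t < vec_norm2 (X *\<^sub>v col W j))" for k and W :: "complex mat"
  have bound: "k \<le> nat \<lceil>(fro_norm X)\<^sup>2 / t\<^sup>2\<rceil>" if "\<exists>W. Good k W" for k
  proof -
    from that obtain W where W: "W \<in> carrier_mat n k" and iso: "mat_adjoint W * W = 1\<^sub>m k"
      and large: "\<And>j. j < k \<Longrightarrow> t < vec_norm2 (X *\<^sub>v col W j)"
      by (auto simp: Good_def)
    have "real k * t\<^sup>2 \<le> (fro_norm X)\<^sup>2"
      by (rule isometry_stretch_le_fro[OF X W iso]) (use t large in \<open>auto intro: less_imp_le\<close>)
    then have "real k \<le> (fro_norm X)\<^sup>2 / t\<^sup>2"
      using t by (simp add: field_simps)
    then show ?thesis by linarith
  qed
  have "\<exists>W. Good 0 W"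
    by (rule exI[of _ "0\<^sub>m n 0"]) (auto simp: Good_def)
  then obtain k where ex: "\<exists>W. Good k W" and max: "\<And>l. \<exists>W. Good l W \<Longrightarrow> l \<le> k"
    using Nat.ex_has_greatest_nat[of "\<lambda>k. \<exists>W. Good k W" 0 "nat \<lceil>(fro_norm X)\<^sup>2 / t\<^sup>2\<rceil>"] bound
    by blast
  then obtain W where W: "W \<in> carrier_mat n k" and iso: "mat_adjoint W * W = 1\<^sub>m k"
    and large: "\<And>j. j < k \<Longrightarrow> t < vec_norm2 (X *\<^sub>v col W j)"
    by (auto simp: Good_def)
  have aW: "mat_adjoint W \<in> carrier_mat k n" using W by auto
  have small: "vec_norm2 (X *\<^sub>v u) \<le> t * vec_norm2 u"
    if u: "u \<in> carrier_vec n" and orth: "mat_adjoint W *\<^sub>v u = 0\<^sub>v k" for u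
  proof (rule ccontr)
    assume "\<not> ?thesis"
    then have gt: "t * vec_norm2 u < vec_norm2 (X *\<^sub>v u)" by simp
    have "vec_norm2 u \<noteq> 0"
      using opnorm_bound[OF X u] gt by auto
    then have pos: "0 < vec_norm2 u" by (simp add: order_less_le)
    define c where "c = complex_of_real (1 / vec_norm2 u)"
    define e where "e = c \<cdot>\<^sub>v u"
    have e: "e \<in> carrier_vec n" using u by (simp add: e_def)
    have Xe: "t < vec_norm2 (X *\<^sub>v e)"
      using gt pos mult_mat_vec[OF X u, of c]
      by (simp add: e_def vec_norm2_smult c_def norm_divide field_simps)
    have "vec_norm2 e = 1" using pos by (simp add: e_def vec_norm2_smult c_def norm_divide)
    then have "e \<bullet>c e = 1" by (simp add: vec_norm2_square)
    then have ee: "(\<Sum>r<n. cnj (e $ r) * e $ r) = 1"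
      using e by (simp add: scalar_prod_def lessThan_atLeast0 mult.commute)
    have orth_e: "mat_adjoint W *\<^sub>v e = 0\<^sub>v k"
      unfolding e_def mult_mat_vec[OF aW u] orth by (intro eq_vecI) auto
    have We: "(\<Sum>r<n. cnj (W $$ (r, i)) * e $ r) = 0" if "i < k" for i
    proof -
      have "(mat_adjoint W *\<^sub>v e) $ i = (\<Sum>r<n. cnj (W $$ (r, i)) * e $ r)"
        using that W e by (simp add: scalar_prod_def lessThan_atLeast0)
      then show ?thesis using that orth_e by simp
    qed
    have eW: "(\<Sum>r<n. cnj (e $ r) * W $$ (r, i)) = 0" if "i < k" for i
    proof -
      have "(\<Sum>r<n. cnj (e $ r) * W $$ (r, i)) = cnj (\<Sum>r<n. cnj (W $$ (r, i)) * e $ r)"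
        by (simp add: mult.commute)
      then show ?thesis using We[OF that] by simp
    qed
    define W' where "W' = mat n (Suc k) (\<lambda>(r, j). if j < k then W $$ (r, j) else e $ r)"
    have W': "W' \<in> carrier_mat n (Suc k)" by (simp add: W'_def)
    have WW: "(\<Sum>r<n. cnj (W $$ (r, i)) * W $$ (r, j)) = (if i = j then 1 else 0)"
      if "i < k" "j < k" for i j
      using iso isometry_iff[OF W] that by blast
    have "(\<Sum>r<n. cnj (W' $$ (r, i)) * W' $$ (r, j)) = (if i = j then 1 else 0)"
      if i: "i < Suc k" and j: "j < Suc k" for i j
    proof -
      have "(\<Sum>r<n. cnj (W' $$ (r, i)) * W' $$ (r, j)) =
        (\<Sum>r<n. cnj (if i < k then W $$ (r, i) else e $ r) * (if j < k then W $$ (r, j) else e $ r))"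
        using i j by (simp add: W'_def)
      also have "\<dots> = (if i = j then 1 else 0)"
        using i j WW We eW ee by (cases "i < k"; cases "j < k") auto
      finally show ?thesis .
    qed
    then have "mat_adjoint W' * W' = 1\<^sub>m (Suc k)"
      using isometry_iff[OF W'] by blast
    moreover have "t < vec_norm2 (X *\<^sub>v col W' j)" if "j < Suc k" for j
    proof -
      have "col W' j = (if j < k then col W j else e)"
        using that W e by (auto simp: W'_def intro!: eq_vecI)
      then show ?thesis using large Xe by simp
    qed
    ultimately have "Good (Suc k) W'" using W' by (simp add: Good_def)
    then show False using max[of "Suc k"] by auto
  qed
  have "mat_opnorm n (X - X * W * mat_adjoint W) \<le> t"
  proof (rule opnorm_le[where m = m])
    fix v :: "complex vec" assume v: "v \<in> carrier_vec n"
    let ?w = "mat_adjoint W *\<^sub>v v"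
    have w: "?w \<in> carrier_vec k" using aW v by auto
    have Ww: "W *\<^sub>v ?w \<in> carrier_vec n" using W w by auto
    define u where "u = v - W *\<^sub>v ?w"
    have u: "u \<in> carrier_vec n" using v Ww by (simp add: u_def)
    have "mat_adjoint W *\<^sub>v (W *\<^sub>v ?w) = ?w"
      using assoc_mult_mat_vec[OF aW W w] iso w by simp
    then have orth: "mat_adjoint W *\<^sub>v u = 0\<^sub>v k"
      using mult_minus_distrib_mat_vec[OF aW v Ww] w by (simp add: u_def)
    have "complex_of_real ((vec_norm2 u)\<^sup>2) = u \<bullet>c u"
      by (rule vec_norm2_square[symmetric])
    also have "\<dots> = v \<bullet>c u - (W *\<^sub>v ?w) \<bullet>c u"
      using minus_scalar_prod_distrib[OF v Ww, of "conjugate u"] u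
      unfolding u_def[symmetric] by auto
    also have "(W *\<^sub>v ?w) \<bullet>c u = 0"
      unfolding mult_mat_vec_adjoint[OF W w u] orth using w by (simp add: scalar_prod_def)
    finally have "(vec_norm2 u)\<^sup>2 = cmod (v \<bullet>c u)"
      by (metis diff_zero norm_of_real abs_power2)
    also have "\<dots> \<le> vec_norm2 v * vec_norm2 u" by (rule cscalar_prod_le[OF v u])
    finally have "vec_norm2 u * vec_norm2 u \<le> vec_norm2 v * vec_norm2 u"
      by (simp add: power2_eq_square)
    then have uv: "vec_norm2 u \<le> vec_norm2 v"
      by (cases "vec_norm2 u = 0") (auto simp: order_less_le)
    have "(X - X * W * mat_adjoint W) *\<^sub>v v = X *\<^sub>v v - X * W * mat_adjoint W *\<^sub>v v"
      using X W aW v by (intro minus_mult_distrib_mat_vec[where nr = m and nc = n]) auto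
    also have "X * W * mat_adjoint W *\<^sub>v v = X *\<^sub>v (W *\<^sub>v ?w)"
      using X W aW v w assoc_mult_mat_vec[OF mult_carrier_mat[OF X W] aW v]
        assoc_mult_mat_vec[OF X W w] by simp
    also have "X *\<^sub>v v - X *\<^sub>v (W *\<^sub>v ?w) = X *\<^sub>v u"
      using mult_minus_distrib_mat_vec[OF X v Ww] by (simp add: u_def)
    finally show "vec_norm2 ((X - X * W * mat_adjoint W) *\<^sub>v v) \<le> t * vec_norm2 v"
      using small[OF u orth] uv t by (metis less_imp_le mult_left_mono order_trans)
  qed (use X W aW t in auto)
  then show ?thesis using that W iso large by blast
qed

text \<open>Each vector that the greedy choice takes contributes more than \<open>t\<^sup>2\<close> to the squared
  Frobenius norm, so the rank of the part of \<open>X\<close> that exceeds \<open>t\<close> is controlled.\<close>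

lemma low_rank_approximation:
  assumes X: "X \<in> carrier_mat N N" and t: "0 < t" and fro: "(fro_norm X)\<^sup>2 \<le> real k * t\<^sup>2"
  obtains Y Z where "Y \<in> carrier_mat N k" "Z \<in> carrier_mat k N" "mat_opnorm k Y \<le> mat_opnorm N X"
    "mat_opnorm N Z \<le> 1" "mat_opnorm N (X - Y * Z) \<le> t"
proof -
  obtain W l where W: "W \<in> carrier_mat N l" and iso: "mat_adjoint W * W = 1\<^sub>m l"
    and large: "\<And>j. j < l \<Longrightarrow> t < vec_norm2 (X *\<^sub>v col W j)"
    and close: "mat_opnorm N (X - X * W * mat_adjoint W) \<le> t"
    using greedy_orthonormal[OF X t] by metis
  have aW: "mat_adjoint W \<in> carrier_mat l N" using W by auto
  have "real l * t\<^sup>2 \<le> (fro_norm X)\<^sup>2"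
    by (rule isometry_stretch_le_fro[OF X W iso]) (use t large in \<open>auto intro: less_imp_le\<close>)
  then have "real l * t\<^sup>2 \<le> real k * t\<^sup>2" using fro by linarith
  then have lk: "l \<le> k" using t by simp
  \<comment> \<open>zero columns bring the width to \<open>k\<close>, so that one net serves all \<open>X\<close>\<close>
  define V where "V = mat N k (\<lambda>(r, j). if j < l then W $$ (r, j) else 0)"
  have V: "V \<in> carrier_mat N k" and aV: "mat_adjoint V \<in> carrier_mat k N" by (auto simp: V_def)
  have VV: "V * mat_adjoint V = W * mat_adjoint W"
  proof (rule eq_matI)
    fix i j assume "i < dim_row (W * mat_adjoint W)" "j < dim_col (W * mat_adjoint W)"
    then have ij: "i < N" "j < N" using W by auto
    have "(V * mat_adjoint V) $$ (i, j) =
        (\<Sum>r\<in>{..<k}. (if r < l then W $$ (i, r) * cnj (W $$ (j, r)) else 0))"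
      using ij V by (auto simp: scalar_prod_def lessThan_atLeast0 V_def intro!: sum.cong)
    also have "\<dots> = (\<Sum>r\<in>{..<l}. W $$ (i, r) * cnj (W $$ (j, r)))"
      using lk by (intro sum.mono_neutral_cong_right) auto
    also have "\<dots> = (W * mat_adjoint W) $$ (i, j)"
      using ij W by (auto simp: scalar_prod_def lessThan_atLeast0)
    finally show "(V * mat_adjoint V) $$ (i, j) = (W * mat_adjoint W) $$ (i, j)" .
  qed (use V W in auto)
  have Z1: "mat_opnorm N (mat_adjoint V) \<le> 1"
  proof (rule opnorm_le[OF aV])
    fix v :: "complex vec" assume v: "v \<in> carrier_vec N"
    have "(vec_norm2 (mat_adjoint V *\<^sub>v v))\<^sup>2 =
        (\<Sum>j\<in>{..<k}. if j < l then (cmod ((mat_adjoint W *\<^sub>v v) $ j))\<^sup>2 else 0)"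
      unfolding vec_norm2_power2 using v V W lk
      by (auto simp: scalar_prod_def V_def intro!: sum.cong)
    also have "\<dots> = (\<Sum>j\<in>{..<l}. (cmod ((mat_adjoint W *\<^sub>v v) $ j))\<^sup>2)"
      using lk by (intro sum.mono_neutral_cong_right) auto
    also have "\<dots> = (vec_norm2 (mat_adjoint W *\<^sub>v v))\<^sup>2"
      using W by (simp add: vec_norm2_power2)
    finally have "vec_norm2 (mat_adjoint V *\<^sub>v v) = vec_norm2 (mat_adjoint W *\<^sub>v v)"
      by simp
    also have "\<dots> \<le> mat_opnorm N (mat_adjoint W) * vec_norm2 v"
      by (rule opnorm_bound[OF aW v])
    also have "\<dots> \<le> 1 * vec_norm2 v"
      using isometry_opnorm_le[OF W iso] opnorm_adjoint[OF W] by (intro mult_right_mono) auto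
    finally show "vec_norm2 (mat_adjoint V *\<^sub>v v) \<le> 1 * vec_norm2 v" .
  qed simp
  show ?thesis
  proof (rule that[of "X * V" "mat_adjoint V"])
    have "mat_opnorm k (X * V) \<le> mat_opnorm N X * mat_opnorm k V" by (rule opnorm_mult[OF X V])
    also have "\<dots> \<le> mat_opnorm N X"
      using Z1 opnorm_adjoint[OF V] opnorm_nonneg[OF X] opnorm_nonneg[OF V]
      by (simp add: mult_left_le)
    finally show "mat_opnorm k (X * V) \<le> mat_opnorm N X" .
    have "X * V * mat_adjoint V = X * W * mat_adjoint W"
      using assoc_mult_mat[OF X V aV] assoc_mult_mat[OF X W aW] VV by simp
    then show "mat_opnorm N (X - X * V * mat_adjoint V) \<le> t" using close by simp
  qed (use X V Z1 in auto)
qed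

lemma pow_mat_add:
  fixes T :: "complex mat"
  assumes T: "T \<in> carrier_mat n n"
  shows "T ^\<^sub>m (a + b) = T ^\<^sub>m a * T ^\<^sub>m b"
proof (induction b)
  case 0
  have "T ^\<^sub>m a \<in> carrier_mat n n" by (rule pow_carrier_mat[OF T])
  then show ?case using T by simp
next
  case (Suc b)
  have "T ^\<^sub>m a \<in> carrier_mat n n" "T ^\<^sub>m b \<in> carrier_mat n n" by (rule pow_carrier_mat[OF T])+
  then show ?case using Suc assoc_mult_mat[OF _ _ T] by simp
qed

lemma mat_adjoint_pow:
  fixes T :: "complex mat"
  assumes T: "T \<in> carrier_mat n n" and self: "mat_adjoint T = T"
  shows "mat_adjoint (T ^\<^sub>m k) = T ^\<^sub>m k"
proof (induction k)
  case 0
  show ?case using T by simp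
next
  case (Suc k)
  have Tk: "T ^\<^sub>m k \<in> carrier_mat n n" by (rule pow_carrier_mat[OF T])
  have "mat_adjoint (T ^\<^sub>m Suc k) = T * T ^\<^sub>m k"
    using mat_adjoint_mult[OF Tk T] Suc self by simp
  also have "\<dots> = T ^\<^sub>m (1 + k)" using pow_mat_add[OF T, of 1 k] T by simp
  finally show ?case by simp
qed

text \<open>A discrete form of Jensen's inequality for the spectral measure of \<open>X\<^sup>* X\<close> at a unit
  vector; for powers of two, repeated use of the Cauchy-Schwarz inequality gives it.\<close>

lemma moment_ge_power:
  assumes X: "X \<in> carrier_mat m n" and v: "v \<in> carrier_vec n" and unit: "vec_norm2 v = 1"
  shows "vec_norm2 (X *\<^sub>v v) ^ (2 * 2 ^ p) \<le> vec_norm2 ((mat_adjoint X * X) ^\<^sub>m (2 ^ p) *\<^sub>v v)"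
proof (induction p)
  case 0
  have Xv: "X *\<^sub>v v \<in> carrier_vec m" and T: "mat_adjoint X * X \<in> carrier_mat n n"
    using X v by auto
  have "(vec_norm2 (X *\<^sub>v v))\<^sup>2 = cmod ((X *\<^sub>v v) \<bullet>c (X *\<^sub>v v))"
    by (simp add: vec_norm2_square norm_power)
  also have "\<dots> = cmod (v \<bullet>c (mat_adjoint X * X *\<^sub>v v))"
    using mult_mat_vec_adjoint[OF X v Xv] assoc_mult_mat_vec[OF mat_adjoint_carrier[OF X] X v]
    by simp
  also have "\<dots> \<le> vec_norm2 v * vec_norm2 (mat_adjoint X * X *\<^sub>v v)"
    using T v by (intro cscalar_prod_le[where n = n]) auto
  finally show ?case using T unit X by simp
next
  case (Suc p)
  let ?T = "mat_adjoint X * X" and ?q = "2 ^ p :: nat"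
  have T: "?T \<in> carrier_mat n n" using X by auto
  have self: "mat_adjoint ?T = ?T" using mat_adjoint_mult[OF mat_adjoint_carrier[OF X] X] by simp
  have Tq: "?T ^\<^sub>m ?q \<in> carrier_mat n n" by (rule pow_carrier_mat[OF T])
  have Tqv: "?T ^\<^sub>m ?q *\<^sub>v v \<in> carrier_vec n" using Tq v by auto
  have T2: "?T ^\<^sub>m (2 ^ Suc p) *\<^sub>v v = ?T ^\<^sub>m ?q *\<^sub>v (?T ^\<^sub>m ?q *\<^sub>v v)"
    using pow_mat_add[OF T, of ?q ?q] assoc_mult_mat_vec[OF Tq Tq v] by (simp flip: mult_2)
  have T2c: "?T ^\<^sub>m (2 ^ Suc p) *\<^sub>v v \<in> carrier_vec n" unfolding T2 using Tq Tqv by auto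
  have "vec_norm2 (X *\<^sub>v v) ^ (2 * 2 ^ Suc p) = (vec_norm2 (X *\<^sub>v v) ^ (2 * ?q))\<^sup>2"
    by (simp flip: power_mult)
  also have "\<dots> \<le> (vec_norm2 (?T ^\<^sub>m ?q *\<^sub>v v))\<^sup>2"
    by (intro power_mono Suc.IH) auto
  also have "\<dots> = cmod ((?T ^\<^sub>m ?q *\<^sub>v v) \<bullet>c (?T ^\<^sub>m ?q *\<^sub>v v))"
    by (simp add: vec_norm2_square norm_power)
  also have "\<dots> = cmod (v \<bullet>c (?T ^\<^sub>m (2 ^ Suc p) *\<^sub>v v))"
    using mult_mat_vec_adjoint[OF Tq v Tqv] mat_adjoint_pow[OF T self, of ?q] T2 by simp
  also have "\<dots> \<le> vec_norm2 v * vec_norm2 (?T ^\<^sub>m (2 ^ Suc p) *\<^sub>v v)"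
    by (rule cscalar_prod_le[OF v T2c])
  finally show ?case using unit by simp
qed

text \<open>By Jensen's inequality each vector stretched by more than \<open>t\<close> contributes at least \<open>t\<^sup>2\<^sup>k\<close>
  to the trace of \<open>(X\<^sup>* X)\<^sup>k\<close>, where \<open>k\<close> is a power of two.  A moment of at most \<open>s\<^sup>2\<^sup>k\<close> leaves
  room for a proportion of at most \<open>(s/t)\<^sup>2\<^sup>k\<close> such vectors, and removing them costs at most
  \<open>M\<close> times the square root of that proportion.\<close>

lemma moment_truncation:
  assumes X: "X \<in> carrier_mat N N" and N: "0 < N" and M: "mat_opnorm N X \<le> M"
    and s: "0 \<le> s" "s < t"
    and moment: "abs_ntr N ((mat_adjoint X * X) ^\<^sub>m (2 ^ Suc p)) \<le> s ^ (2 * 2 ^ Suc p)"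
  obtains Y where "Y \<in> carrier_mat N N" "mat_opnorm N Y \<le> t"
    "mat_norm2 N (X - Y) \<le> M * (s / t) ^ (2 ^ Suc p)"
proof -
  have t: "0 < t" using s by linarith
  obtain W l where W: "W \<in> carrier_mat N l" and iso: "mat_adjoint W * W = 1\<^sub>m l"
    and large: "\<And>j. j < l \<Longrightarrow> t < vec_norm2 (X *\<^sub>v col W j)"
    and close: "mat_opnorm N (X - X * W * mat_adjoint W) \<le> t"
    using greedy_orthonormal[OF X t] by metis
  let ?T = "mat_adjoint X * X" and ?q = "2 ^ p :: nat"
  define Z where "Z = ?T ^\<^sub>m ?q"
  have aW: "mat_adjoint W \<in> carrier_mat l N" using W by auto
  have T: "?T \<in> carrier_mat N N" using X by auto
  have Z: "Z \<in> carrier_mat N N" unfolding Z_def by (rule pow_carrier_mat[OF T])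
  have self: "mat_adjoint ?T = ?T" using mat_adjoint_mult[OF mat_adjoint_carrier[OF X] X] by simp
  have unit: "vec_norm2 (col W j) = 1" if "j < l" for j
  proof -
    have "col W j \<bullet>c col W j = (\<Sum>r<N. cnj (W $$ (r, j)) * W $$ (r, j))"
      using W that by (simp add: scalar_prod_def lessThan_atLeast0 mult.commute)
    also have "\<dots> = 1" using iso isometry_iff[OF W] that by simp
    finally have "complex_of_real ((vec_norm2 (col W j))\<^sup>2) = complex_of_real 1"
      by (simp add: vec_norm2_square)
    then have "(vec_norm2 (col W j))\<^sup>2 = 1" by (simp only: of_real_eq_iff)
    then show ?thesis
      using power2_eq_1_iff[of "vec_norm2 (col W j)"] vec_norm2_nonneg[of "col W j"] by linarith
  qed
  have "real l * (t ^ (2 * ?q))\<^sup>2 \<le> (fro_norm Z)\<^sup>2"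
  proof (rule isometry_stretch_le_fro[OF Z W iso])
    fix j assume j: "j < l"
    have "t ^ (2 * ?q) \<le> vec_norm2 (X *\<^sub>v col W j) ^ (2 * ?q)"
      using t large[OF j] by (intro power_mono) auto
    also have "\<dots> \<le> vec_norm2 (Z *\<^sub>v col W j)"
      unfolding Z_def using j W unit by (intro moment_ge_power[OF X]) (auto simp: col_dim)
    finally show "t ^ (2 * ?q) \<le> vec_norm2 (Z *\<^sub>v col W j)" .
  qed (use t in auto)
  also have "\<dots> = real N * (mat_norm2 N Z)\<^sup>2"
    using N by (simp add: mat_norm2_eq_fro[OF Z] power_divide)
  also have "\<dots> = Re (mat_tr N (mat_adjoint Z * Z))"
  proof -
    have "0 \<le> Re (mat_tr N (mat_adjoint Z * Z))"
      using Z by (auto simp: mat_tr_def scalar_prod_def intro!: sum_nonneg add_nonneg_nonneg)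
    then show ?thesis using N by (simp add: mat_norm2_def)
  qed
  also have "mat_adjoint Z * Z = ?T ^\<^sub>m (2 ^ Suc p)"
    using pow_mat_add[OF T, of ?q ?q] mat_adjoint_pow[OF T self, of ?q]
    by (simp add: Z_def flip: mult_2)
  also have "Re (mat_tr N (?T ^\<^sub>m (2 ^ Suc p))) \<le> real N * abs_ntr N (?T ^\<^sub>m (2 ^ Suc p))"
    using N complex_Re_le_cmod by (simp add: abs_ntr_def norm_divide)
  also have "\<dots> \<le> real N * s ^ (2 * 2 ^ Suc p)"
    by (intro mult_left_mono moment) auto
  finally have l: "real l * t ^ (2 * 2 ^ Suc p) \<le> real N * s ^ (2 * 2 ^ Suc p)"
    by (simp add: mult_ac flip: power_mult)
  let ?Y = "X - X * W * mat_adjoint W"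
  have P: "X * W * mat_adjoint W \<in> carrier_mat N N" using X W aW by auto
  have XW: "X * W \<in> carrier_mat N l" using X W by auto
  have M0: "0 \<le> M" using opnorm_nonneg[OF X] M by linarith
  have XY: "X - ?Y = X * W * mat_adjoint W"
    using X P by (intro eq_matI) auto
  have "(fro_norm (X - ?Y))\<^sup>2 \<le> (fro_norm (X * W) * mat_opnorm N (mat_adjoint W))\<^sup>2"
    unfolding XY by (intro power_mono fro_norm_mult_right[OF XW aW]) auto
  also have "\<dots> \<le> (fro_norm (X * W))\<^sup>2"
    using isometry_opnorm_le[OF W iso] opnorm_nonneg[OF aW] opnorm_adjoint[OF W]
    by (intro power_mono) (auto simp: mult_left_le)
  also have "\<dots> = (\<Sum>j<l. (vec_norm2 (col (X * W) j))\<^sup>2)"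
    unfolding fro_norm_power2_cols using W by (simp only: index_mult_mat carrier_matD)
  also have "\<dots> = (\<Sum>j<l. (vec_norm2 (X *\<^sub>v col W j))\<^sup>2)"
    by (intro sum.cong refl) (simp only: lessThan_iff col_mult2[OF X W])
  also have "\<dots> \<le> (\<Sum>j<l. M\<^sup>2)"
  proof (intro sum_mono power_mono)
    fix j assume "j \<in> {..<l}"
    then show "vec_norm2 (X *\<^sub>v col W j) \<le> M"
      using opnorm_bound[OF X, of "col W j"] unit[of j] M col_dim[of W j] W by auto
  qed auto
  also have "\<dots> = real l * M\<^sup>2" by simp
  finally have "(fro_norm (X - ?Y))\<^sup>2 \<le> real l * M\<^sup>2" .
  then have "(fro_norm (X - ?Y))\<^sup>2 / real N \<le> real l * M\<^sup>2 / real N"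
    by (rule divide_right_mono) simp
  moreover have D: "X - ?Y \<in> carrier_mat N N" unfolding XY by (rule P)
  have "(mat_norm2 N (X - ?Y))\<^sup>2 = (fro_norm (X - ?Y))\<^sup>2 / real N"
    unfolding mat_norm2_eq_fro[OF D] power_divide by (simp only: real_sqrt_pow2 of_nat_0_le_iff)
  ultimately have "(mat_norm2 N (X - ?Y))\<^sup>2 \<le> M\<^sup>2 * (real l / real N)"
    by (simp only: mult.commute times_divide_eq_right)
  also have "\<dots> \<le> M\<^sup>2 * (s ^ (2 * 2 ^ Suc p) / t ^ (2 * 2 ^ Suc p))"
  proof (rule mult_left_mono)
    have "0 < t ^ (2 * 2 ^ Suc p)" using t by simp
    with l N show "real l / real N \<le> s ^ (2 * 2 ^ Suc p) / t ^ (2 * 2 ^ Suc p)"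
      by (simp only: divide_le_eq le_divide_eq of_nat_0_less_iff if_True times_divide_eq_left)
        (simp only: mult.commute)
  qed simp
  also have "\<dots> = (M * (s / t) ^ (2 ^ Suc p))\<^sup>2"
    by (simp only: power_mult_distrib power_divide power_even_eq)
  finally have "mat_norm2 N (X - ?Y) \<le> M * (s / t) ^ (2 ^ Suc p)"
    by (rule power2_le_imp_le) (use M0 s t in auto)
  then show ?thesis by (rule that[OF minus_carrier_mat[OF P] close])
qed

section \<open>Evaluation of noncommutative polynomials\<close>

definition word_in :: "'i set \<Rightarrow> 'i ncword \<Rightarrow> bool" where
  "word_in I w \<longleftrightarrow> fst ` set (letters w) \<subseteq> I"

lemma word_in_zero [simp]: "word_in I 0"
  by (simp add: word_in_def zero_ncword_def)

lemma word_in_plus [simp]: "word_in I (v + w) \<longleftrightarrow> word_in I v \<and> word_in I w"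
  by (auto simp: word_in_def plus_ncword_def)

lemma word_in_adj [simp]: "word_in I (word_adj w) \<longleftrightarrow> word_in I w"
  by (auto simp: word_in_def word_adj_def image_image split_def)

lemma ncpolys_iff: "P \<in> ncpolys I \<longleftrightarrow> (\<forall>w\<in>Poly_Mapping.keys P. word_in I w)"
  by (simp add: ncpolys_def word_in_def)

lemma ncpolys_single: "word_in I w \<Longrightarrow> Poly_Mapping.single w c \<in> ncpolys I"
  by (simp add: ncpolys_iff)

lemma ncpolys_add: "P \<in> ncpolys I \<Longrightarrow> Q \<in> ncpolys I \<Longrightarrow> P + Q \<in> ncpolys I"
  using Poly_Mapping.keys_add[of P Q] by (auto simp: ncpolys_iff)

lemma ncpolys_mult: "P \<in> ncpolys I \<Longrightarrow> Q \<in> ncpolys I \<Longrightarrow> P * Q \<in> ncpolys I"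
  using keys_mult[of P Q] by (fastforce simp: ncpolys_iff)

lemma ncpolys_sum: "(\<And>x. x \<in> S \<Longrightarrow> f x \<in> ncpolys I) \<Longrightarrow> sum f S \<in> ncpolys I"
  by (induction S rule: infinite_finite_induct) (auto intro: ncpolys_add simp: ncpolys_iff[of 0])

lemma ncpolys_adj: "P \<in> ncpolys I \<Longrightarrow> ncadj P \<in> ncpolys I"
  unfolding ncadj_def by (intro ncpolys_sum ncpolys_single) (simp add: ncpolys_iff)

lemma ncpolys_const: "ncconst c \<in> ncpolys I"
  unfolding ncconst_def by (rule ncpolys_single) simp

lemma ncpolys_one: "1 \<in> ncpolys I"
  using ncpolys_const[of 1 I] by (simp add: ncconst_def)

lemma ncpolys_var: "i \<in> I \<Longrightarrow> ncvar i \<in> ncpolys I"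
  unfolding ncvar_def by (rule ncpolys_single) (simp add: word_in_def)

lemma ncpolys_power: "P \<in> ncpolys I \<Longrightarrow> P ^ k \<in> ncpolys I"
  by (induction k) (auto intro: ncpolys_one ncpolys_mult)

lemma ncpolys_mono: "I \<subseteq> J \<Longrightarrow> ncpolys I \<subseteq> ncpolys J"
  by (auto simp: ncpolys_def)

lemma ncpolys_finite_support:
  assumes "P \<in> ncpolys I"
  obtains F where "finite F" "F \<subseteq> I" "P \<in> ncpolys F"
proof
  show "finite (\<Union>w\<in>Poly_Mapping.keys P. fst ` set (letters w))" by auto
  show "(\<Union>w\<in>Poly_Mapping.keys P. fst ` set (letters w)) \<subseteq> I"
    using assms by (auto simp: ncpolys_def)
  show "P \<in> ncpolys (\<Union>w\<in>Poly_Mapping.keys P. fst ` set (letters w))"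
    by (auto simp: ncpolys_def)
qed

lemma ncpoly_eq_sum_single:
  "P = (\<Sum>w\<in>Poly_Mapping.keys P. Poly_Mapping.single w (Poly_Mapping.lookup P w))"
  by (rule poly_mapping_eqI)
    (auto simp: lookup_sum lookup_single when_def in_keys_iff sum.delta)

lemma ncpolys_induct [consumes 1, case_names single add]:
  assumes "P \<in> ncpolys I"
    and single: "\<And>w c. word_in I w \<Longrightarrow> Pr (Poly_Mapping.single w c)"
    and add: "\<And>P Q. P \<in> ncpolys I \<Longrightarrow> Q \<in> ncpolys I \<Longrightarrow> Pr P \<Longrightarrow> Pr Q \<Longrightarrow> Pr (P + Q)"
  shows "Pr P"
proof -
  let ?s = "\<lambda>w. Poly_Mapping.single w (Poly_Mapping.lookup P w)"
  have "sum ?s S \<in> ncpolys I \<and> Pr (sum ?s S)" if "finite S" "S \<subseteq> Poly_Mapping.keys P" for S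
    using that
  proof (induction S)
    case empty
    then show ?case using single[of 0 0] ncpolys_single[of I 0 0] by simp
  next
    case (insert w S)
    then have "word_in I w" using assms(1) by (auto simp: ncpolys_iff)
    then show ?case using insert by (auto intro!: add single ncpolys_add ncpolys_single)
  qed
  from this[of "Poly_Mapping.keys P"] show ?thesis
    using ncpoly_eq_sum_single[of P] by simp
qed

subsection \<open>Evaluation in a C*-algebra\<close>

lemma scaleC_zero_left [simp]: "0 *\<^sub>C x = (0 :: 'a::cstar_algebra)"
  using scaleC_of_real[of 0 x] by simp

lemma scaleC_one [simp]: "1 *\<^sub>C x = (x :: 'a::cstar_algebra)"
  using scaleC_of_real[of 1 x] by simp

lemma adj_one [simp]: "adj 1 = (1 :: 'a::cstar_algebra)"
  by (metis adj_adj adj_mult mult.left_neutral mult.right_neutral)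

lemma adj_minus: "adj (x - y) = adj x - adj (y :: 'a::cstar_algebra)"
  using adj_add[of "x - y" y] by (simp add: algebra_simps)

lemma scaleC_minus1: "(-1) *\<^sub>C x = - (x :: 'a::cstar_algebra)"
  using scaleC_of_real[of "-1" x] by simp

lemma norm_adj [simp]: "norm (adj x) = norm (x :: 'a::cstar_algebra)"
proof -
  have "norm y \<le> norm (adj y)" for y :: 'a
  proof (cases "y = 0")
    case False
    have "norm y * norm y \<le> norm (adj y) * norm y"
      using cstar_identity[of y] norm_mult_ineq[of "adj y" y] by (simp add: power2_eq_square)
    then show ?thesis using False by simp
  qed simp
  from this[of x] this[of "adj x"] show ?thesis by (simp add: adj_adj)
qed

lemma word_eval_zero [simp]: "word_eval a 0 = 1"
  by (simp add: word_eval_def zero_ncword_def)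

lemma word_eval_plus: "word_eval a (v + w) = word_eval a v * word_eval a w"
  by (simp add: word_eval_def plus_ncword_def)

lemma word_eval_adj: "word_eval a (word_adj w) = adj (word_eval a w)"
proof -
  have "prod_list (map (\<lambda>(i, s). if s then adj (a i) else a i) (rev (map (\<lambda>(i, s). (i, \<not> s)) l)))
      = adj (prod_list (map (\<lambda>(i, s). if s then adj (a i) else a i) l))" for l
    by (induction l) (auto simp: adj_mult adj_adj)
  then show ?thesis by (simp add: word_eval_def word_adj_def)
qed

lemma nceval_superset:
  assumes "finite S" "Poly_Mapping.keys P \<subseteq> S"
  shows "nceval a P = (\<Sum>w\<in>S. Poly_Mapping.lookup P w *\<^sub>C word_eval a w)"
  unfolding nceval_def using assms
  by (intro sum.mono_neutral_left) (auto simp: in_keys_iff)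

lemma nceval_single [simp]: "nceval a (Poly_Mapping.single w c) = c *\<^sub>C word_eval a w"
  by (subst nceval_superset[of "{w}"]) auto

lemma nceval_add: "nceval a (P + Q) = nceval a P + nceval a Q"
proof -
  let ?S = "Poly_Mapping.keys P \<union> Poly_Mapping.keys Q"
  show ?thesis
    using Poly_Mapping.keys_add[of P Q]
    by (simp add: nceval_superset[of ?S] lookup_add scaleC_add_left sum.distrib)
qed

lemma ncpolys_UNIV [simp]: "P \<in> ncpolys UNIV"
  by (simp add: ncpolys_def)

lemma nceval_mult: "nceval a (P * Q) = nceval a P * nceval a Q"
proof -
  have "P \<in> ncpolys UNIV" "Q \<in> ncpolys UNIV" by simp_all
  then show ?thesis
  proof (induction P rule: ncpolys_induct)
    case (single v c)
    have "Q \<in> ncpolys UNIV" by simp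
    then show ?case
      by (induction Q rule: ncpolys_induct)
        (auto simp: mult_single word_eval_plus mult_scaleC_left mult_scaleC_right scaleC_scaleC
          nceval_add distrib_left mult.commute)
  qed (auto simp: nceval_add distrib_right)
qed

lemma nceval_const [simp]: "nceval a (ncconst c) = c *\<^sub>C 1"
  by (simp add: ncconst_def)

lemma nceval_one [simp]: "nceval a 1 = 1"
  by (simp flip: single_one)

lemma nceval_const_mult: "nceval a (ncconst c * P) = c *\<^sub>C nceval a P"
  by (simp add: nceval_mult mult_scaleC_left)

lemma nceval_var [simp]: "nceval a (ncvar i) = a i"
  by (simp add: ncvar_def word_eval_def)

lemma nceval_power: "nceval a (P ^ k) = nceval a P ^ k"
  by (induction k) (auto simp: nceval_mult)

lemma ncadj_superset:
  assumes "finite S" "Poly_Mapping.keys P \<subseteq> S"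
  shows "ncadj P = (\<Sum>w\<in>S. Poly_Mapping.single (word_adj w) (cnj (Poly_Mapping.lookup P w)))"
  unfolding ncadj_def using assms
  by (intro sum.mono_neutral_left) (auto simp: in_keys_iff)

lemma ncadj_single [simp]:
  "ncadj (Poly_Mapping.single w c) = Poly_Mapping.single (word_adj w) (cnj c)"
  by (subst ncadj_superset[of "{w}"]) auto

lemma ncadj_add: "ncadj (P + Q) = ncadj P + ncadj Q"
proof -
  let ?S = "Poly_Mapping.keys P \<union> Poly_Mapping.keys Q"
  show ?thesis
    using Poly_Mapping.keys_add[of P Q]
    by (simp add: ncadj_superset[of ?S] lookup_add single_add sum.distrib)
qed

lemma nceval_adj: "nceval a (ncadj P) = adj (nceval a P)"
proof -
  have "P \<in> ncpolys UNIV" by simp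
  then show ?thesis
    by (induction P rule: ncpolys_induct)
      (auto simp: ncadj_add nceval_add adj_add word_eval_adj adj_scaleC)
qed

subsection \<open>Evaluation in matrices\<close>

lemma mat_word_eval_NCWord:
  "mat_word_eval N A (NCWord []) = 1\<^sub>m N"
  "mat_word_eval N A (NCWord ((i, s) # l)) =
    (if s then mat_adjoint (A i) else A i) * mat_word_eval N A (NCWord l)"
  by (simp_all add: mat_word_eval_def)

lemma mat_word_eval_carrier:
  assumes A: "\<forall>i\<in>I. A i \<in> carrier_mat N N" and w: "word_in I w"
  shows "mat_word_eval N A w \<in> carrier_mat N N"
proof -
  have "fst ` set l \<subseteq> I \<Longrightarrow> mat_word_eval N A (NCWord l) \<in> carrier_mat N N" for l
  proof (induction l)
    case (Cons x l)
    obtain i s where x: "x = (i, s)" by force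
    have "A i \<in> carrier_mat N N" using A Cons.prems x by auto
    then have "(if s then mat_adjoint (A i) else A i) \<in> carrier_mat N N" by auto
    then show ?case using Cons by (simp add: x mat_word_eval_NCWord mult_carrier_mat[of _ N N _ N])
  qed (simp add: mat_word_eval_NCWord)
  then show ?thesis using w by (cases w) (auto simp: word_in_def)
qed

lemma mat_word_eval_plus:
  assumes A: "\<forall>i\<in>I. A i \<in> carrier_mat N N" and w: "word_in I w" and v: "word_in I v"
  shows "mat_word_eval N A (v + w) = mat_word_eval N A v * mat_word_eval N A w"
proof -
  have W: "mat_word_eval N A w \<in> carrier_mat N N" by (rule mat_word_eval_carrier[OF A w])
  have "fst ` set l \<subseteq> I \<Longrightarrow>
      mat_word_eval N A (NCWord l + w) = mat_word_eval N A (NCWord l) * mat_word_eval N A w" for l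
  proof (induction l)
    case Nil
    show ?case using W by (simp add: mat_word_eval_NCWord plus_ncword_def)
  next
    case (Cons x l)
    obtain i s where x: "x = (i, s)" by force
    have L: "mat_word_eval N A (NCWord l) \<in> carrier_mat N N"
      using Cons.prems by (intro mat_word_eval_carrier[OF A]) (auto simp: word_in_def)
    have "(if s then mat_adjoint (A i) else A i) \<in> carrier_mat N N"
      using A Cons.prems x by auto
    from assoc_mult_mat[OF this L W] Cons show ?case
      by (simp add: x plus_ncword_def mat_word_eval_NCWord)
  qed
  then show ?thesis using v by (cases v) (auto simp: word_in_def)
qed

lemma mat_word_eval_adj:
  assumes A: "\<forall>i\<in>I. A i \<in> carrier_mat N N" and w: "word_in I w"
  shows "mat_word_eval N A (word_adj w) = mat_adjoint (mat_word_eval N A w)"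
proof -
  have "fst ` set l \<subseteq> I \<Longrightarrow>
      mat_word_eval N A (word_adj (NCWord l)) = mat_adjoint (mat_word_eval N A (NCWord l))" for l
  proof (induction l)
    case Nil
    then show ?case by (simp add: word_adj_def mat_word_eval_NCWord)
  next
    case (Cons x l)
    obtain i s where x: "x = (i, s)" by force
    have i: "i \<in> I" and l: "word_in I (NCWord l)" using Cons.prems x by (auto simp: word_in_def)
    have L: "mat_word_eval N A (NCWord l) \<in> carrier_mat N N" by (rule mat_word_eval_carrier[OF A l])
    have Ai: "A i \<in> carrier_mat N N" using A i by blast
    have sh: "word_adj (NCWord (x # l)) = word_adj (NCWord l) + NCWord [(i, \<not> s)]"
      by (simp add: x word_adj_def plus_ncword_def)
    have "mat_word_eval N A (word_adj (NCWord (x # l))) =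
        mat_adjoint (mat_word_eval N A (NCWord l)) * mat_word_eval N A (NCWord [(i, \<not> s)])"
      unfolding sh using mat_word_eval_plus[OF A, of "NCWord [(i, \<not> s)]" "word_adj (NCWord l)"]
        Cons i l by (simp add: word_in_def[of I "NCWord [(i, \<not> s)]"])
    then show ?case
      using Ai mat_adjoint_mult[OF Ai L] mat_adjoint_mult[OF mat_adjoint_carrier[OF Ai] L]
      by (simp add: x mat_word_eval_NCWord)
  qed
  then show ?thesis using w by (cases w) (auto simp: word_in_def)
qed

lemma mat_nceval_carrier [simp, intro]: "mat_nceval N A P \<in> carrier_mat N N"
  by (simp add: mat_nceval_def)

lemma mat_nceval_dim [simp]: "dim_row (mat_nceval N A P) = N" "dim_col (mat_nceval N A P) = N"
  by (simp_all add: mat_nceval_def)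

lemma mat_nceval_superset:
  assumes "finite S" "Poly_Mapping.keys P \<subseteq> S" "i < N" "j < N"
  shows "mat_nceval N A P $$ (i, j) =
    (\<Sum>w\<in>S. Poly_Mapping.lookup P w * mat_word_eval N A w $$ (i, j))"
proof -
  have "mat_nceval N A P $$ (i, j) =
      (\<Sum>w\<in>Poly_Mapping.keys P. Poly_Mapping.lookup P w * mat_word_eval N A w $$ (i, j))"
    using assms by (simp add: mat_nceval_def)
  also have "\<dots> = (\<Sum>w\<in>S. Poly_Mapping.lookup P w * mat_word_eval N A w $$ (i, j))"
    using assms by (intro sum.mono_neutral_left) (auto simp: in_keys_iff)
  finally show ?thesis .
qed

lemma mat_nceval_single:
  assumes A: "\<forall>i\<in>I. A i \<in> carrier_mat N N" and w: "word_in I w"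
  shows "mat_nceval N A (Poly_Mapping.single w c) = c \<cdot>\<^sub>m mat_word_eval N A w"
  using mat_word_eval_carrier[OF A w]
  by (intro eq_matI) (auto simp: mat_nceval_superset[of "{w}"])

lemma mat_nceval_add: "mat_nceval N A (P + Q) = mat_nceval N A P + mat_nceval N A Q"
proof (rule eq_matI)
  let ?S = "Poly_Mapping.keys P \<union> Poly_Mapping.keys Q"
  fix i j assume "i < dim_row (mat_nceval N A P + mat_nceval N A Q)"
    "j < dim_col (mat_nceval N A P + mat_nceval N A Q)"
  then have "i < N" "j < N" by simp_all
  then show "mat_nceval N A (P + Q) $$ (i, j) = (mat_nceval N A P + mat_nceval N A Q) $$ (i, j)"
    using Poly_Mapping.keys_add[of P Q]
    by (simp add: mat_nceval_superset[of ?S] lookup_add sum.distrib distrib_right)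
qed auto

lemma mat_nceval_mult:
  assumes A: "\<forall>i\<in>I. A i \<in> carrier_mat N N"
    and P: "P \<in> ncpolys I" and Q: "Q \<in> ncpolys I"
  shows "mat_nceval N A (P * Q) = mat_nceval N A P * mat_nceval N A Q"
  using P
proof (induction P rule: ncpolys_induct)
  case (single v c)
  note v = single
  have V: "mat_word_eval N A v \<in> carrier_mat N N" by (rule mat_word_eval_carrier[OF A v])
  show ?case using Q
  proof (induction Q rule: ncpolys_induct)
    case (single w d)
    have W: "mat_word_eval N A w \<in> carrier_mat N N" by (rule mat_word_eval_carrier[OF A single])
    have "(c \<cdot>\<^sub>m mat_word_eval N A v) * (d \<cdot>\<^sub>m mat_word_eval N A w) =
        (c * d) \<cdot>\<^sub>m (mat_word_eval N A v * mat_word_eval N A w)"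
      using mult_smult_assoc_mat[OF V smult_carrier_mat[OF W], of c d]
        mult_smult_distrib[OF V W, of d] V W by (auto intro!: eq_matI)
    then show ?case
      by (simp add: mult_single mat_nceval_single[OF A] single v mat_word_eval_plus[OF A])
  next
    case (add P Q)
    then show ?case
      by (simp add: mat_nceval_add distrib_left
          mult_add_distrib_mat[OF mat_nceval_carrier mat_nceval_carrier mat_nceval_carrier])
  qed
next
  case (add P Q)
  then show ?case
    by (simp add: mat_nceval_add distrib_right
        add_mult_distrib_mat[OF mat_nceval_carrier mat_nceval_carrier mat_nceval_carrier])
qed

lemma mat_nceval_adj:
  assumes A: "\<forall>i\<in>I. A i \<in> carrier_mat N N" and P: "P \<in> ncpolys I"
  shows "mat_nceval N A (ncadj P) = mat_adjoint (mat_nceval N A P)"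
  using P
proof (induction P rule: ncpolys_induct)
  case (single w c)
  have W: "mat_word_eval N A w \<in> carrier_mat N N" by (rule mat_word_eval_carrier[OF A single])
  show ?case
    using W by (auto simp: mat_nceval_single[OF A] single mat_word_eval_adj[OF A] intro!: eq_matI)
next
  case (add P Q)
  then show ?case by (auto simp: ncadj_add mat_nceval_add intro!: eq_matI)
qed

lemma mat_nceval_const: "mat_nceval N A (ncconst c) = c \<cdot>\<^sub>m 1\<^sub>m N"
proof -
  have "mat_nceval N A (Poly_Mapping.single 0 c) = c \<cdot>\<^sub>m mat_word_eval N A 0"
    by (rule mat_nceval_single[where I = "{}"]) auto
  then show ?thesis by (simp add: ncconst_def zero_ncword_def mat_word_eval_NCWord)
qed

lemma mat_nceval_one: "mat_nceval N A 1 = 1\<^sub>m N"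
  using mat_nceval_const[of N A 1] by (auto simp: ncconst_def intro!: eq_matI)

lemma mat_nceval_const_mult:
  assumes "\<forall>i\<in>I. A i \<in> carrier_mat N N" "P \<in> ncpolys I"
  shows "mat_nceval N A (ncconst c * P) = c \<cdot>\<^sub>m mat_nceval N A P"
  using mat_nceval_mult[OF assms(1) ncpolys_const assms(2), of c]
    mult_smult_assoc_mat[OF one_carrier_mat, of "mat_nceval N A P" N N c]
  by (simp add: mat_nceval_const left_mult_one_mat[OF mat_nceval_carrier])

lemma mat_nceval_var:
  assumes A: "A i \<in> carrier_mat N N"
  shows "mat_nceval N A (ncvar i) = A i"
  using mat_nceval_single[of "{i}" A N "NCWord [(i, False)]" 1] A
  by (simp add: ncvar_def word_in_def mat_word_eval_NCWord) (auto intro!: eq_matI)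

lemma mat_nceval_power:
  assumes "\<forall>i\<in>I. A i \<in> carrier_mat N N" "P \<in> ncpolys I"
  shows "mat_nceval N A (P ^ k) = mat_nceval N A P ^\<^sub>m k"
proof (induction k)
  case 0
  show ?case by (simp add: mat_nceval_one)
next
  case (Suc k)
  have "mat_nceval N A (P ^ Suc k) = mat_nceval N A (P ^ k * P)"
    by (simp only: power_Suc2)
  also have "\<dots> = mat_nceval N A P ^\<^sub>m Suc k"
    using mat_nceval_mult[OF assms(1) ncpolys_power[OF assms(2)] assms(2)] Suc by simp
  finally show ?case .
qed

subsection \<open>Substitution\<close>

text \<open>Substitution of polynomials for the variables, as needed for composing approximations: one
  polynomial \<open>Q\<close> represents the composition in the C*-algebra and in all matrix algebras.\<close>

lemma ncpolys_substitute:
  fixes f :: "'j \<Rightarrow> 'i ncpoly"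
  assumes f: "\<And>j. j \<in> J \<Longrightarrow> f j \<in> ncpolys I" and P: "P \<in> ncpolys J"
  shows "\<exists>Q\<in>ncpolys I.
    (\<forall>a :: 'i \<Rightarrow> 'a::cstar_algebra. nceval a Q = nceval (\<lambda>j. nceval a (f j)) P) \<and>
    (\<forall>N A. (\<forall>i\<in>I. A i \<in> carrier_mat N N) \<longrightarrow>
       mat_nceval N A Q = mat_nceval N (\<lambda>j. mat_nceval N A (f j)) P)"
  (is "\<exists>Q\<in>_. ?subst Q P")
  using P
proof (induction P rule: ncpolys_induct)
  case (single w c)
  have "fst ` set l \<subseteq> J \<Longrightarrow> \<exists>Q\<in>ncpolys I.
    (\<forall>a :: 'i \<Rightarrow> 'a. nceval a Q = word_eval (\<lambda>j. nceval a (f j)) (NCWord l)) \<and>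
    (\<forall>N A. (\<forall>i\<in>I. A i \<in> carrier_mat N N) \<longrightarrow>
       mat_nceval N A Q = mat_word_eval N (\<lambda>j. mat_nceval N A (f j)) (NCWord l))" for l
  proof (induction l)
    case Nil
    show ?case
      by (rule bexI[of _ 1]) (simp_all add: ncpolys_one mat_nceval_one mat_word_eval_NCWord word_eval_def)
  next
    case (Cons x l)
    obtain j s where x: "x = (j, s)" by force
    have fj: "f j \<in> ncpolys I" using Cons.prems x by (auto intro: f)
    let ?g = "if s then ncadj (f j) else f j"
    have g: "?g \<in> ncpolys I" using fj by (auto intro: ncpolys_adj)
    from Cons obtain Q where Q: "Q \<in> ncpolys I"
      and ev: "\<And>a :: 'i \<Rightarrow> 'a. nceval a Q = word_eval (\<lambda>j. nceval a (f j)) (NCWord l)"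
      and mev: "\<And>N A. (\<forall>i\<in>I. A i \<in> carrier_mat N N) \<Longrightarrow>
       mat_nceval N A Q = mat_word_eval N (\<lambda>j. mat_nceval N A (f j)) (NCWord l)"
      by auto
    show ?case
    proof (rule bexI[of _ "?g * Q"], intro conjI allI impI)
      fix a :: "'i \<Rightarrow> 'a"
      show "nceval a (?g * Q) = word_eval (\<lambda>j. nceval a (f j)) (NCWord (x # l))"
        by (simp add: nceval_mult nceval_adj ev x word_eval_def)
    next
      fix N and A :: "'i \<Rightarrow> complex mat" assume A: "\<forall>i\<in>I. A i \<in> carrier_mat N N"
      show "mat_nceval N A (?g * Q) = mat_word_eval N (\<lambda>j. mat_nceval N A (f j)) (NCWord (x # l))"
        using mat_nceval_mult[of I A N ?g Q] A g Q mat_nceval_adj[of I A N "f j"] fj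
        by (simp add: mev x mat_word_eval_NCWord)
    qed (rule ncpolys_mult[OF g Q])
  qed
  from this[of "letters w"] obtain Q where Q: "Q \<in> ncpolys I"
      and ev: "\<And>a :: 'i \<Rightarrow> 'a. nceval a Q = word_eval (\<lambda>j. nceval a (f j)) w"
      and mev: "\<And>N A. (\<forall>i\<in>I. A i \<in> carrier_mat N N) \<Longrightarrow>
       mat_nceval N A Q = mat_word_eval N (\<lambda>j. mat_nceval N A (f j)) w"
    using single by (auto simp: word_in_def)
  show ?case
  proof (rule bexI[of _ "ncconst c * Q"], intro conjI allI impI)
    fix N and A :: "'i \<Rightarrow> complex mat" assume A: "\<forall>i\<in>I. A i \<in> carrier_mat N N"
    show "mat_nceval N A (ncconst c * Q) =
        mat_nceval N (\<lambda>j. mat_nceval N A (f j)) (Poly_Mapping.single w c)"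
      using mat_nceval_const_mult[of I A N Q c] A Q mev[OF A]
        mat_nceval_single[of J "\<lambda>j. mat_nceval N A (f j)" N w c] single by simp
  qed (auto simp: nceval_const_mult ev intro: ncpolys_mult ncpolys_const Q)
next
  case (add P1 P2)
  from add.IH obtain Q1 Q2 where "Q1 \<in> ncpolys I" "Q2 \<in> ncpolys I" "?subst Q1 P1" "?subst Q2 P2"
    by blast
  then show ?case
    by (intro bexI[of _ "Q1 + Q2"]) (auto simp: nceval_add mat_nceval_add intro: ncpolys_add)
qed

section \<open>Traces on C*-algebras\<close>

lemma bounded_linear_adj: "bounded_linear (adj :: 'a::cstar_algebra \<Rightarrow> 'a)"
proof (rule bounded_linear_intro[where K = 1])
  fix r and x :: 'a
  show "adj (r *\<^sub>R x) = r *\<^sub>R adj x"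
    using adj_scaleC[of "of_real r" x] by (simp add: scaleC_of_real)
qed (simp_all add: adj_add)

lemma adj_scaleR: "adj (r *\<^sub>R x) = r *\<^sub>R adj (x :: 'a::cstar_algebra)"
  by (rule linear_scale[OF bounded_linear.linear[OF bounded_linear_adj]])

lemma scaleC_diff_right: "c *\<^sub>C (x - y) = c *\<^sub>C x - c *\<^sub>C (y :: 'a::cstar_algebra)"
  using scaleC_add_right[of c "x - y" y] by (simp add: algebra_simps)

lemma abs_half_gbinomial_le_1: "\<bar>(1 / 2 :: real) gchoose n\<bar> \<le> 1"
proof (induction n)
  case (Suc n)
  have "real (Suc n) * ((1 / 2) gchoose Suc n) = (1 / 2 - real n) * ((1 / 2) gchoose n)"
    using gbinomial_mult_1[of "1 / 2 :: real" n] by (simp add: algebra_simps)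
  then have "real (Suc n) * \<bar>(1 / 2) gchoose Suc n\<bar> = \<bar>1 / 2 - real n\<bar> * \<bar>(1 / 2) gchoose n\<bar>"
    by (metis abs_mult abs_of_nat)
  also have "\<dots> \<le> real (Suc n) * 1"
    by (intro mult_mono Suc.IH) auto
  finally show ?case by simp
qed simp

text \<open>The binomial series of \<open>\<surd>(1 - z)\<close>, whose Cauchy square is \<open>1 - z\<close> by Vandermonde's identity.
  This is all the functional calculus that the contractivity of traces requires.\<close>

lemma sqrt_one_minus:
  fixes z :: "'a::cstar_algebra"
  assumes "norm z < 1" "adj z = z"
  obtains y where "adj y = y" "y * y = 1 - z"
proof -
  define c :: "nat \<Rightarrow> real" where "c n = (1 / 2 gchoose n) * (-1) ^ n" for n
  define f where "f n = c n *\<^sub>R z ^ n" for n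
  have le: "norm (f n) \<le> norm z ^ n" for n
  proof -
    have "norm (f n) \<le> 1 * norm (z ^ n)"
      unfolding f_def norm_scaleR
      using abs_half_gbinomial_le_1[of n] by (intro mult_right_mono) (auto simp: c_def abs_mult power_abs)
    then show ?thesis using norm_power_ineq[of z n] by simp
  qed
  have "summable (\<lambda>n. norm z ^ n)" using assms by (intro summable_geometric) simp
  then have summ: "summable (\<lambda>n. norm (f n))"
    by (rule summable_comparison_test'[where N = 0]) (simp add: le)
  have conv: "(\<Sum>i\<le>k. f i * f (k - i)) = (if k = 0 then 1 else if k = 1 then - z else 0)" for k
  proof -
    have "(\<Sum>i\<le>k. f i * f (k - i)) = (\<Sum>i\<le>k. c i * c (k - i)) *\<^sub>R z ^ k"
      by (auto simp: f_def scaleR_sum_left simp flip: power_add intro!: sum.cong)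
    also have "(\<Sum>i\<le>k. c i * c (k - i)) = (-1) ^ k * (\<Sum>i=0..k. ((1 / 2) gchoose i) * ((1 / 2) gchoose (k - i)))"
      unfolding sum_distrib_left atMost_atLeast0
      by (auto simp: c_def simp flip: power_add intro!: sum.cong)
    also have "(\<Sum>i=0..k. ((1 / 2) gchoose i) * ((1 / 2) gchoose (k - i))) = (1 :: real) gchoose k"
      using gbinomial_Vandermonde[of "1 / 2" "1 / 2 :: real" k] by simp
    also have "(1 :: real) gchoose k = real (1 choose k)"
      using binomial_gbinomial[of 1 k, where ?'a = real] by simp
    finally show ?thesis
      by (auto simp: binomial_eq_0)
  qed
  define y where "y = suminf f"
  have "(\<lambda>k. \<Sum>i\<le>k. f i * f (k - i)) sums (y * y)"
    unfolding y_def by (rule Cauchy_product_sums[OF summ summ])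
  moreover have "(\<lambda>k. \<Sum>i\<le>k. f i * f (k - i)) sums (\<Sum>k\<in>{0, 1}. \<Sum>i\<le>k. f i * f (k - i))"
    by (rule sums_finite) (auto simp: conv)
  ultimately have "y * y = (\<Sum>k\<in>{0, 1}. \<Sum>i\<le>k. f i * f (k - i))"
    by (rule sums_unique2)
  then have yy: "y * y = 1 - z" unfolding conv by simp
  have "adj (z ^ n) = z ^ n" for n
    using assms by (induction n) (auto simp: adj_mult power_commutes)
  then have "adj (f n) = f n" for n
    by (simp add: f_def adj_scaleR)
  moreover have "summable f" by (rule summable_norm_cancel[OF summ])
  ultimately have "adj y = y"
    using bounded_linear.suminf[OF bounded_linear_adj, of f] by (simp add: y_def)
  then show ?thesis using that yy by blast
qed

lemma tracial_state_add: "tracial_state \<tau> \<Longrightarrow> \<tau> (x + y) = \<tau> x + \<tau> y"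
  and tracial_state_scaleC: "tracial_state \<tau> \<Longrightarrow> \<tau> (c *\<^sub>C x) = c * \<tau> x"
  and tracial_state_nonneg: "tracial_state \<tau> \<Longrightarrow> 0 \<le> \<tau> (adj x * x)"
  and tracial_state_one: "tracial_state \<tau> \<Longrightarrow> \<tau> 1 = 1"
  and tracial_state_commute: "tracial_state \<tau> \<Longrightarrow> \<tau> (x * y) = \<tau> (y * x)"
  by (auto simp: tracial_state_def)

lemma tracial_state_diff: "tracial_state \<tau> \<Longrightarrow> \<tau> (x - y) = \<tau> x - \<tau> y"
  using tracial_state_add[of \<tau> "x - y" y] by simp

lemma tracial_state_adj:
  assumes "tracial_state \<tau>"
  shows "\<tau> (adj x) = cnj (\<tau> x)"
proof -
  have *: "Im (c * \<tau> (adj x) + cnj c * \<tau> x) = 0" for c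
  proof -
    let ?y = "x + c *\<^sub>C 1"
    have "adj ?y * ?y = adj x * x + c *\<^sub>C adj x + cnj c *\<^sub>C x + (cnj c * c) *\<^sub>C 1"
      by (simp add: adj_add adj_scaleC distrib_left distrib_right mult_scaleC_left mult_scaleC_right
          scaleC_scaleC scaleC_add_right mult.commute)
    then have "\<tau> (adj ?y * ?y) = \<tau> (adj x * x) + (c * \<tau> (adj x) + cnj c * \<tau> x) + cnj c * c"
      using assms by (simp add: tracial_state_add tracial_state_scaleC tracial_state_one)
    moreover have "Im (\<tau> (adj ?y * ?y)) = 0" "Im (\<tau> (adj x * x)) = 0"
      using tracial_state_nonneg[OF assms, of ?y] tracial_state_nonneg[OF assms, of x]
      by (simp_all add: less_eq_complex_def)
    moreover have "Im (cnj c * c) = 0" by simp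
    ultimately show ?thesis by (simp del: times_complex.sel)
  qed
  \<comment> \<open>polarisation with the scalars \<open>1\<close> and \<open>\<i>\<close>\<close>
  from *[of 1] *[of \<i>] show ?thesis by (auto simp: complex_eq_iff)
qed

text \<open>For \<open>r > \<parallel>x\<parallel>\<^sup>2\<close> the element \<open>1 - x\<^sup>* x / r\<close> is a square \<open>y\<^sup>* y\<close>, hence has nonnegative trace.\<close>

lemma tracial_state_Re_square_le:
  assumes \<tau>: "tracial_state \<tau>"
  shows "Re (\<tau> (adj x * x)) \<le> (norm x)\<^sup>2"
proof (rule field_le_epsilon)
  fix e :: real assume e: "0 < e"
  define r where "r = (norm x)\<^sup>2 + e"
  have r: "0 < r" using e by (simp add: r_def add_nonneg_pos)
  define z where "z = (1 / r) *\<^sub>R (adj x * x)"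
  have "norm z = (norm x)\<^sup>2 / r" using r by (simp add: z_def cstar_identity)
  then have "norm z < 1" using r e by (simp add: r_def)
  moreover have "adj z = z"
    by (simp add: z_def adj_scaleR adj_mult adj_adj)
  ultimately obtain y where y: "adj y = y" "y * y = 1 - z"
    using sqrt_one_minus by blast
  have "0 \<le> \<tau> (1 - z)" using tracial_state_nonneg[OF \<tau>, of y] y by simp
  also have "\<tau> (1 - z) = 1 - of_real (1 / r) * \<tau> (adj x * x)"
    using \<tau> by (simp add: z_def tracial_state_diff tracial_state_one tracial_state_scaleC
        flip: scaleC_of_real)
  finally have "0 \<le> 1 - (1 / r) * Re (\<tau> (adj x * x))"
    by (simp add: less_eq_complex_def)
  then show "Re (\<tau> (adj x * x)) \<le> (norm x)\<^sup>2 + e"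
    using r by (simp add: r_def[symmetric] divide_simps)
qed

text \<open>Positivity at \<open>x - \<tau>(x) 1\<close> gives \<open>|\<tau>(x)|\<^sup>2 \<le> \<tau>(x\<^sup>* x)\<close>.\<close>

lemma tracial_state_norm_le:
  assumes \<tau>: "tracial_state \<tau>"
  shows "cmod (\<tau> x) \<le> norm x"
proof -
  let ?t = "\<tau> x"
  let ?y = "x - ?t *\<^sub>C 1"
  have "adj ?y * ?y = adj x * x - ?t *\<^sub>C adj x - cnj ?t *\<^sub>C x + (cnj ?t * ?t) *\<^sub>C 1"
    by (simp add: adj_minus adj_scaleC left_diff_distrib right_diff_distrib mult_scaleC_left
        mult_scaleC_right scaleC_scaleC scaleC_diff_right mult.commute)
  then have "\<tau> (adj ?y * ?y) = \<tau> (adj x * x) - ?t * cnj ?t"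
    using \<tau> by (simp add: tracial_state_add tracial_state_diff tracial_state_scaleC
        tracial_state_one tracial_state_adj)
  then have "0 \<le> Re (\<tau> (adj x * x)) - Re (?t * cnj ?t)"
    using tracial_state_nonneg[OF \<tau>, of ?y] by (simp add: less_eq_complex_def)
  then have "(cmod ?t)\<^sup>2 \<le> (norm x)\<^sup>2"
    using tracial_state_Re_square_le[OF \<tau>, of x] by (simp add: complex_mult_cnj cmod_power2)
  then show ?thesis by (rule power2_le_imp_le) simp
qed

section \<open>Laws\<close>

lemma cstar_power_self_adjoint: "adj x = x \<Longrightarrow> adj (x ^ k) = x ^ k" for x :: "'a::cstar_algebra"
  by (induction k) (auto simp: adj_mult power_commutes)

lemma trace_laws_subset_law_space:
  fixes a :: "'i \<Rightarrow> 'a::cstar_algebra"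
  assumes R: "R_bounded R I a"
  shows "trace_laws I a \<subseteq> law_space R I"
proof
  fix l assume "l \<in> trace_laws I a"
  then obtain \<tau> where \<tau>: "tracial_state \<tau>" and l: "l = restrict (\<lambda>P. \<tau> (nceval a P)) (ncpolys I)"
    by (auto simp: trace_laws_def)
  have moment: "\<tau> ((adj (a j) * a j) ^ k) \<le> complex_of_real (R ^ (2 * k))" if j: "j \<in> I" for j k
  proof -
    let ?y = "adj (a j) * a j"
    have "adj (?y ^ k) = ?y ^ k"
      by (intro cstar_power_self_adjoint) (simp add: adj_mult adj_adj)
    then have "cnj (\<tau> (?y ^ k)) = \<tau> (?y ^ k)"
      using tracial_state_adj[OF \<tau>, of "?y ^ k"] by simp
    then have Im: "Im (\<tau> (?y ^ k)) = 0" by (simp add: complex_eq_iff)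
    have "Re (\<tau> (?y ^ k)) \<le> norm (?y ^ k)"
      using complex_Re_le_cmod tracial_state_norm_le[OF \<tau>] order_trans by blast
    also have "\<dots> \<le> ((norm (a j))\<^sup>2) ^ k"
      using norm_power_ineq[of ?y k] by (simp add: cstar_identity)
    also have "\<dots> \<le> (R\<^sup>2) ^ k"
      using R j by (intro power_mono) (auto simp: R_bounded_def)
    finally show ?thesis using Im by (simp add: less_eq_complex_def power_mult)
  qed
  show "l \<in> law_space R I"
    unfolding law_space_def mem_Collect_eq
    using \<tau> moment
    by (auto simp: l nceval_add nceval_mult nceval_adj nceval_power tracial_state_add
        tracial_state_scaleC tracial_state_nonneg tracial_state_one mult_scaleC_left
        ncpolys_add ncpolys_mult ncpolys_adj ncpolys_const ncpolys_one ncpolys_var ncpolys_power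
        intro: tracial_state_commute)
qed

lemma mat_tr_adjoint:
  "A \<in> carrier_mat N N \<Longrightarrow> mat_tr N (mat_adjoint A) = cnj (mat_tr N A)"
  by (simp add: mat_tr_def)

lemma mat_tr_square_nonneg:
  assumes A: "A \<in> carrier_mat N N"
  shows "0 \<le> mat_tr N (mat_adjoint A * A)"
proof -
  have "mat_tr N (mat_adjoint A * A) = (\<Sum>i<N. \<Sum>j<N. of_real ((cmod (A $$ (j, i)))\<^sup>2))"
    using A by (simp add: mat_tr_def scalar_prod_def lessThan_atLeast0 complex_norm_square mult.commute
        del: of_real_power)
  also have "0 \<le> \<dots>" by (intro sum_nonneg) (simp add: less_eq_complex_def)
  finally show ?thesis .
qed

lemma opnorm_pow_le:
  assumes A: "A \<in> carrier_mat N N"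
  shows "mat_opnorm N (A ^\<^sub>m k) \<le> mat_opnorm N A ^ k"
proof (induction k)
  case 0
  show ?case using opnorm_one_le[of N] A by simp
next
  case (Suc k)
  have Ak: "A ^\<^sub>m k \<in> carrier_mat N N" by (rule pow_carrier_mat[OF A])
  have "mat_opnorm N (A ^\<^sub>m Suc k) \<le> mat_opnorm N (A ^\<^sub>m k) * mat_opnorm N A"
    using opnorm_mult[OF Ak A] by simp
  also have "\<dots> \<le> mat_opnorm N A ^ k * mat_opnorm N A"
    using opnorm_nonneg[OF A] by (intro mult_right_mono Suc.IH) auto
  finally show ?case by (simp add: mult.commute)
qed

lemma mat_law_in_law_space:
  assumes A: "A \<in> mat_tuples N R I" and N: "0 < N"
  shows "mat_law N I A \<in> law_space R I"
proof -
  have c: "\<forall>i\<in>I. A i \<in> carrier_mat N N" and le: "\<And>i. i \<in> I \<Longrightarrow> mat_opnorm N (A i) \<le> R"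
    using A by (auto simp: mat_tuples_def)
  note m = mat_nceval_carrier[of N A]
  have moment: "mat_tr N (mat_nceval N A ((ncadj (ncvar j) * ncvar j) ^ k)) / of_nat N
      \<le> complex_of_real (R ^ (2 * k))" if j: "j \<in> I" for j k
  proof -
    let ?v = "ncadj (ncvar j) * ncvar j" and ?T = "mat_adjoint (A j) * A j"
    have Aj: "A j \<in> carrier_mat N N" using c j by blast
    have v: "ncvar j \<in> ncpolys I" by (rule ncpolys_var[OF j])
    have T: "?T \<in> carrier_mat N N" using Aj by auto
    have "mat_nceval N A ?v = ?T"
      using mat_nceval_mult[OF c ncpolys_adj[OF v] v] mat_nceval_adj[OF c v] mat_nceval_var[of A j N] Aj
      by simp
    then have ev: "mat_nceval N A (?v ^ k) = ?T ^\<^sub>m k"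
      using mat_nceval_power[OF c ncpolys_mult[OF ncpolys_adj[OF v] v], of k] by simp
    have Tk: "?T ^\<^sub>m k \<in> carrier_mat N N" by (rule pow_carrier_mat[OF T])
    have "mat_adjoint (?T ^\<^sub>m k) = ?T ^\<^sub>m k"
      using mat_adjoint_mult[OF mat_adjoint_carrier[OF Aj] Aj] by (intro mat_adjoint_pow[OF T]) simp
    then have "cnj (mat_tr N (?T ^\<^sub>m k)) = mat_tr N (?T ^\<^sub>m k)"
      using mat_tr_adjoint[OF Tk] by simp
    then have Im: "Im (mat_tr N (?T ^\<^sub>m k)) = 0" by (simp add: complex_eq_iff)
    have "Re (mat_tr N (?T ^\<^sub>m k) / of_nat N) \<le> abs_ntr N (?T ^\<^sub>m k)"
      unfolding abs_ntr_def by (rule complex_Re_le_cmod)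
    also have "\<dots> \<le> mat_opnorm N (?T ^\<^sub>m k)"
      using abs_ntr_le_norm2[OF Tk] mat_norm2_le_opnorm[OF Tk] by linarith
    also have "\<dots> \<le> mat_opnorm N ?T ^ k" by (rule opnorm_pow_le[OF T])
    also have "\<dots> \<le> (R * R) ^ k"
    proof (intro power_mono)
      have "mat_opnorm N ?T \<le> mat_opnorm N (A j) * mat_opnorm N (A j)"
        using opnorm_mult[OF mat_adjoint_carrier[OF Aj] Aj] opnorm_adjoint[OF Aj] by simp
      also have "\<dots> \<le> R * R"
        using le[OF j] opnorm_nonneg[OF Aj] by (intro mult_mono) auto
      finally show "mat_opnorm N ?T \<le> R * R" .
    qed (use opnorm_nonneg[OF T] in auto)
    finally have "Re (mat_tr N (?T ^\<^sub>m k) / of_nat N) \<le> R ^ (2 * k)"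
      by (simp add: power_mult power2_eq_square)
    then show ?thesis unfolding ev using Im by (simp add: less_eq_complex_def)
  qed
  have pos: "0 \<le> mat_tr N (mat_nceval N A (ncadj P * P)) / of_nat N" if "P \<in> ncpolys I" for P
  proof -
    have "0 \<le> mat_tr N (mat_nceval N A (ncadj P * P))"
      using mat_tr_square_nonneg[OF m[of P]] mat_nceval_mult[OF c ncpolys_adj[OF that] that]
        mat_nceval_adj[OF c that] by simp
    then show ?thesis by (simp add: less_eq_complex_def)
  qed
  have one: "mat_tr N (mat_nceval N A 1) / of_nat N = 1"
    using N by (simp add: mat_nceval_one mat_tr_def)
  have const: "mat_tr N (mat_nceval N A (ncconst c * P)) / of_nat N =
      c * (mat_tr N (mat_nceval N A P) / of_nat N)" if "P \<in> ncpolys I" for c P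
    using mat_nceval_const_mult[OF c that] by (simp add: mat_tr_def sum_distrib_left)
  have comm: "mat_tr N (mat_nceval N A (P * Q)) = mat_tr N (mat_nceval N A (Q * P))"
    if "P \<in> ncpolys I" "Q \<in> ncpolys I" for P Q
    using mat_nceval_mult[OF c that] mat_nceval_mult[OF c that(2,1)] mat_tr_commute[OF m[of P] m[of Q]]
    by simp
  show ?thesis
    unfolding law_space_def mem_Collect_eq
    using pos one moment const comm
    by (auto simp: mat_law_def mat_nceval_add mat_tr_add[OF m m] add_divide_distrib
        ncpolys_add ncpolys_mult ncpolys_adj ncpolys_const ncpolys_one ncpolys_var ncpolys_power)
qed

section \<open>Extension of laws to the C*-algebra\<close>

lemma nceval_closure_dense:
  fixes a :: "'i \<Rightarrow> 'a::cstar_algebra"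
  assumes gen: "generating I a"
  shows "closure (nceval a ` ncpolys I) = UNIV"
proof -
  let ?S = "nceval a ` ncpolys I"
  have "unital_cstar_subalgebra (closure ?S)"
    unfolding unital_cstar_subalgebra_def
  proof (intro conjI ballI allI)
    show "closed (closure ?S)" by simp
    show "1 \<in> closure ?S"
      using closure_subset[of ?S] ncpolys_one[of I] by (force intro: image_eqI[where x = 1])
  next
    fix x y assume "x \<in> closure ?S" "y \<in> closure ?S"
    then obtain f g where f: "\<And>n. f n \<in> ?S" "f \<longlonglongrightarrow> x" and g: "\<And>n. g n \<in> ?S" "g \<longlonglongrightarrow> y"
      unfolding closure_sequential by blast
    have "f n + g n \<in> ?S" "f n * g n \<in> ?S" for n
    proof -
      from f(1)[of n] g(1)[of n] obtain P Q where "P \<in> ncpolys I" "Q \<in> ncpolys I"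
        "f n = nceval a P" "g n = nceval a Q" by blast
      then have "f n + g n = nceval a (P + Q)" "f n * g n = nceval a (P * Q)"
        "P + Q \<in> ncpolys I" "P * Q \<in> ncpolys I"
        by (auto simp: nceval_add nceval_mult ncpolys_add ncpolys_mult)
      then show "f n + g n \<in> ?S" "f n * g n \<in> ?S" by auto
    qed
    then show "x + y \<in> closure ?S" "x * y \<in> closure ?S"
      using tendsto_add[OF f(2) g(2)] tendsto_mult[OF f(2) g(2)]
      by (auto simp: closure_sequential intro: exI[of _ "\<lambda>n. f n + g n"] exI[of _ "\<lambda>n. f n * g n"])
  next
    fix c x assume "x \<in> closure ?S"
    then obtain f where f: "\<And>n. f n \<in> ?S" "f \<longlonglongrightarrow> x"
      unfolding closure_sequential by blast
    have "c *\<^sub>C f n \<in> ?S" for n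
      using f(1)[of n] by (force simp: nceval_const_mult[symmetric] intro!: ncpolys_mult ncpolys_const)
    moreover have "bounded_linear (\<lambda>x::'a. c *\<^sub>C x)"
    proof (rule bounded_linear_intro[where K = "cmod c"])
      fix r and x :: 'a
      show "c *\<^sub>C r *\<^sub>R x = r *\<^sub>R c *\<^sub>C x"
        by (simp add: scaleC_scaleC mult.commute flip: scaleC_of_real)
    qed (simp_all add: scaleC_add_right norm_scaleC)
    then have "(\<lambda>n. c *\<^sub>C f n) \<longlonglongrightarrow> c *\<^sub>C x"
      using f(2) by (rule bounded_linear.tendsto)
    ultimately show "c *\<^sub>C x \<in> closure ?S"
      unfolding closure_sequential by (intro exI[of _ "\<lambda>n. c *\<^sub>C f n"]) blast
  next
    fix x assume "x \<in> closure ?S"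
    then obtain f where f: "\<And>n. f n \<in> ?S" "f \<longlonglongrightarrow> x"
      unfolding closure_sequential by blast
    have "adj (f n) \<in> ?S" for n
      using f(1)[of n] by (force simp: nceval_adj[symmetric] intro!: ncpolys_adj)
    moreover have "(\<lambda>n. adj (f n)) \<longlonglongrightarrow> adj x"
      using bounded_linear_adj f(2) by (rule bounded_linear.tendsto)
    ultimately show "adj x \<in> closure ?S"
      unfolding closure_sequential by (intro exI[of _ "\<lambda>n. adj (f n)"]) blast
  qed
  moreover have "a ` I \<subseteq> closure ?S"
  proof
    fix x assume "x \<in> a ` I"
    then obtain i where i: "i \<in> I" "x = a i" by blast
    have "x \<in> ?S" by (rule image_eqI[where x = "ncvar i"]) (simp_all add: i ncpolys_var)
    then show "x \<in> closure ?S" by (rule subsetD[OF closure_subset])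
  qed
  ultimately show ?thesis using gen unfolding generating_def by blast
qed

lemma approximating_polys:
  fixes a :: "'i \<Rightarrow> 'a::cstar_algebra"
  assumes "generating I a"
  obtains p where "\<And>n. p n \<in> ncpolys I" "(\<lambda>n. nceval a (p n)) \<longlonglongrightarrow> x"
proof -
  have "x \<in> closure (nceval a ` ncpolys I)" using nceval_closure_dense[OF assms] by simp
  then obtain f where f: "\<forall>n. f n \<in> nceval a ` ncpolys I" "f \<longlonglongrightarrow> x"
    unfolding closure_sequential by blast
  then have "\<forall>n. \<exists>P. P \<in> ncpolys I \<and> f n = nceval a P" by blast
  then obtain p where "\<forall>n. p n \<in> ncpolys I \<and> f n = nceval a (p n)" by metis
  moreover from this have "f = (\<lambda>n. nceval a (p n))" by auto
  ultimately show ?thesis using that[of p] f(2) by simp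
qed

lemma law_diff:
  assumes l: "l \<in> law_space R I" and P: "P \<in> ncpolys I" and Q: "Q \<in> ncpolys I"
  shows "l (P + ncconst (-1) * Q) = l P - l Q"
proof -
  have "\<And>P Q. P \<in> ncpolys I \<Longrightarrow> Q \<in> ncpolys I \<Longrightarrow> l (P + Q) = l P + l Q"
    "\<And>c P. P \<in> ncpolys I \<Longrightarrow> l (ncconst c * P) = c * l P"
    using l by (auto simp: law_space_def)
  then show ?thesis using P Q ncpolys_mult[OF ncpolys_const Q, of "-1"] by simp
qed

text \<open>The bound makes \<open>\<ell>(P)\<close> a function of \<open>P(a)\<close> that is Lipschitz on a dense *-subalgebra.  Its
  continuous extension inherits linearity, positivity and the trace property as limits.\<close>

lemma law_of_trace:
  fixes a :: "'i \<Rightarrow> 'a::cstar_algebra"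
  assumes gen: "generating I a" and l: "l \<in> law_space R I"
    and le: "\<And>P. P \<in> ncpolys I \<Longrightarrow> cmod (l P) \<le> norm (nceval a P)"
  shows "l \<in> trace_laws I a"
proof -
  let ?S = "nceval a ` ncpolys I"
  have add: "\<And>P Q. P \<in> ncpolys I \<Longrightarrow> Q \<in> ncpolys I \<Longrightarrow> l (P + Q) = l P + l Q"
    and const: "\<And>c P. P \<in> ncpolys I \<Longrightarrow> l (ncconst c * P) = c * l P"
    and pos: "\<And>P. P \<in> ncpolys I \<Longrightarrow> 0 \<le> l (ncadj P * P)" and one: "l 1 = 1"
    and comm: "\<And>P Q. P \<in> ncpolys I \<Longrightarrow> Q \<in> ncpolys I \<Longrightarrow> l (P * Q) = l (Q * P)"
    and ext: "l \<in> extensional (ncpolys I)"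
    using l by (auto simp: law_space_def)
  have lip: "cmod (l P - l Q) \<le> norm (nceval a P - nceval a Q)"
    if "P \<in> ncpolys I" "Q \<in> ncpolys I" for P Q
  proof -
    have "cmod (l (P + ncconst (-1) * Q)) \<le> norm (nceval a (P + ncconst (-1) * Q))"
      using that by (intro le ncpolys_add ncpolys_mult ncpolys_const)
    then show ?thesis
      using law_diff[OF l that] by (simp add: nceval_add nceval_const_mult scaleC_minus1)
  qed
  define f where "f x = l (SOME P. P \<in> ncpolys I \<and> nceval a P = x)" for x
  have f: "f (nceval a P) = l P" if P: "P \<in> ncpolys I" for P
  proof -
    let ?Q = "SOME Q. Q \<in> ncpolys I \<and> nceval a Q = nceval a P"
    have "?Q \<in> ncpolys I \<and> nceval a ?Q = nceval a P"
      by (rule someI[of _ P]) (use P in simp)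
    then have "cmod (l ?Q - l P) \<le> 0" using lip[of ?Q P] P by simp
    then show ?thesis by (simp add: f_def)
  qed
  have "uniformly_continuous_on ?S f"
    unfolding uniformly_continuous_on_def
  proof (intro allI impI)
    fix e :: real assume "0 < e"
    have "dist (f x') (f x) < e" if "x \<in> ?S" "x' \<in> ?S" "dist x' x < e" for x x'
    proof -
      from that obtain P Q where "P \<in> ncpolys I" "Q \<in> ncpolys I" "x' = nceval a P" "x = nceval a Q"
        by blast
      with lip[of P Q] that(3) show ?thesis by (simp add: dist_norm f)
    qed
    then show "\<exists>d>0. \<forall>x\<in>?S. \<forall>x'\<in>?S. dist x' x < d \<longrightarrow> dist (f x') (f x) < e"
      using \<open>0 < e\<close> by blast
  qed
  then obtain \<tau> where cont: "uniformly_continuous_on (closure ?S) \<tau>"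
    and \<tau>f: "\<And>x. x \<in> ?S \<Longrightarrow> f x = \<tau> x"
    by (rule uniformly_continuous_on_extension_on_closure) blast
  have "isCont \<tau> x" for x
    using uniformly_continuous_imp_continuous[OF cont] nceval_closure_dense[OF gen]
    by (simp add: continuous_on_eq_continuous_at)
  then have lim: "(\<lambda>n. \<tau> (g n)) \<longlonglongrightarrow> \<tau> x" if "g \<longlonglongrightarrow> x" for g x
    using that isCont_tendsto_compose by blast
  have \<tau>: "\<tau> (nceval a P) = l P" if "P \<in> ncpolys I" for P
    using that f[OF that] \<tau>f[of "nceval a P"] by simp
  have "tracial_state \<tau>"
    unfolding tracial_state_def
  proof (intro conjI allI)
    fix x y
    obtain p where p: "\<And>n. p n \<in> ncpolys I" "(\<lambda>n. nceval a (p n)) \<longlonglongrightarrow> x"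
      using approximating_polys[OF gen] by blast
    obtain q where q: "\<And>n. q n \<in> ncpolys I" "(\<lambda>n. nceval a (q n)) \<longlonglongrightarrow> y"
      using approximating_polys[OF gen] by blast
    have "\<tau> (nceval a (p n) + nceval a (q n)) = \<tau> (nceval a (p n)) + \<tau> (nceval a (q n))" for n
      using p(1)[of n] q(1)[of n] by (simp add: \<tau> add ncpolys_add flip: nceval_add)
    then have "(\<lambda>n. \<tau> (nceval a (p n)) + \<tau> (nceval a (q n))) \<longlonglongrightarrow> \<tau> (x + y)"
      using lim[OF tendsto_add[OF p(2) q(2)]] by simp
    moreover have "(\<lambda>n. \<tau> (nceval a (p n)) + \<tau> (nceval a (q n))) \<longlonglongrightarrow> \<tau> x + \<tau> y"
      by (intro tendsto_add lim p q)
    ultimately show "\<tau> (x + y) = \<tau> x + \<tau> y" by (rule LIMSEQ_unique)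
    have "\<tau> (nceval a (p n) * nceval a (q n)) = \<tau> (nceval a (q n) * nceval a (p n))" for n
      using p(1)[of n] q(1)[of n] by (simp add: \<tau> comm ncpolys_mult flip: nceval_mult)
    then have "(\<lambda>n. \<tau> (nceval a (p n) * nceval a (q n))) \<longlonglongrightarrow> \<tau> (y * x)"
      using lim[OF tendsto_mult[OF q(2) p(2)]] by simp
    moreover have "(\<lambda>n. \<tau> (nceval a (p n) * nceval a (q n))) \<longlonglongrightarrow> \<tau> (x * y)"
      by (rule lim[OF tendsto_mult[OF p(2) q(2)]])
    ultimately show "\<tau> (x * y) = \<tau> (y * x)" by (rule LIMSEQ_unique[rotated])
  next
    fix c x
    obtain p where p: "\<And>n. p n \<in> ncpolys I" "(\<lambda>n. nceval a (p n)) \<longlonglongrightarrow> x"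
      using approximating_polys[OF gen] by blast
    have "(\<lambda>n. nceval a (ncconst c * p n)) \<longlonglongrightarrow> (c *\<^sub>C 1) * x"
      unfolding nceval_mult nceval_const by (intro tendsto_mult tendsto_const p)
    then have "(\<lambda>n. \<tau> (nceval a (ncconst c * p n))) \<longlonglongrightarrow> \<tau> (c *\<^sub>C x)"
      using lim by (simp add: mult_scaleC_left)
    moreover have "\<tau> (nceval a (ncconst c * p n)) = c * \<tau> (nceval a (p n))" for n
      using p(1)[of n] by (simp add: \<tau> const ncpolys_mult ncpolys_const)
    moreover have "(\<lambda>n. c * \<tau> (nceval a (p n))) \<longlonglongrightarrow> c * \<tau> x"
      by (intro tendsto_mult tendsto_const lim p)
    ultimately show "\<tau> (c *\<^sub>C x) = c * \<tau> x" by (simp add: LIMSEQ_unique)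
  next
    fix x
    obtain p where p: "\<And>n. p n \<in> ncpolys I" "(\<lambda>n. nceval a (p n)) \<longlonglongrightarrow> x"
      using approximating_polys[OF gen] by blast
    have "(\<lambda>n. \<tau> (adj (nceval a (p n)) * nceval a (p n))) \<longlonglongrightarrow> \<tau> (adj x * x)"
      by (intro lim tendsto_mult bounded_linear.tendsto[OF bounded_linear_adj] p)
    moreover have "\<tau> (adj (nceval a (p n)) * nceval a (p n)) = l (ncadj (p n) * p n)" for n
      using p(1)[of n] by (simp add: \<tau> ncpolys_mult ncpolys_adj flip: nceval_adj nceval_mult)
    ultimately have lim0: "(\<lambda>n. l (ncadj (p n) * p n)) \<longlonglongrightarrow> \<tau> (adj x * x)" by simp
    have "0 \<le> Re (\<tau> (adj x * x))"
      using tendsto_Re[OF lim0] by (rule LIMSEQ_le_const) (use pos p(1) in \<open>auto simp: less_eq_complex_def\<close>)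
    moreover have "Im (l (ncadj (p n) * p n)) = 0" for n
      using pos[OF p(1)[of n]] by (simp add: less_eq_complex_def)
    then have "Im (\<tau> (adj x * x)) = 0"
      using tendsto_Im[OF lim0] by (simp add: LIMSEQ_const_iff)
    ultimately show "0 \<le> \<tau> (adj x * x)" by (simp add: less_eq_complex_def)
  next
    show "\<tau> 1 = 1" using \<tau>[OF ncpolys_one] one by simp
  qed
  moreover have "l = restrict (\<lambda>P. \<tau> (nceval a P)) (ncpolys I)"
    using ext by (auto simp: fun_eq_iff \<tau> extensional_def restrict_def)
  ultimately show ?thesis by (auto simp: trace_laws_def)
qed

section \<open>Neighbourhoods of the set of trace laws\<close>

lemma closedin_Collect_Ball:
  assumes "\<And>x. x \<in> S \<Longrightarrow> closedin T {l \<in> topspace T. Q x l}"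
  shows "closedin T {l \<in> topspace T. \<forall>x\<in>S. Q x l}"
proof (cases "S = {}")
  case False
  then have "{l \<in> topspace T. \<forall>x\<in>S. Q x l} = (\<Inter>x\<in>S. {l \<in> topspace T. Q x l})" by auto
  also have "closedin T \<dots>" using False assms by (intro closedin_INT) auto
  finally show ?thesis .
qed simp

text \<open>Each condition that defines a law is a closed condition on finitely many coordinates.\<close>

lemma closedin_law_space:
  fixes I :: "'i set"
  shows "closedin (product_topology (\<lambda>_. euclidean) (ncpolys I)) (law_space R I)"
proof -
  let ?T = "product_topology (\<lambda>_. euclidean) (ncpolys I) :: ('i ncpoly \<Rightarrow> complex) topology"
  have top: "topspace ?T = extensional (ncpolys I)"
    by (auto simp: PiE_def)
  have ev: "continuous_map ?T euclidean (\<lambda>l. l P)" if "P \<in> ncpolys I" for P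
    using continuous_map_product_projection[OF that, of "\<lambda>_. euclidean"] by simp
  have eq: "closedin ?T {l \<in> topspace ?T. u l = v l}"
    if u: "continuous_map ?T euclidean u" and v: "continuous_map ?T euclidean v"
    for u v :: "('i ncpoly \<Rightarrow> complex) \<Rightarrow> complex"
  proof -
    have "closedin ?T {l \<in> topspace ?T. u l - v l \<in> {0}}"
      by (rule closedin_continuous_map_preimage[OF continuous_map_diff[OF u v]]) simp
    then show ?thesis by simp
  qed
  have le: "closedin ?T {l \<in> topspace ?T. l P \<in> C}" if "P \<in> ncpolys I" "closed C" for P C
    by (rule closedin_continuous_map_preimage[OF ev[OF that(1)]]) (use that in simp)
  have cl1: "closed {z :: complex. 0 \<le> z}" and cl2: "\<And>w :: complex. closed {z. z \<le> w}"
    unfolding less_eq_complex_def by (intro closed_Collect_conj closed_Collect_le closed_Collect_eq continuous_intros)+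
  have mult: "continuous_map ?T euclidean (\<lambda>l. c * l P)" if "P \<in> ncpolys I" for P c
    using continuous_map_compose[OF ev[OF that], of euclidean "\<lambda>z. c * z"]
    by (simp add: o_def continuous_intros)
  have "law_space R I = {l \<in> topspace ?T. \<forall>P\<in>ncpolys I. \<forall>Q\<in>ncpolys I. l (P + Q) = l P + l Q} \<inter>
     {l \<in> topspace ?T. \<forall>c\<in>UNIV. \<forall>P\<in>ncpolys I. l (ncconst c * P) = c * l P} \<inter>
     {l \<in> topspace ?T. \<forall>P\<in>ncpolys I. l (ncadj P * P) \<in> {z. 0 \<le> z}} \<inter>
     {l \<in> topspace ?T. l 1 = 1} \<inter>
     {l \<in> topspace ?T. \<forall>P\<in>ncpolys I. \<forall>Q\<in>ncpolys I. l (P * Q) = l (Q * P)} \<inter>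
     {l \<in> topspace ?T. \<forall>j\<in>I. \<forall>k\<in>UNIV.
        l ((ncadj (ncvar j) * ncvar j) ^ k) \<in> {z. z \<le> complex_of_real (R ^ (2 * k))}}"
    unfolding law_space_def top by auto
  also have "closedin ?T \<dots>"
    by (intro closedin_Int closedin_Collect_Ball eq le cl1 cl2 ev mult continuous_map_add
        ncpolys_add ncpolys_mult ncpolys_adj ncpolys_const ncpolys_one ncpolys_var ncpolys_power)
      auto
  finally show ?thesis .
qed

text \<open>The bounds \<open>c P\<close> confine the laws to a compact product of discs.  In it, the laws outside the
  neighbourhood violate one of the inequalities \<open>|\<ell>(P)| \<le> \<parallel>P(a)\<parallel>\<close> by some \<open>1 / (n + 1)\<close>, since
  otherwise they would be trace laws; by compactness finitely many pairs \<open>(P, n)\<close> suffice.  Laws of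
  matrix tuples satisfy such bounds because their operator norms are bounded.\<close>

lemma trace_laws_neighbourhood:
  fixes a :: "'i \<Rightarrow> 'a::cstar_algebra"
  assumes gen: "generating I a" and op: "openin (law_topology R I) \<O>" and sub: "trace_laws I a \<subseteq> \<O>"
  shows "\<exists>\<delta>>0. \<exists>Q. finite Q \<and> Q \<subseteq> ncpolys I \<and>
    (\<forall>l\<in>law_space R I. (\<forall>P\<in>ncpolys I. cmod (l P) \<le> c P) \<longrightarrow>
       (\<forall>P\<in>Q. cmod (l P) \<le> norm (nceval a P) + \<delta>) \<longrightarrow> l \<in> \<O>)"
proof -
  let ?T = "product_topology (\<lambda>_. euclidean) (ncpolys I) :: ('i ncpoly \<Rightarrow> complex) topology"
  from op obtain W where W: "openin ?T W" and \<O>: "\<O> = W \<inter> law_space R I"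
    unfolding law_topology_def openin_subtopology by blast
  let ?D = "PiE (ncpolys I) (\<lambda>P. cball (0 :: complex) (c P))"
  have ev: "continuous_map ?T euclidean (\<lambda>l. l P)" if "P \<in> ncpolys I" for P
    using continuous_map_product_projection[OF that, of "\<lambda>_. euclidean"] by simp
  have "compactin ?T ?D"
    by (simp add: compactin_PiE)
  then have "compactin ?T (?D \<inter> law_space R I)"
    by (rule compact_Int_closedin[OF _ closedin_law_space])
  then have comp: "compactin ?T ((?D \<inter> law_space R I) \<inter> (topspace ?T - W))"
    by (rule compact_Int_closedin) (rule closedin_diff[OF closedin_topspace W])
  let ?K = "(?D \<inter> law_space R I) \<inter> (topspace ?T - W)"
  define V where "V P n = {l \<in> topspace ?T. l P \<in> {z. norm (nceval a P) + 1 / real (Suc n) < cmod z}}"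
    for P n
  have V: "openin ?T (V P n)" if "P \<in> ncpolys I" for P n
    unfolding V_def
    by (rule openin_continuous_map_preimage[OF ev[OF that]])
      (auto intro!: open_Collect_less continuous_intros)
  have cover: "?K \<subseteq> \<Union> ((\<lambda>(P, n). V P n) ` (ncpolys I \<times> UNIV))"
  proof
    fix l assume l: "l \<in> ?K"
    then have "l \<notin> trace_laws I a" using sub \<O> by auto
    then obtain P where P: "P \<in> ncpolys I" "norm (nceval a P) < cmod (l P)"
      using law_of_trace[OF gen, of l R] l by (meson IntD1 IntD2 not_le)
    then obtain n where "1 / real (Suc n) < cmod (l P) - norm (nceval a P)"
      using nat_approx_posE[of "cmod (l P) - norm (nceval a P)"] by auto
    then have "l \<in> V P n" using l by (auto simp: V_def)
    then show "l \<in> \<Union> ((\<lambda>(P, n). V P n) ` (ncpolys I \<times> UNIV))" using P by blast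
  qed
  have "\<exists>\<F>. finite \<F> \<and> \<F> \<subseteq> (\<lambda>(P, n). V P n) ` (ncpolys I \<times> UNIV) \<and> ?K \<subseteq> \<Union>\<F>"
    by (rule compactinD[OF comp _ cover]) (use V in auto)
  then obtain E where E: "finite E" "E \<subseteq> ncpolys I \<times> (UNIV :: nat set)"
    and K: "?K \<subseteq> \<Union> ((\<lambda>(P, n). V P n) ` E)"
    by (metis (no_types, lifting) finite_subset_image)
  define m where "m = Max (insert 0 (snd ` E))"
  have m: "n \<le> m" if "(P, n) \<in> E" for P n
    unfolding m_def using E(1) that by (intro Max_ge) force+
  show ?thesis
  proof (intro exI[of _ "1 / real (Suc m)"] exI[of _ "fst ` E"] conjI ballI impI)
    show "fst ` E \<subseteq> ncpolys I" using E(2) by auto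
    fix l assume l: "l \<in> law_space R I" "\<forall>P\<in>ncpolys I. cmod (l P) \<le> c P"
      "\<forall>P\<in>fst ` E. cmod (l P) \<le> norm (nceval a P) + 1 / real (Suc m)"
    have ext: "l \<in> extensional (ncpolys I)" using l(1) by (simp add: law_space_def)
    have "l \<notin> V P n" if Pn: "(P, n) \<in> E" for P n
    proof -
      have "cmod (l P) \<le> norm (nceval a P) + 1 / real (Suc m)" using l(3) Pn by force
      also have "1 / real (Suc m) \<le> 1 / real (Suc n)" using m[OF Pn] by (simp add: frac_le)
      finally show ?thesis by (simp add: V_def)
    qed
    then have "l \<notin> ?K" using K by auto
    moreover have "l \<in> ?D" "l \<in> topspace ?T" using l(2) ext by (auto simp: PiE_def)
    ultimately show "l \<in> \<O>" using l(1) \<O> by auto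
  qed (use E in auto)
qed

lemma openin_law_bounds:
  fixes a :: "'i \<Rightarrow> 'a::cstar_algebra"
  assumes Q: "finite Q" "Q \<subseteq> ncpolys I"
  shows "openin (law_topology R I) {l \<in> law_space R I. \<forall>P\<in>Q. cmod (l P) < norm (nceval a P) + \<delta>}"
proof -
  let ?T = "product_topology (\<lambda>_. euclidean) (ncpolys I) :: ('i ncpoly \<Rightarrow> complex) topology"
  define V where "V P = {l \<in> topspace ?T. l P \<in> {z. cmod z < norm (nceval a P) + \<delta>}}" for P
  have V: "openin ?T (V P)" if "P \<in> ncpolys I" for P
  proof -
    have "continuous_map ?T euclidean (\<lambda>l. l P)"
      using continuous_map_product_projection[OF that, of "\<lambda>_. euclidean"] by simp
    then show ?thesis
      unfolding V_def
      by (rule openin_continuous_map_preimage) (auto intro!: open_Collect_less continuous_intros)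
  qed
  have "openin ?T (topspace ?T \<inter> (\<Inter>P\<in>Q. V P))"
  proof (cases "Q = {}")
    case False
    then have "openin ?T (\<Inter>P\<in>Q. V P)"
      by (intro openin_Inter) (use Q V in auto)
    then show ?thesis by (rule openin_Int[OF openin_topspace])
  qed (simp del: topspace_product_topology)
  moreover have "{l \<in> law_space R I. \<forall>P\<in>Q. cmod (l P) < norm (nceval a P) + \<delta>} =
      (topspace ?T \<inter> (\<Inter>P\<in>Q. V P)) \<inter> law_space R I"
    using closedin_subset[OF closedin_law_space[of I R]] by (auto simp: V_def)
  ultimately show ?thesis
    unfolding law_topology_def openin_subtopology by blast
qed

lemma trace_laws_in_bounds:
  assumes R: "R_bounded R I a" and Q: "Q \<subseteq> ncpolys I" and \<delta>: "0 < \<delta>"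
  shows "trace_laws I a \<subseteq> {l \<in> law_space R I. \<forall>P\<in>Q. cmod (l P) < norm (nceval a P) + \<delta>}"
proof -
  have "cmod (l P) < norm (nceval a P) + \<delta>" if "l \<in> trace_laws I a" "P \<in> Q" for l P
  proof -
    from that(1) obtain \<tau> where "tracial_state \<tau>" "l = restrict (\<lambda>P. \<tau> (nceval a P)) (ncpolys I)"
      by (auto simp: trace_laws_def)
    then have "cmod (l P) \<le> norm (nceval a P)"
      using tracial_state_norm_le[of \<tau> "nceval a P"] Q that(2) by auto
    then show ?thesis using \<delta> by linarith
  qed
  then show ?thesis using trace_laws_subset_law_space[OF R] by auto
qed

section \<open>Nets for the operator norm\<close>

text \<open>Volume comparison in a normed space of dimension \<open>d\<close>, with the volume of a ball replaced
  by the number of points of a fine lattice in it: a separated set in the ball of radius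
  \<open>M\<close> has at most \<open>q\<^sup>d\<close> elements, with \<open>q\<close> independent of the norm.  Writing lattice points
  in base \<open>q\<close> bounds the number of points in a ball by \<open>q\<^sup>d\<close> times the number of points in a
  ball that is smaller by a factor of about \<open>q\<close>.  The shifts of a small ball by the rounded
  elements of a separated set are disjoint.\<close>

lemma lattice_packing:
  fixes p :: "('d \<Rightarrow> real) \<Rightarrow> real" and D :: "'d set" and S :: "('d \<Rightarrow> real) set"
  assumes D: "finite D"
    and add: "\<And>x y. p (\<lambda>i. x i + y i) \<le> p x + p y"
    and scale: "\<And>c x. p (\<lambda>i. c * x i) \<le> \<bar>c\<bar> * p x"
    and coord: "\<And>x i. i \<in> D \<Longrightarrow> \<bar>x i\<bar> \<le> p x"
    and cong: "\<And>x y. (\<And>i. i \<in> D \<Longrightarrow> x i = y i) \<Longrightarrow> p x = p y"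
    and S: "finite S" and bound: "\<And>x. x \<in> S \<Longrightarrow> p x \<le> M"
    and sep: "\<And>x y. x \<in> S \<Longrightarrow> y \<in> S \<Longrightarrow> x \<noteq> y \<Longrightarrow> \<epsilon> \<le> p (\<lambda>i. x i - y i)"
    and \<epsilon>: "0 < \<epsilon>" and M: "0 \<le> M" and q: "4 * M / \<epsilon> + 2 \<le> real q"
  shows "card S \<le> q ^ card D"
proof -
  have p0: "p (\<lambda>i. 0) \<le> 0" using scale[of 0 "\<lambda>i. 0"] by simp
  have pos: "0 \<le> p x" for x
  proof -
    have "p (\<lambda>i. x i + (-1) * x i) \<le> p x + p (\<lambda>i. (-1) * x i)" by (rule add)
    moreover have "p (\<lambda>i. (-1) * x i) \<le> p x" using scale[of "-1" x] by simp
    moreover have "p (\<lambda>i. 0) \<le> p (\<lambda>i. 0) + p (\<lambda>i. 0)" using add[of "\<lambda>i. 0" "\<lambda>i. 0"] by simp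
    ultimately show ?thesis by simp
  qed
  have minus: "p (\<lambda>i. x i - y i) \<le> p x + p y" for x y
    using add[of x "\<lambda>i. (-1) * y i"] scale[of "-1" y] by simp
  define e where "e i = (\<lambda>j. if j = i then 1 else 0 :: real)" for i :: 'd
  define C where "C = (\<Sum>i\<in>D. p (e i))"
  have C: "0 \<le> C" unfolding C_def by (intro sum_nonneg pos)
  have small: "p z \<le> K * C" if "\<And>i. i \<in> D \<Longrightarrow> \<bar>z i\<bar> \<le> K" for z K
  proof -
    have "p (\<lambda>j. \<Sum>i\<in>D'. z i * e i j) \<le> (\<Sum>i\<in>D'. \<bar>z i\<bar> * p (e i))" if "finite D'" for D'
      using that
    proof (induction D')
      case (insert i D')
      have "p (\<lambda>j. z i * e i j + (\<Sum>i\<in>D'. z i * e i j)) \<le>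
          p (\<lambda>j. z i * e i j) + p (\<lambda>j. \<Sum>i\<in>D'. z i * e i j)"
        by (rule add)
      then show ?case using insert scale[of "z i" "e i"] by simp
    qed (use p0 in simp)
    from this[OF D] have "p (\<lambda>j. \<Sum>i\<in>D. z i * e i j) \<le> (\<Sum>i\<in>D. \<bar>z i\<bar> * p (e i))" .
    also have "p (\<lambda>j. \<Sum>i\<in>D. z i * e i j) = p z"
      using D by (intro cong) (simp add: e_def if_distrib sum.delta cong: if_cong)
    also have "(\<Sum>i\<in>D. \<bar>z i\<bar> * p (e i)) \<le> (\<Sum>i\<in>D. K * p (e i))"
      using that by (intro sum_mono mult_right_mono pos)
    finally show ?thesis by (simp add: C_def sum_distrib_left)
  qed
  \<comment> \<open>the scale at which rounding to the lattice is negligible\<close>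
  define t where "t = (12 * C + 4 * real q * C + 1) / \<epsilon>"
  have q0: "0 < q"
    using q \<epsilon> M by (metis add_nonneg_pos divide_nonneg_pos mult_nonneg_nonneg of_nat_0_less_iff
        less_le_trans zero_le_numeral zero_less_numeral)
  have t\<epsilon>: "t * \<epsilon> = 12 * C + 4 * real q * C + 1" using \<epsilon> by (simp add: t_def)
  have t: "0 < t" using \<epsilon> C by (auto simp: t_def intro!: divide_pos_pos add_nonneg_pos add_nonneg_nonneg)
  define L where "L r = {u :: 'd \<Rightarrow> int. (\<forall>i. i \<notin> D \<longrightarrow> u i = 0) \<and> p (\<lambda>i. of_int (u i)) \<le> r}" for r
  define \<rho> where "\<rho> = t * \<epsilon> / 4"
  define \<sigma> where "\<sigma> = t * M + C + \<rho>"
  have \<rho>: "0 \<le> \<rho>" using t \<epsilon> by (simp add: \<rho>_def)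
  have finL: "finite (L r)" for r
  proof (rule finite_subset)
    show "L r \<subseteq> {u. \<forall>i. (i \<in> D \<longrightarrow> u i \<in> {- \<lceil>r\<rceil>..\<lceil>r\<rceil>}) \<and> (i \<notin> D \<longrightarrow> u i = 0)}"
    proof
      fix u assume u: "u \<in> L r"
      have "\<bar>u i\<bar> \<le> \<lceil>r\<rceil>" if "i \<in> D" for i
      proof -
        have "\<bar>of_int (u i)\<bar> \<le> r"
          using coord[OF that, of "\<lambda>i. of_int (u i)"] u by (auto simp: L_def)
        then show ?thesis by linarith
      qed
      then show "u \<in> {u. \<forall>i. (i \<in> D \<longrightarrow> u i \<in> {- \<lceil>r\<rceil>..\<lceil>r\<rceil>}) \<and> (i \<notin> D \<longrightarrow> u i = 0)}"
        using u by (auto simp: L_def abs_le_iff) (smt (verit))+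
    qed
    show "finite {u. \<forall>i. (i \<in> D \<longrightarrow> u i \<in> {- \<lceil>r\<rceil>..\<lceil>r\<rceil>}) \<and> (i \<notin> D \<longrightarrow> u i = 0)}"
      by (rule finite_set_of_finite_funs[OF D]) simp
  qed
  define rnd where "rnd x = (\<lambda>i. if i \<in> D then \<lfloor>t * x i\<rfloor> else 0)" for x :: "'d \<Rightarrow> real"
  have rnd: "p (\<lambda>i. of_int (rnd x i) - t * x i) \<le> C" for x
  proof -
    have "p (\<lambda>i. of_int (rnd x i) - t * x i) \<le> 1 * C"
    proof (rule small)
      fix i assume "i \<in> D"
      then show "\<bar>of_int (rnd x i) - t * x i\<bar> \<le> 1" by (simp add: rnd_def) linarith
    qed
    then show ?thesis by simp
  qed
  have "card S * card (L \<rho>) = card (S \<times> L \<rho>)" by (simp add: card_cartesian_product)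
  also have "\<dots> \<le> card (L \<sigma>)"
  proof (rule card_inj_on_le[where f = "\<lambda>(x, u) i. rnd x i + u i"])
    show "inj_on (\<lambda>(x, u) i. rnd x i + u i) (S \<times> L \<rho>)"
    proof (rule inj_onI, clarify)
      fix x u y v
      assume x: "x \<in> S" and y: "y \<in> S" and u: "u \<in> L \<rho>" and v: "v \<in> L \<rho>"
        and eq: "(\<lambda>i. rnd x i + u i) = (\<lambda>i. rnd y i + v i)"
      have eqi: "rnd x i - rnd y i = v i - u i" for i using fun_cong[OF eq, of i] by linarith
      have "x = y"
      proof (rule ccontr)
        assume "x \<noteq> y"
        have "p (\<lambda>i. x i - y i) = p (\<lambda>i. (1 / t) * (t * x i - t * y i))"
          using t by (intro cong) (simp add: field_simps)
        also have "\<dots> \<le> (1 / t) * p (\<lambda>i. t * x i - t * y i)"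
          using scale[of "1 / t" "\<lambda>i. t * x i - t * y i"] t by simp
        finally have "t * p (\<lambda>i. x i - y i) \<le> p (\<lambda>i. t * x i - t * y i)"
          using t by (simp add: field_simps)
        moreover have "t * \<epsilon> \<le> t * p (\<lambda>i. x i - y i)"
          using sep[OF x y \<open>x \<noteq> y\<close>] t by simp
        ultimately have "t * \<epsilon> \<le> p (\<lambda>i. t * x i - t * y i)" by linarith
        also have "\<dots> = p (\<lambda>i. (of_int (v i) - of_int (u i)) -
            ((of_int (rnd x i) - t * x i) - (of_int (rnd y i) - t * y i)))"
          using eqi by (intro cong) (simp add: algebra_simps flip: of_int_diff of_int_add)
        also have "\<dots> \<le> p (\<lambda>i. of_int (v i) - of_int (u i)) +
            p (\<lambda>i. (of_int (rnd x i) - t * x i) - (of_int (rnd y i) - t * y i))"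
          by (rule minus)
        also have "\<dots> \<le> (\<rho> + \<rho>) + (C + C)"
          using minus[of "\<lambda>i. of_int (v i)" "\<lambda>i. of_int (u i)"] u v
            minus[of "\<lambda>i. of_int (rnd x i) - t * x i" "\<lambda>i. of_int (rnd y i) - t * y i"]
            rnd[of x] rnd[of y]
          by (simp add: L_def)
        finally show False using t\<epsilon> C mult_nonneg_nonneg[OF C of_nat_0_le_iff[of q]]
          by (simp add: \<rho>_def algebra_simps)
      qed
      moreover have "u i = v i" for i using eqi[of i] \<open>x = y\<close> by simp
      ultimately show "x = y \<and> u = v" by auto
    qed
    show "(\<lambda>(x, u) i. rnd x i + u i) ` (S \<times> L \<rho>) \<subseteq> L \<sigma>"
    proof clarify
      fix x u assume x: "x \<in> S" and u: "u \<in> L \<rho>"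
      have "p (\<lambda>i. of_int (rnd x i + u i)) =
          p (\<lambda>i. (t * x i + (of_int (rnd x i) - t * x i)) + of_int (u i))"
        by (intro cong) simp
      also have "\<dots> \<le> p (\<lambda>i. t * x i + (of_int (rnd x i) - t * x i)) + p (\<lambda>i. of_int (u i))"
        by (rule add)
      also have "\<dots> \<le> (t * M + C) + \<rho>"
      proof (intro add_mono)
        have "p (\<lambda>i. t * x i + (of_int (rnd x i) - t * x i)) \<le>
            p (\<lambda>i. t * x i) + p (\<lambda>i. of_int (rnd x i) - t * x i)"
          by (rule add)
        moreover have "p (\<lambda>i. t * x i) \<le> t * M"
          using scale[of t x] bound[OF x] t by (smt (verit) mult_left_mono)
        ultimately show "p (\<lambda>i. t * x i + (of_int (rnd x i) - t * x i)) \<le> t * M + C"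
          using rnd[of x] by linarith
      qed (use u in \<open>simp add: L_def\<close>)
      finally show "(\<lambda>i. rnd x i + u i) \<in> L \<sigma>"
        using u by (simp add: L_def \<sigma>_def rnd_def)
    qed
  qed (rule finL)
  also have "card (L \<sigma>) \<le> card (L \<rho> \<times> (D \<rightarrow>\<^sub>E {0..<int q}))"
  proof (rule card_inj_on_le[where f = "\<lambda>u. (\<lambda>i. u i div int q, restrict (\<lambda>i. u i mod int q) D)"])
    show "inj_on (\<lambda>u. (\<lambda>i. u i div int q, restrict (\<lambda>i. u i mod int q) D)) (L \<sigma>)"
    proof (rule inj_onI)
      fix u v assume u: "u \<in> L \<sigma>" and v: "v \<in> L \<sigma>"
        and eq: "(\<lambda>i. u i div int q, restrict (\<lambda>i. u i mod int q) D) =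
          (\<lambda>i. v i div int q, restrict (\<lambda>i. v i mod int q) D)"
      show "u = v"
      proof
        fix i
        show "u i = v i"
        proof (cases "i \<in> D")
          case True
          have "u i div int q = v i div int q" using eq by (auto simp: fun_eq_iff)
          moreover have "u i mod int q = v i mod int q"
            using eq True by (metis (mono_tags, lifting) prod.inject restrict_apply')
          ultimately show ?thesis by (metis mult_div_mod_eq)
        qed (use u v in \<open>auto simp: L_def\<close>)
      qed
    qed
    have "(\<lambda>i. u i div int q) \<in> L \<rho>" if u: "u \<in> L \<sigma>" for u
    proof -
      have "p (\<lambda>i. of_int (u i div int q)) =
          p (\<lambda>i. (1 / real q) * (of_int (u i) - of_int (u i mod int q)))"
      proof (intro cong)
        fix i
        have "of_int (u i) = real q * of_int (u i div int q) + (of_int (u i mod int q) :: real)"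
          by (metis mult_div_mod_eq of_int_add of_int_mult of_int_of_nat_eq)
        then show "of_int (u i div int q) = (1 / real q) * (of_int (u i) - of_int (u i mod int q))"
          using q0 by simp
      qed
      also have "\<dots> \<le> (1 / real q) * p (\<lambda>i. of_int (u i) - of_int (u i mod int q))"
        using scale[of "1 / real q" "\<lambda>i. of_int (u i) - of_int (u i mod int q)"] by simp
      also have "\<dots> \<le> (1 / real q) * (\<sigma> + real q * C)"
      proof (intro mult_left_mono)
        have "p (\<lambda>i. of_int (u i mod int q)) \<le> real q * C"
        proof (rule small)
          fix i
          have "0 \<le> u i mod int q" "u i mod int q < int q" using q0 by simp_all
          then show "\<bar>of_int (u i mod int q)\<bar> \<le> real q" by linarith
        qed
        then show "p (\<lambda>i. of_int (u i) - of_int (u i mod int q)) \<le> \<sigma> + real q * C"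
          using minus[of "\<lambda>i. of_int (u i)" "\<lambda>i. of_int (u i mod int q)"] u by (simp add: L_def)
      qed simp
      also have "\<dots> \<le> \<rho>"
      proof -
        have "4 * M + 2 * \<epsilon> \<le> real q * \<epsilon>" using q \<epsilon> by (simp add: field_simps)
        then have "t * (4 * M + 2 * \<epsilon>) \<le> t * (real q * \<epsilon>)" using t by simp
        then have "t * M + t * \<epsilon> / 2 \<le> real q * (t * \<epsilon> / 4)" by (simp add: algebra_simps)
        moreover have "C + real q * C \<le> t * \<epsilon> / 4"
          unfolding t\<epsilon> using C by simp
        ultimately have "\<sigma> + real q * C \<le> real q * \<rho>" unfolding \<sigma>_def \<rho>_def by linarith
        then show ?thesis using q0 by (simp add: field_simps)
      qed
      finally show ?thesis using u by (simp add: L_def)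
    qed
    then show "(\<lambda>u. (\<lambda>i. u i div int q, restrict (\<lambda>i. u i mod int q) D)) ` L \<sigma>
        \<subseteq> L \<rho> \<times> (D \<rightarrow>\<^sub>E {0..<int q})"
      using q0 by auto
  qed (use finL D in \<open>auto intro: finite_PiE\<close>)
  also have "\<dots> = card (L \<rho>) * q ^ card D"
    using D by (simp add: card_cartesian_product card_PiE)
  finally have "card (L \<rho>) * card S \<le> card (L \<rho>) * q ^ card D" by (simp add: mult.commute)
  moreover have "(\<lambda>i. 0) \<in> L \<rho>" using p0 \<rho> by (simp add: L_def)
  then have "0 < card (L \<rho>)" using finL by (auto simp: card_gt_0_iff)
  ultimately show ?thesis by simp
qed

lemma opnorm_ge_entry:
  assumes A: "A \<in> carrier_mat m n" and ij: "i < m" "j < n"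
  shows "cmod (A $$ (i, j)) \<le> mat_opnorm n A"
proof -
  let ?e = "unit_vec n j :: complex vec"
  have "(vec_norm2 ?e)\<^sup>2 = 1"
    using ij by (simp add: vec_norm2_power2 unit_vec_def if_distrib[where f = "\<lambda>x. (cmod x)\<^sup>2"]
        cong: if_cong)
  then have e: "vec_norm2 ?e = 1"
    using power2_eq_1_iff[of "vec_norm2 ?e"] vec_norm2_nonneg[of ?e] by linarith
  have "(A *\<^sub>v ?e) $ i = A $$ (i, j)"
    using A ij by simp
  then have "(cmod (A $$ (i, j)))\<^sup>2 \<le> (vec_norm2 (A *\<^sub>v ?e))\<^sup>2"
    unfolding vec_norm2_power2[of "A *\<^sub>v ?e"] using A ij
    by (intro order_trans[OF _ member_le_sum[of i]]) auto
  then have "cmod (A $$ (i, j)) \<le> vec_norm2 (A *\<^sub>v ?e)"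
    by (rule power2_le_imp_le) simp
  also have "\<dots> \<le> mat_opnorm n A" using opnorm_bound[OF A, of ?e] e by simp
  finally show ?thesis .
qed

lemma opnorm_packing:
  assumes S: "finite S" "S \<subseteq> carrier_mat m n"
    and bound: "\<And>A. A \<in> S \<Longrightarrow> mat_opnorm n A \<le> M"
    and sep: "\<And>A B. A \<in> S \<Longrightarrow> B \<in> S \<Longrightarrow> A \<noteq> B \<Longrightarrow> \<epsilon> \<le> mat_opnorm n (A - B)"
    and \<epsilon>: "0 < \<epsilon>" and M: "0 \<le> M" and q: "4 * M / \<epsilon> + 2 \<le> real q"
  shows "card S \<le> q ^ (2 * m * n)"
proof -
  define D :: "(nat \<times> nat \<times> bool) set" where "D = {..<m} \<times> {..<n} \<times> UNIV"
  define toM where "toM x = mat m n (\<lambda>(r, c). Complex (x (r, c, False)) (x (r, c, True)))"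
    for x :: "nat \<times> nat \<times> bool \<Rightarrow> real"
  define ofM where "ofM A = (\<lambda>(r, c, s). if s then Im (A $$ (r, c)) else Re (A $$ (r, c)))"
    for A :: "complex mat"
  have toM: "toM x \<in> carrier_mat m n" for x by (simp add: toM_def)
  have inv: "toM (ofM A) = A" if "A \<in> carrier_mat m n" for A
    using that by (auto simp: toM_def ofM_def intro!: eq_matI)
  have minus: "toM (\<lambda>i. x i - y i) = toM x - toM y" for x y
    by (auto simp: toM_def complex_eq_iff intro!: eq_matI)
  have inj: "inj_on ofM S" using S(2) inv by (metis inj_onI subsetD)
  have "card (ofM ` S) \<le> q ^ card D"
  proof (rule lattice_packing[where p = "\<lambda>x. mat_opnorm n (toM x)" and M = M and \<epsilon> = \<epsilon>])
    show "mat_opnorm n (toM (\<lambda>i. x i + y i)) \<le> mat_opnorm n (toM x) + mat_opnorm n (toM y)" for x y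
    proof -
      have "toM (\<lambda>i. x i + y i) = toM x + toM y"
        by (auto simp: toM_def complex_eq_iff intro!: eq_matI)
      then show ?thesis using opnorm_triangle[OF toM toM] by simp
    qed
    show "mat_opnorm n (toM (\<lambda>i. c * x i)) \<le> \<bar>c\<bar> * mat_opnorm n (toM x)" for c x
    proof -
      have "toM (\<lambda>i. c * x i) = complex_of_real c \<cdot>\<^sub>m toM x"
        by (auto simp: toM_def complex_eq_iff intro!: eq_matI)
      then show ?thesis using opnorm_smult_le[OF toM, of "complex_of_real c"] by simp
    qed
    show "\<bar>x i\<bar> \<le> mat_opnorm n (toM x)" if "i \<in> D" for x i
    proof -
      from that obtain r c s where i: "i = (r, c, s)" "r < m" "c < n" by (auto simp: D_def)
      have "\<bar>x i\<bar> \<le> cmod (toM x $$ (r, c))"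
        using i abs_Re_le_cmod[of "toM x $$ (r, c)"] abs_Im_le_cmod[of "toM x $$ (r, c)"]
        by (cases s) (auto simp: toM_def)
      then show ?thesis using opnorm_ge_entry[OF toM i(2,3), of x] by linarith
    qed
    show "mat_opnorm n (toM x) = mat_opnorm n (toM y)" if "\<And>i. i \<in> D \<Longrightarrow> x i = y i" for x y
    proof -
      have "toM x = toM y" using that by (auto simp: toM_def D_def intro!: eq_matI)
      then show ?thesis by simp
    qed
    show "mat_opnorm n (toM x) \<le> M" if "x \<in> ofM ` S" for x
      using that S(2) bound inv by auto
    show "\<epsilon> \<le> mat_opnorm n (toM (\<lambda>i. x i - y i))" if "x \<in> ofM ` S" "y \<in> ofM ` S" "x \<noteq> y" for x y
      using that S(2) sep inv unfolding minus by (smt (verit) imageE subsetD)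
  qed (use S \<epsilon> M q in \<open>auto simp: D_def\<close>)
  moreover have "card D = 2 * m * n"
    by (simp add: D_def card_cartesian_product UNIV_bool)
  ultimately show ?thesis using card_image[OF inj] by simp
qed

lemma opnorm_minus_self:
  assumes A: "A \<in> carrier_mat m n"
  shows "mat_opnorm n (A - A) \<le> 0"
proof (rule opnorm_le[where m = m])
  fix v :: "complex vec" assume v: "v \<in> carrier_vec n"
  have "(A - A) *\<^sub>v v = 0\<^sub>v m"
    using A v by (intro eq_vecI) (auto simp: scalar_prod_def)
  then show "vec_norm2 ((A - A) *\<^sub>v v) \<le> 0 * vec_norm2 v" by simp
qed (use A in auto)

text \<open>A separated set of maximal cardinality is a net.\<close>

lemma opnorm_net:
  assumes \<epsilon>: "0 < \<epsilon>" and M: "0 \<le> M" and q: "4 * M / \<epsilon> + 2 \<le> real q"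
  shows "\<exists>S. finite S \<and> S \<subseteq> carrier_mat m n \<and> card S \<le> q ^ (2 * m * n) \<and>
    (\<forall>A\<in>S. mat_opnorm n A \<le> M) \<and>
    (\<forall>A\<in>carrier_mat m n. mat_opnorm n A \<le> M \<longrightarrow> (\<exists>B\<in>S. mat_opnorm n (A - B) < \<epsilon>))"
proof -
  define Sep where "Sep S \<longleftrightarrow> finite S \<and> S \<subseteq> carrier_mat m n \<and> (\<forall>A\<in>S. mat_opnorm n A \<le> M) \<and>
    (\<forall>A\<in>S. \<forall>B\<in>S. A \<noteq> B \<longrightarrow> \<epsilon> \<le> mat_opnorm n (A - B))" for S
  have bound: "card S \<le> q ^ (2 * m * n)" if "Sep S" for S
    using that \<epsilon> M q by (intro opnorm_packing[where M = M and \<epsilon> = \<epsilon>]) (auto simp: Sep_def)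
  have "Sep {}" by (simp add: Sep_def)
  then have "\<exists>S. Sep S \<and> (\<forall>S'. Sep S' \<longrightarrow> card S' \<le> card S)"
    using bound by (intro ex_has_greatest_nat[where b = "Suc (q ^ (2 * m * n))"]) (auto simp: less_Suc_eq_le)
  then obtain S where S: "Sep S" and max: "\<And>S'. Sep S' \<Longrightarrow> card S' \<le> card S" by blast
  have sym: "mat_opnorm n (A - B) = mat_opnorm n (B - A)"
    if A: "A \<in> carrier_mat m n" and B: "B \<in> carrier_mat m n" for A B :: "complex mat"
  proof -
    have le: "mat_opnorm n (X - Y) \<le> mat_opnorm n (Y - X)"
      if "X \<in> carrier_mat m n" "Y \<in> carrier_mat m n" for X Y :: "complex mat"
    proof -
      have "X - Y = (-1) \<cdot>\<^sub>m (Y - X)" using that by (auto intro!: eq_matI)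
      then show ?thesis using opnorm_smult_le[OF minus_carrier_mat[OF that(1), of Y], of "-1"] by simp
    qed
    show ?thesis using le[OF A B] le[OF B A] by linarith
  qed
  have "\<exists>B\<in>S. mat_opnorm n (A - B) < \<epsilon>"
    if A: "A \<in> carrier_mat m n" "mat_opnorm n A \<le> M" for A
  proof (rule ccontr)
    assume "\<not> ?thesis"
    then have far: "\<epsilon> \<le> mat_opnorm n (A - B)" if "B \<in> S" for B using that by force
    have "mat_opnorm n (A - A) \<le> 0"
      by (rule opnorm_minus_self) (rule A)
    then have "A \<notin> S" using far[of A] \<epsilon> by auto
    moreover have "Sep (insert A S)"
      unfolding Sep_def using S A far sym
      by (auto simp: Sep_def) (metis subsetD)
    ultimately show False using max[of "insert A S"] S by (simp add: Sep_def)
  qed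
  then show ?thesis using S bound[OF S] by (intro exI[of _ S]) (simp add: Sep_def)
qed

section \<open>Unitary conjugation\<close>

lemma unitary_matsD:
  assumes "U \<in> unitary_mats N"
  shows "U \<in> carrier_mat N N" "mat_adjoint U \<in> carrier_mat N N"
    "mat_adjoint U * U = 1\<^sub>m N" "U * mat_adjoint U = 1\<^sub>m N"
  using assms by (auto simp: unitary_mats_def)

lemma unitary_mats_adjoint: "U \<in> unitary_mats N \<Longrightarrow> mat_adjoint U \<in> unitary_mats N"
  by (auto simp: unitary_mats_def)

lemma conjugate_mult:
  fixes A B X :: "complex mat"
  assumes A: "A \<in> carrier_mat N N" and B: "B \<in> carrier_mat N N" and X: "X \<in> carrier_mat N N"
  shows "A * B * X * mat_adjoint (A * B) = A * (B * X * mat_adjoint B) * mat_adjoint A"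
proof -
  have aA: "mat_adjoint A \<in> carrier_mat N N" and aB: "mat_adjoint B \<in> carrier_mat N N"
    using A B by auto
  have BX: "B * X \<in> carrier_mat N N" and BXB: "B * X * mat_adjoint B \<in> carrier_mat N N"
    using B X aB by auto
  have "A * B * X = A * (B * X)" by (rule assoc_mult_mat[OF A B X])
  then have "A * B * X * mat_adjoint (A * B) = A * (B * X) * (mat_adjoint B * mat_adjoint A)"
    using mat_adjoint_mult[OF A B] by simp
  also have "\<dots> = A * (B * X) * mat_adjoint B * mat_adjoint A"
    by (rule assoc_mult_mat[symmetric, OF mult_carrier_mat[OF A BX] aB aA])
  also have "A * (B * X) * mat_adjoint B = A * (B * X * mat_adjoint B)"
    by (rule assoc_mult_mat[OF A BX aB])
  finally show ?thesis .
qed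

lemma conjugate_minus:
  fixes A X Y :: "complex mat"
  assumes A: "A \<in> carrier_mat N N" and X: "X \<in> carrier_mat N N" and Y: "Y \<in> carrier_mat N N"
  shows "A * (X - Y) * mat_adjoint A = A * X * mat_adjoint A - A * Y * mat_adjoint A"
  using mult_minus_distrib_mat[OF A X Y]
    minus_mult_distrib_mat[OF mult_carrier_mat[OF A X] mult_carrier_mat[OF A Y] mat_adjoint_carrier[OF A]]
  by simp

lemma conjugate_add:
  fixes A X Y :: "complex mat"
  assumes A: "A \<in> carrier_mat N N" and X: "X \<in> carrier_mat N N" and Y: "Y \<in> carrier_mat N N"
  shows "A * (X + Y) * mat_adjoint A = A * X * mat_adjoint A + A * Y * mat_adjoint A"
  using mult_add_distrib_mat[OF A X Y]
    add_mult_distrib_mat[OF mult_carrier_mat[OF A X] mult_carrier_mat[OF A Y] mat_adjoint_carrier[OF A]]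
  by simp

lemma conjugate_carrier:
  fixes A X :: "complex mat"
  assumes "A \<in> carrier_mat N N" "X \<in> carrier_mat N N"
  shows "A * X * mat_adjoint A \<in> carrier_mat N N"
  using assms by auto

lemma conjugate_one:
  fixes X :: "complex mat"
  assumes "X \<in> carrier_mat N N"
  shows "1\<^sub>m N * X * mat_adjoint (1\<^sub>m N) = X"
  using assms by simp

lemma unitary_conjugate_inverse:
  assumes U: "U \<in> unitary_mats N" and X: "X \<in> carrier_mat N N"
  shows "mat_adjoint U * (U * X * mat_adjoint U) * mat_adjoint (mat_adjoint U) = X"
  using conjugate_mult[OF unitary_matsD(2)[OF U] unitary_matsD(1)[OF U] X] unitary_matsD(3)[OF U]
    conjugate_one[OF X] by simp

lemma unitary_conjugate_mult:
  assumes U: "U \<in> unitary_mats N" and X: "X \<in> carrier_mat N N" and Y: "Y \<in> carrier_mat N N"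
  shows "U * X * mat_adjoint U * (U * Y * mat_adjoint U) = U * (X * Y) * mat_adjoint U"
proof -
  note u = unitary_matsD(1)[OF U] and au = unitary_matsD(2)[OF U]
  have UX: "U * X \<in> carrier_mat N N" and UY: "U * Y \<in> carrier_mat N N" using u X Y by auto
  have "U * X * mat_adjoint U * (U * Y * mat_adjoint U) =
      U * X * (mat_adjoint U * (U * Y * mat_adjoint U))"
    by (rule assoc_mult_mat[OF UX au conjugate_carrier[OF u Y]])
  also have "mat_adjoint U * (U * Y * mat_adjoint U) = mat_adjoint U * (U * Y) * mat_adjoint U"
    by (rule assoc_mult_mat[symmetric, OF au UY au])
  also have "mat_adjoint U * (U * Y) = Y"
    using assoc_mult_mat[OF au u Y] unitary_matsD(3)[OF U] Y by simp
  also have "U * X * (Y * mat_adjoint U) = U * X * Y * mat_adjoint U"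
    by (rule assoc_mult_mat[symmetric, OF UX Y au])
  also have "U * X * Y = U * (X * Y)" by (rule assoc_mult_mat[OF u X Y])
  finally show ?thesis .
qed

lemma mat_adjoint_conjugate:
  fixes U X :: "complex mat"
  assumes U: "U \<in> carrier_mat N N" and X: "X \<in> carrier_mat N N"
  shows "mat_adjoint (U * X * mat_adjoint U) = U * mat_adjoint X * mat_adjoint U"
  using mat_adjoint_mult[OF mult_carrier_mat[OF U X] mat_adjoint_carrier[OF U]] mat_adjoint_mult[OF U X]
    assoc_mult_mat[OF U mat_adjoint_carrier[OF X] mat_adjoint_carrier[OF U]] by simp

lemma unitary_opnorm_le: "U \<in> unitary_mats N \<Longrightarrow> mat_opnorm N U \<le> 1"
  by (rule isometry_opnorm_le) (auto simp: unitary_mats_def)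

lemma mat_nceval_conjugate:
  assumes U: "U \<in> unitary_mats N" and A: "\<forall>i\<in>I. A i \<in> carrier_mat N N" and P: "P \<in> ncpolys I"
  shows "mat_nceval N (\<lambda>i. U * A i * mat_adjoint U) P = U * mat_nceval N A P * mat_adjoint U"
  using P
proof (induction P rule: ncpolys_induct)
  case (single w c)
  note u = unitary_matsD(1)[OF U] and au = unitary_matsD(2)[OF U]
  let ?B = "\<lambda>i. U * A i * mat_adjoint U"
  have B: "\<forall>i\<in>I. ?B i \<in> carrier_mat N N" using A u by (blast intro: conjugate_carrier)
  have word: "fst ` set l \<subseteq> I \<Longrightarrow> mat_word_eval N ?B (NCWord l) =
      U * mat_word_eval N A (NCWord l) * mat_adjoint U" for l
  proof (induction l)
    case Nil
    then show ?case using unitary_matsD[OF U] by (simp add: mat_word_eval_NCWord)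
  next
    case (Cons x l)
    obtain i s where x: "x = (i, s)" by force
    have Ai: "A i \<in> carrier_mat N N" using A Cons.prems x by auto
    have L: "mat_word_eval N A (NCWord l) \<in> carrier_mat N N"
      using Cons.prems by (intro mat_word_eval_carrier[OF A]) (auto simp: word_in_def)
    show ?case
      using Cons unitary_conjugate_mult[OF U Ai L]
        unitary_conjugate_mult[OF U mat_adjoint_carrier[OF Ai] L] mat_adjoint_conjugate[OF u Ai]
      by (simp add: x mat_word_eval_NCWord)
  qed
  have W: "mat_word_eval N A w \<in> carrier_mat N N" by (rule mat_word_eval_carrier[OF A single])
  have "mat_word_eval N ?B w = U * mat_word_eval N A w * mat_adjoint U"
    using word[of "letters w"] single by (simp add: word_in_def)
  moreover have "c \<cdot>\<^sub>m (U * mat_word_eval N A w * mat_adjoint U) =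
      U * (c \<cdot>\<^sub>m mat_word_eval N A w) * mat_adjoint U"
    using mult_smult_distrib[OF u W, of c] mult_smult_assoc_mat[OF mult_carrier_mat[OF u W] au, of c]
    by simp
  ultimately show ?case
    by (simp add: mat_nceval_single[OF A single] mat_nceval_single[OF B single])
next
  case (add P Q)
  then show ?case
    by (simp add: mat_nceval_add conjugate_add[OF unitary_matsD(1)[OF U]])
qed

section \<open>Polynomials are Lipschitz on bounded sets\<close>

lemma word_opnorm_bound:
  assumes A: "\<forall>i\<in>I. A i \<in> carrier_mat N N \<and> mat_opnorm N (A i) \<le> M" and w: "word_in I w"
  shows "mat_opnorm N (mat_word_eval N A w) \<le> (max 1 M) ^ length (letters w)"
proof -
  have "fst ` set l \<subseteq> I \<Longrightarrow> mat_opnorm N (mat_word_eval N A (NCWord l)) \<le> (max 1 M) ^ length l" for l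
  proof (induction l)
    case Nil
    then show ?case by (simp add: mat_word_eval_NCWord opnorm_one_le)
  next
    case (Cons x l)
    obtain i s where x: "x = (i, s)" by force
    let ?X = "if s then mat_adjoint (A i) else A i"
    have Ai: "A i \<in> carrier_mat N N" "mat_opnorm N (A i) \<le> M" using A Cons.prems x by auto
    then have X: "?X \<in> carrier_mat N N" "mat_opnorm N ?X \<le> max 1 M"
      using opnorm_adjoint[OF Ai(1)] by auto
    have L: "mat_word_eval N A (NCWord l) \<in> carrier_mat N N"
      using Cons.prems A by (intro mat_word_eval_carrier[of I]) (auto simp: word_in_def)
    have "mat_opnorm N (?X * mat_word_eval N A (NCWord l)) \<le>
        mat_opnorm N ?X * mat_opnorm N (mat_word_eval N A (NCWord l))"
      by (rule opnorm_mult[OF X(1) L])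
    also have "\<dots> \<le> max 1 M * (max 1 M) ^ length l"
      using Cons X(2) opnorm_nonneg[OF L] by (intro mult_mono) auto
    finally show ?case by (simp add: x mat_word_eval_NCWord)
  qed
  from this[of "letters w"] w show ?thesis by (simp add: word_in_def)
qed

lemma nceval_opnorm_bound:
  assumes "P \<in> ncpolys I"
  shows "\<exists>C\<ge>0. \<forall>N A. (\<forall>i\<in>I. A i \<in> carrier_mat N N \<and> mat_opnorm N (A i) \<le> M) \<longrightarrow>
    mat_opnorm N (mat_nceval N A P) \<le> C"
  using assms
proof (induction P rule: ncpolys_induct)
  case (single w c)
  show ?case
  proof (intro exI[of _ "cmod c * (max 1 M) ^ length (letters w)"] conjI allI impI)
    fix N and A :: "'a \<Rightarrow> complex mat"
    assume A: "\<forall>i\<in>I. A i \<in> carrier_mat N N \<and> mat_opnorm N (A i) \<le> M"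
    then have A': "\<forall>i\<in>I. A i \<in> carrier_mat N N" by blast
    have "mat_opnorm N (c \<cdot>\<^sub>m mat_word_eval N A w) \<le> cmod c * mat_opnorm N (mat_word_eval N A w)"
      by (rule opnorm_smult_le[OF mat_word_eval_carrier[OF A' single]])
    also have "\<dots> \<le> cmod c * (max 1 M) ^ length (letters w)"
      by (intro mult_left_mono word_opnorm_bound[OF A single]) simp
    finally show "mat_opnorm N (mat_nceval N A (Poly_Mapping.single w c)) \<le>
        cmod c * (max 1 M) ^ length (letters w)"
      by (simp add: mat_nceval_single[OF A' single])
  qed simp
next
  case (add P Q)
  then obtain C D where CD: "0 \<le> C" "0 \<le> D"
    and C: "\<And>N A. (\<forall>i\<in>I. A i \<in> carrier_mat N N \<and> mat_opnorm N (A i) \<le> M) \<Longrightarrow>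
      mat_opnorm N (mat_nceval N A P) \<le> C"
    and D: "\<And>N A. (\<forall>i\<in>I. A i \<in> carrier_mat N N \<and> mat_opnorm N (A i) \<le> M) \<Longrightarrow>
      mat_opnorm N (mat_nceval N A Q) \<le> D"
    by blast
  have "mat_opnorm N (mat_nceval N A (P + Q)) \<le> C + D"
    if "\<forall>i\<in>I. A i \<in> carrier_mat N N \<and> mat_opnorm N (A i) \<le> M" for N A
    using opnorm_triangle[OF mat_nceval_carrier[of N A P] mat_nceval_carrier[of N A Q]]
      C[OF that] D[OF that] by (simp add: mat_nceval_add)
  then show ?case using CD by (intro exI[of _ "C + D"]) auto
qed

lemma mat_minus_split:
  fixes X Y Z :: "complex mat"
  assumes "X \<in> carrier_mat m n" "Y \<in> carrier_mat m n" "Z \<in> carrier_mat m n"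
  shows "X - Z = (X - Y) + (Y - Z)"
  using assms by (intro eq_matI) auto

text \<open>The operator norm and the normalised Hilbert-Schmidt norm have these properties in common;
  unitary invariance and Lipschitz bounds for polynomials follow from them.\<close>

locale ideal_norm =
  fixes nrm :: "nat \<Rightarrow> complex mat \<Rightarrow> real"
  assumes nonneg: "A \<in> carrier_mat N N \<Longrightarrow> 0 \<le> nrm N A"
    and triangle: "A \<in> carrier_mat N N \<Longrightarrow> B \<in> carrier_mat N N \<Longrightarrow> nrm N (A + B) \<le> nrm N A + nrm N B"
    and mult_left: "A \<in> carrier_mat N N \<Longrightarrow> B \<in> carrier_mat N N \<Longrightarrow>
      nrm N (A * B) \<le> mat_opnorm N A * nrm N B"
    and mult_right: "A \<in> carrier_mat N N \<Longrightarrow> B \<in> carrier_mat N N \<Longrightarrow>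
      nrm N (A * B) \<le> nrm N A * mat_opnorm N B"
    and adjoint: "A \<in> carrier_mat N N \<Longrightarrow> nrm N (mat_adjoint A) = nrm N A"
    and smult: "A \<in> carrier_mat N N \<Longrightarrow> nrm N (c \<cdot>\<^sub>m A) \<le> cmod c * nrm N A"
    and le_opnorm: "A \<in> carrier_mat N N \<Longrightarrow> nrm N A \<le> mat_opnorm N A"
begin

lemma triangle_minus:
  assumes "A \<in> carrier_mat N N" "B \<in> carrier_mat N N" "C \<in> carrier_mat N N"
  shows "nrm N (A - C) \<le> nrm N (A - B) + nrm N (B - C)"
proof -
  have "A - C = (A - B) + (B - C)" by (rule mat_minus_split[OF assms])
  then show ?thesis
    using triangle[OF minus_carrier_mat[OF assms(2)] minus_carrier_mat[OF assms(3)], of A B] by simp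
qed

lemma minus_commute:
  assumes A: "A \<in> carrier_mat N N" and B: "B \<in> carrier_mat N N"
  shows "nrm N (A - B) = nrm N (B - A)"
proof -
  have le: "nrm N (X - Y) \<le> nrm N (Y - X)"
    if "X \<in> carrier_mat N N" "Y \<in> carrier_mat N N" for X Y :: "complex mat"
  proof -
    have "X - Y = (-1) \<cdot>\<^sub>m (Y - X)" using that by (intro eq_matI) auto
    then show ?thesis using smult[OF minus_carrier_mat[OF that(1), of Y], of "-1"] by simp
  qed
  show ?thesis using le[OF A B] le[OF B A] by linarith
qed

lemma unitary_conjugate_le:
  assumes U: "U \<in> unitary_mats N" and X: "X \<in> carrier_mat N N"
  shows "nrm N (U * X * mat_adjoint U) \<le> nrm N X"
proof -
  note u = unitary_matsD(1)[OF U] and au = unitary_matsD(2)[OF U]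
  have UX: "U * X \<in> carrier_mat N N" using u X by auto
  have "nrm N (U * X * mat_adjoint U) \<le> nrm N (U * X) * mat_opnorm N (mat_adjoint U)"
    by (rule mult_right[OF UX au])
  also have "\<dots> \<le> nrm N (U * X)"
    using unitary_opnorm_le[OF unitary_mats_adjoint[OF U]] nonneg[OF UX] by (simp add: mult_left_le)
  also have "\<dots> \<le> mat_opnorm N U * nrm N X" by (rule mult_left[OF u X])
  also have "\<dots> \<le> nrm N X"
    using unitary_opnorm_le[OF U] nonneg[OF X] by (simp add: mult_left_le_one_le opnorm_nonneg[OF u])
  finally show ?thesis .
qed

text \<open>Telescoping over the letters: each summand contains one difference, measured in \<open>nrm\<close>, and
  otherwise factors of bounded operator norm.\<close>

lemma word_lipschitz:
  assumes AB: "\<forall>i\<in>I. A i \<in> carrier_mat N N \<and> B i \<in> carrier_mat N N \<and>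
      mat_opnorm N (A i) \<le> M \<and> mat_opnorm N (B i) \<le> M \<and> nrm N (A i - B i) \<le> \<eta>"
    and \<eta>: "0 \<le> \<eta>" and w: "word_in I w"
  shows "nrm N (mat_word_eval N A w - mat_word_eval N B w) \<le>
    real (length (letters w)) * (max 1 M) ^ length (letters w) * \<eta>"
proof -
  let ?K = "max 1 M"
  have "fst ` set l \<subseteq> I \<Longrightarrow> nrm N (mat_word_eval N A (NCWord l) - mat_word_eval N B (NCWord l)) \<le>
      real (length l) * ?K ^ length l * \<eta>" for l
  proof (induction l)
    case Nil
    have "nrm N (1\<^sub>m N - 1\<^sub>m N) \<le> mat_opnorm N (1\<^sub>m N - 1\<^sub>m N)"
      by (rule le_opnorm[OF minus_carrier_mat[OF one_carrier_mat]])
    also have "\<dots> \<le> 0" by (rule opnorm_minus_self[OF one_carrier_mat])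
    finally show ?case by (simp add: mat_word_eval_NCWord)
  next
    case (Cons x l)
    obtain i s where x: "x = (i, s)" by force
    let ?X = "if s then mat_adjoint (A i) else A i" and ?Y = "if s then mat_adjoint (B i) else B i"
    let ?V = "mat_word_eval N A (NCWord l)" and ?W = "mat_word_eval N B (NCWord l)"
    have l: "word_in I (NCWord l)" using Cons.prems by (auto simp: word_in_def)
    have i: "A i \<in> carrier_mat N N" "B i \<in> carrier_mat N N" "mat_opnorm N (A i) \<le> M"
      "nrm N (A i - B i) \<le> \<eta>" using AB Cons.prems x by auto
    have X: "?X \<in> carrier_mat N N" "mat_opnorm N ?X \<le> ?K" and Y: "?Y \<in> carrier_mat N N"
      using i opnorm_adjoint[OF i(1)] by auto
    have XY: "nrm N (?X - ?Y) \<le> \<eta>"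
      using i(4) adjoint[OF minus_carrier_mat[OF i(2), of "A i"]] mat_adjoint_minus[OF i(1,2)] by auto
    have V: "?V \<in> carrier_mat N N" and W: "?W \<in> carrier_mat N N"
      using AB by (auto intro!: mat_word_eval_carrier[OF _ l])
    have Wn: "mat_opnorm N ?W \<le> ?K ^ length l"
      using word_opnorm_bound[of I B N M "NCWord l"] AB l by simp
    have d1: "?V - ?W \<in> carrier_mat N N" and d2: "?X - ?Y \<in> carrier_mat N N"
      by (rule minus_carrier_mat[OF W], rule minus_carrier_mat[OF Y])
    have "?X * ?V - ?Y * ?W = ?X * (?V - ?W) + (?X - ?Y) * ?W"
    proof -
      have "?X * (?V - ?W) = ?X * ?V - ?X * ?W" by (rule mult_minus_distrib_mat[OF X(1) V W])
      moreover have "(?X - ?Y) * ?W = ?X * ?W - ?Y * ?W" by (rule minus_mult_distrib_mat[OF X(1) Y W])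
      moreover have "?X * ?V - ?Y * ?W = (?X * ?V - ?X * ?W) + (?X * ?W - ?Y * ?W)"
        by (rule mat_minus_split[OF mult_carrier_mat[OF X(1) V] mult_carrier_mat[OF X(1) W]
              mult_carrier_mat[OF Y W]])
      ultimately show ?thesis by simp
    qed
    then have "nrm N (?X * ?V - ?Y * ?W) \<le> nrm N (?X * (?V - ?W)) + nrm N ((?X - ?Y) * ?W)"
      using triangle[OF mult_carrier_mat[OF X(1) d1] mult_carrier_mat[OF d2 W]] by simp
    also have "\<dots> \<le> mat_opnorm N ?X * nrm N (?V - ?W) + nrm N (?X - ?Y) * mat_opnorm N ?W"
      by (intro add_mono mult_left[OF X(1) d1] mult_right[OF d2 W])
    also have "\<dots> \<le> ?K * (real (length l) * ?K ^ length l * \<eta>) + \<eta> * ?K ^ length l"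
      using Cons XY X(2) Wn \<eta> nonneg[OF d1] opnorm_nonneg[OF W]
      by (intro add_mono mult_mono) auto
    also have "\<dots> \<le> ?K * (real (length l) * ?K ^ length l * \<eta>) + ?K * (\<eta> * ?K ^ length l)"
    proof -
      have "0 \<le> \<eta> * ?K ^ length l" using \<eta> by simp
      then have "1 * (\<eta> * ?K ^ length l) \<le> ?K * (\<eta> * ?K ^ length l)"
        by (intro mult_right_mono) auto
      then show ?thesis by simp
    qed
    also have "\<dots> = real (length (x # l)) * ?K ^ length (x # l) * \<eta>"
      by (simp add: algebra_simps)
    finally show ?case by (simp add: x mat_word_eval_NCWord)
  qed
  from this[of "letters w"] w show ?thesis by (simp add: word_in_def)
qed

lemma nceval_lipschitz:
  assumes "P \<in> ncpolys I"
  shows "\<exists>C\<ge>0. \<forall>N \<eta> A B. 0 \<le> \<eta> \<longrightarrow> (\<forall>i\<in>I. A i \<in> carrier_mat N N \<and> B i \<in> carrier_mat N N \<and>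
      mat_opnorm N (A i) \<le> M \<and> mat_opnorm N (B i) \<le> M \<and> nrm N (A i - B i) \<le> \<eta>) \<longrightarrow>
    nrm N (mat_nceval N A P - mat_nceval N B P) \<le> C * \<eta>"
  using assms
proof (induction P rule: ncpolys_induct)
  case (single w c)
  let ?C = "cmod c * (real (length (letters w)) * (max 1 M) ^ length (letters w))"
  show ?case
  proof (intro exI[of _ ?C] conjI allI impI)
    fix N \<eta> and A B :: "'a \<Rightarrow> complex mat"
    assume \<eta>: "0 \<le> \<eta>" and AB: "\<forall>i\<in>I. A i \<in> carrier_mat N N \<and> B i \<in> carrier_mat N N \<and>
      mat_opnorm N (A i) \<le> M \<and> mat_opnorm N (B i) \<le> M \<and> nrm N (A i - B i) \<le> \<eta>"
    then have A: "\<forall>i\<in>I. A i \<in> carrier_mat N N" and B: "\<forall>i\<in>I. B i \<in> carrier_mat N N" by blast+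
    let ?V = "mat_word_eval N A w" and ?W = "mat_word_eval N B w"
    have V: "?V \<in> carrier_mat N N" and W: "?W \<in> carrier_mat N N"
      using mat_word_eval_carrier[OF A single] mat_word_eval_carrier[OF B single] .
    have "c \<cdot>\<^sub>m ?V - c \<cdot>\<^sub>m ?W = c \<cdot>\<^sub>m (?V - ?W)"
      using V W by (intro eq_matI) (auto simp: right_diff_distrib)
    then have "nrm N (c \<cdot>\<^sub>m ?V - c \<cdot>\<^sub>m ?W) \<le> cmod c * nrm N (?V - ?W)"
      using smult[OF minus_carrier_mat[OF W]] by simp
    also have "\<dots> \<le> cmod c * (real (length (letters w)) * (max 1 M) ^ length (letters w) * \<eta>)"
      by (intro mult_left_mono word_lipschitz[OF AB \<eta> single]) simp
    finally show "nrm N (mat_nceval N A (Poly_Mapping.single w c) -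
        mat_nceval N B (Poly_Mapping.single w c)) \<le> ?C * \<eta>"
      by (simp add: mat_nceval_single[OF A single] mat_nceval_single[OF B single] mult_ac)
  qed simp
next
  case (add P Q)
  let ?near = "\<lambda>N \<eta> A B. \<forall>i\<in>I. A i \<in> carrier_mat N N \<and> B i \<in> carrier_mat N N \<and>
      mat_opnorm N (A i) \<le> M \<and> mat_opnorm N (B i) \<le> M \<and> nrm N (A i - B i) \<le> \<eta>"
  from add obtain C D where CD: "0 \<le> C" "0 \<le> D"
    and C: "\<And>N \<eta> A B. 0 \<le> \<eta> \<Longrightarrow> ?near N \<eta> A B \<Longrightarrow>
      nrm N (mat_nceval N A P - mat_nceval N B P) \<le> C * \<eta>"
    and D: "\<And>N \<eta> A B. 0 \<le> \<eta> \<Longrightarrow> ?near N \<eta> A B \<Longrightarrow>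
      nrm N (mat_nceval N A Q - mat_nceval N B Q) \<le> D * \<eta>"
    by blast
  have "nrm N (mat_nceval N A (P + Q) - mat_nceval N B (P + Q)) \<le> (C + D) * \<eta>"
    if \<eta>: "0 \<le> \<eta>" and AB: "?near N \<eta> A B" for N \<eta> A B
  proof -
    have "mat_nceval N A (P + Q) - mat_nceval N B (P + Q) =
        (mat_nceval N A P - mat_nceval N B P) + (mat_nceval N A Q - mat_nceval N B Q)"
      by (simp add: mat_nceval_add) (intro eq_matI; simp)
    then show ?thesis
      using triangle[OF minus_carrier_mat[OF mat_nceval_carrier[of N B P]]
          minus_carrier_mat[OF mat_nceval_carrier[of N B Q]],
          of "mat_nceval N A P" "mat_nceval N A Q"] C[OF \<eta> AB] D[OF \<eta> AB]
      by (simp add: distrib_right)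
  qed
  then show ?case using CD by (intro exI[of _ "C + D"]) auto
qed

lemma nceval_lipschitz_finite:
  assumes "finite G" "G \<subseteq> ncpolys I"
  obtains C where "0 < C"
    "\<And>P N \<eta> A B. P \<in> G \<Longrightarrow> 0 \<le> \<eta> \<Longrightarrow> (\<forall>i\<in>I. A i \<in> carrier_mat N N \<and> B i \<in> carrier_mat N N \<and>
      mat_opnorm N (A i) \<le> M \<and> mat_opnorm N (B i) \<le> M \<and> nrm N (A i - B i) \<le> \<eta>) \<Longrightarrow>
    nrm N (mat_nceval N A P - mat_nceval N B P) \<le> C * \<eta>"
proof -
  let ?near = "\<lambda>N \<eta> A B. \<forall>i\<in>I. A i \<in> carrier_mat N N \<and> B i \<in> carrier_mat N N \<and>
      mat_opnorm N (A i) \<le> M \<and> mat_opnorm N (B i) \<le> M \<and> nrm N (A i - B i) \<le> \<eta>"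
  have "\<forall>P\<in>G. \<exists>C\<ge>0. \<forall>N \<eta> A B. 0 \<le> \<eta> \<longrightarrow> ?near N \<eta> A B \<longrightarrow>
      nrm N (mat_nceval N A P - mat_nceval N B P) \<le> C * \<eta>"
    using nceval_lipschitz assms(2) by blast
  from bchoice[OF this] obtain C where C: "\<forall>P\<in>G. 0 \<le> C P \<and> (\<forall>N \<eta> A B. 0 \<le> \<eta> \<longrightarrow> ?near N \<eta> A B \<longrightarrow>
      nrm N (mat_nceval N A P - mat_nceval N B P) \<le> C P * \<eta>)" ..
  show ?thesis
  proof (rule that[of "1 + (\<Sum>P\<in>G. C P)"])
    show "0 < 1 + (\<Sum>P\<in>G. C P)" using C by (intro add_pos_nonneg sum_nonneg) auto
    fix P N \<eta> A B assume P: "P \<in> G" and \<eta>: "0 \<le> \<eta>" and AB: "?near N \<eta> A B"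
    have "nrm N (mat_nceval N A P - mat_nceval N B P) \<le> C P * \<eta>" using C P \<eta> AB by blast
    also have "C P \<le> (\<Sum>P\<in>G. C P)" using C P assms(1) by (intro member_le_sum) auto
    also have "\<dots> \<le> 1 + (\<Sum>P\<in>G. C P)" by simp
    finally show "nrm N (mat_nceval N A P - mat_nceval N B P) \<le> (1 + (\<Sum>P\<in>G. C P)) * \<eta>"
      using \<eta> by (simp add: mult_right_mono)
  qed
qed

section \<open>Comparison of orbital covering numbers\<close>

text \<open>The covering number is controlled by covers whose centres need not lie in the covered set,
  at half the radius: each centre that is used is replaced by a point of the set close to its orbit.\<close>

lemma K_orb_le_external:
  fixes \<Omega> :: "('i \<Rightarrow> complex mat) set" and c :: "'t \<Rightarrow> 'i \<Rightarrow> complex mat"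
  assumes T: "finite T"
    and \<Omega>: "\<And>C i. C \<in> \<Omega> \<Longrightarrow> i \<in> F \<Longrightarrow> C i \<in> carrier_mat N N"
    and c: "\<And>t i. t \<in> T \<Longrightarrow> i \<in> F \<Longrightarrow> c t i \<in> carrier_mat N N"
    and cover: "\<And>C. C \<in> \<Omega> \<Longrightarrow> \<exists>t\<in>T. \<exists>U\<in>unitary_mats N. \<forall>i\<in>F.
      nrm N (C i - U * c t i * mat_adjoint U) < \<epsilon> / 2"
  shows "K_orb nrm N F \<epsilon> \<Omega> \<le> enat (card T)"
proof -
  define near where "near C t U \<longleftrightarrow> U \<in> unitary_mats N \<and>
      (\<forall>i\<in>F. nrm N (C i - U * c t i * mat_adjoint U) < \<epsilon> / 2)" for C t U
  define T' where "T' = {t \<in> T. \<exists>C\<in>\<Omega>. \<exists>U. near C t U}"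
  have "\<forall>t\<in>T'. \<exists>C. C \<in> \<Omega> \<and> (\<exists>U. near C t U)" by (auto simp: T'_def)
  then obtain r where r: "\<And>t. t \<in> T' \<Longrightarrow> r t \<in> \<Omega>" "\<And>t. t \<in> T' \<Longrightarrow> \<exists>U. near (r t) t U" by metis
  have T': "finite T'" "card T' \<le> card T" using T by (auto simp: T'_def intro: card_mono)
  have "\<exists>B\<in>r ` T'. \<exists>W\<in>unitary_mats N. \<forall>i\<in>F. nrm N (C i - W * B i * mat_adjoint W) < \<epsilon>"
    if C: "C \<in> \<Omega>" for C
  proof -
    from cover[OF C] obtain t U where t: "t \<in> T" and U: "near C t U" by (auto simp: near_def)
    then have t': "t \<in> T'" using C by (auto simp: T'_def)
    from r(2)[OF t'] obtain V where V: "near (r t) t V" ..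
    have u: "U \<in> unitary_mats N" and v: "V \<in> unitary_mats N" using U V by (auto simp: near_def)
    note uc = unitary_matsD[OF u] and vc = unitary_matsD[OF v]
    let ?W = "U * mat_adjoint V"
    have W: "?W \<in> unitary_mats N"
    proof -
      have ad: "mat_adjoint ?W = V * mat_adjoint U" using mat_adjoint_mult[OF uc(1) vc(2)] by simp
      have "?W * 1\<^sub>m N * mat_adjoint ?W = U * (mat_adjoint V * 1\<^sub>m N * mat_adjoint (mat_adjoint V)) * mat_adjoint U"
        by (rule conjugate_mult[OF uc(1) vc(2) one_carrier_mat])
      moreover have "V * mat_adjoint U * 1\<^sub>m N * mat_adjoint (V * mat_adjoint U) =
          V * (mat_adjoint U * 1\<^sub>m N * mat_adjoint (mat_adjoint U)) * mat_adjoint V"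
        by (rule conjugate_mult[OF vc(1) uc(2) one_carrier_mat])
      moreover have "mat_adjoint (V * mat_adjoint U) = ?W"
        using mat_adjoint_mult[OF vc(1) uc(2)] by simp
      ultimately show ?thesis
        using uc vc ad by (simp add: unitary_mats_def ad)
    qed
    have "nrm N (C i - ?W * r t i * mat_adjoint ?W) < \<epsilon>" if i: "i \<in> F" for i
    proof -
      have cc: "c t i \<in> carrier_mat N N" by (rule c[OF t i])
      have rc: "r t i \<in> carrier_mat N N" and Cc: "C i \<in> carrier_mat N N"
        using \<Omega> r(1)[OF t'] C i by auto
      let ?X = "U * c t i * mat_adjoint U" and ?Y = "V * c t i * mat_adjoint V"
      have X: "?X \<in> carrier_mat N N" and Y: "?Y \<in> carrier_mat N N"
        using conjugate_carrier[OF uc(1) cc] conjugate_carrier[OF vc(1) cc] .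
      have Wc: "?W \<in> carrier_mat N N" using unitary_matsD(1)[OF W] .
      have "?W * ?Y * mat_adjoint ?W = ?X"
        using conjugate_mult[OF uc(1) vc(2) Y] unitary_conjugate_inverse[OF v cc] by simp
      then have "?X - ?W * r t i * mat_adjoint ?W = ?W * (?Y - r t i) * mat_adjoint ?W"
        using conjugate_minus[OF Wc Y rc] by simp
      then have "nrm N (?X - ?W * r t i * mat_adjoint ?W) \<le> nrm N (?Y - r t i)"
        using unitary_conjugate_le[OF W minus_carrier_mat[OF rc]] by simp
      also have "\<dots> < \<epsilon> / 2" using V i minus_commute[OF Y rc] by (simp add: near_def)
      finally have "nrm N (?X - ?W * r t i * mat_adjoint ?W) < \<epsilon> / 2" .
      moreover have "nrm N (C i - ?X) < \<epsilon> / 2" using U i by (simp add: near_def)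
      ultimately show ?thesis
        using triangle_minus[OF Cc X conjugate_carrier[OF Wc rc]] by linarith
    qed
    then show ?thesis using W t' by blast
  qed
  then have "K_orb nrm N F \<epsilon> \<Omega> \<le> enat (card (r ` T'))"
    unfolding K_orb_def using T' r(1) by (intro INF_lower) auto
  also have "card (r ` T') \<le> card T" using card_image_le[OF T'(1)] T'(2) order_trans by blast
  finally show ?thesis by simp
qed

end

lemma log_enat_mono: "m \<le> n \<Longrightarrow> log_enat m \<le> log_enat n"
  by (auto simp: log_enat_def split: enat.splits)

lemma nceval_tendsto:
  fixes b :: "'j \<Rightarrow> 'a::cstar_algebra"
  assumes b: "\<And>j. (\<lambda>n. x j n) \<longlonglongrightarrow> b j"
  shows "(\<lambda>n. nceval (\<lambda>j. x j n) P) \<longlonglongrightarrow> nceval b P"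
proof -
  have "P \<in> ncpolys UNIV" by simp
  then show ?thesis
  proof (induction P rule: ncpolys_induct)
    case (single w c)
    have "(\<lambda>n. word_eval (\<lambda>j. x j n) (NCWord l)) \<longlonglongrightarrow> word_eval b (NCWord l)" for l
    proof (induction l)
      case (Cons y l)
      obtain i s where y: "y = (i, s)" by force
      have "(\<lambda>n. if s then adj (x i n) else x i n) \<longlonglongrightarrow> (if s then adj (b i) else b i)"
        using b bounded_linear.tendsto[OF bounded_linear_adj b] by simp
      from tendsto_mult[OF this Cons] show ?case by (simp add: y word_eval_def)
    qed (simp add: word_eval_def)
    from this[of "letters w"] have "(\<lambda>n. word_eval (\<lambda>j. x j n) w) \<longlonglongrightarrow> word_eval b w" by simp
    then have "(\<lambda>n. (c *\<^sub>C 1) * word_eval (\<lambda>j. x j n) w) \<longlonglongrightarrow> (c *\<^sub>C 1) * word_eval b w"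
      by (intro tendsto_mult tendsto_const)
    then show ?case by (simp add: mult_scaleC_left)
  next
    case (add P Q)
    then show ?case by (simp add: nceval_add tendsto_add)
  qed
qed

lemma ncpolys_finite_support_finite:
  assumes "finite G" "G \<subseteq> ncpolys I"
  obtains F where "finite F" "F \<subseteq> I" "G \<subseteq> ncpolys F"
proof -
  have "\<forall>P\<in>G. \<exists>F. finite F \<and> F \<subseteq> I \<and> P \<in> ncpolys F"
    using ncpolys_finite_support assms(2) by (metis subsetD)
  from bchoice[OF this] obtain f where f: "\<forall>P\<in>G. finite (f P) \<and> f P \<subseteq> I \<and> P \<in> ncpolys (f P)" ..
  show ?thesis
  proof (rule that[of "\<Union>P\<in>G. f P"])
    show "G \<subseteq> ncpolys (\<Union>P\<in>G. f P)"
    proof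
      fix P assume P: "P \<in> G"
      then have "P \<in> ncpolys (f P)" using f by blast
      then show "P \<in> ncpolys (\<Union>P\<in>G. f P)" using ncpolys_mono[of "f P" "\<Union>P\<in>G. f P"] P by blast
    qed
  qed (use f assms(1) in auto)
qed

section \<open>Entropy of microstates and its independence of the generators\<close>

text \<open>The last assumption is the cut-off of singular values: a bound of order \<open>s\<close> on a
  high moment of \<open>X\<close>, measured by \<open>\<mu>\<close>, allows a small change in \<open>nrm\<close> to bring its operator norm
  down to \<open>t > s\<close>.  The exponent may depend on the a priori bound \<open>M\<close>, but \<open>s\<close> and \<open>t\<close> do not;
  this order of choices matters when \<open>X\<close> is a polynomial in microstates.\<close>

locale entropy_pair = ideal_norm nrm for nrm +
  fixes \<mu> :: "nat \<Rightarrow> complex mat \<Rightarrow> real"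
  assumes size_close: "X \<in> carrier_mat N N \<Longrightarrow> Y \<in> carrier_mat N N \<Longrightarrow> \<mu> N X \<le> \<mu> N Y + nrm N (X - Y)"
    and square_le_size: "0 < N \<Longrightarrow> X \<in> carrier_mat N N \<Longrightarrow> (nrm N X)\<^sup>2 \<le> \<mu> N (mat_adjoint X * X)"
    and truncation: "0 \<le> s \<Longrightarrow> s < t \<Longrightarrow> 0 < e \<Longrightarrow> \<exists>k>0. \<forall>N>0. \<forall>X\<in>carrier_mat N N.
      mat_opnorm N X \<le> M \<longrightarrow> \<mu> N ((mat_adjoint X * X) ^\<^sub>m k) \<le> s ^ (2 * k) \<longrightarrow>
      (\<exists>Y\<in>carrier_mat N N. mat_opnorm N Y \<le> t \<and> nrm N (X - Y) \<le> e)"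

text \<open>In the applications \<open>\<mu>\<close> is the operator norm or the absolute value of the normalised trace.\<close>

definition size_microstates :: "(nat \<Rightarrow> complex mat \<Rightarrow> real) \<Rightarrow> nat \<Rightarrow> real \<Rightarrow> 'i set \<Rightarrow>
    ('i \<Rightarrow> 'a::cstar_algebra) \<Rightarrow> 'i ncpoly set \<Rightarrow> real \<Rightarrow> ('i \<Rightarrow> complex mat) set" where
  "size_microstates \<mu> N R I a Q \<delta> =
     {A \<in> mat_tuples N R I. \<forall>P\<in>Q. \<mu> N (mat_nceval N A P) \<le> norm (nceval a P) + \<delta>}"

definition size_entropy :: "(nat \<Rightarrow> complex mat \<Rightarrow> real) \<Rightarrow> (nat \<Rightarrow> complex mat \<Rightarrow> real) \<Rightarrow> real \<Rightarrow>
    'i set \<Rightarrow> ('i \<Rightarrow> 'a::cstar_algebra) \<Rightarrow> ereal" where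
  "size_entropy nrm \<mu> R I a =
     (SUP (F, \<epsilon>)\<in>{(F, \<epsilon>). finite F \<and> F \<subseteq> I \<and> 0 < \<epsilon>}.
      INF (\<delta>, Q)\<in>{(\<delta>, Q). 0 < \<delta> \<and> finite Q \<and> Q \<subseteq> ncpolys I}.
        limsup (\<lambda>N. ereal (1 / (real N)\<^sup>2) *
          log_enat (K_orb nrm N F \<epsilon> (size_microstates \<mu> N R I a Q \<delta>))))"

lemma mat_tuplesD:
  assumes "A \<in> mat_tuples N R I"
  shows "\<forall>i\<in>I. A i \<in> carrier_mat N N" "\<forall>i\<in>I. mat_opnorm N (A i) \<le> R"
  using assms by (auto simp: mat_tuples_def)

context entropy_pair
begin

text \<open>Evaluate the approximants \<open>f\<^sub>j\<close> of \<open>b\<^sub>j\<close> at \<open>A\<close>, cut off their singular values, and scale the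
  result down to norm at most \<open>S\<close>.  The finite set \<open>Q\<close> consists of the compositions \<open>P \<circ> f\<close>, which
  control the new microstate conditions, of the squares of \<open>g\<^sub>i \<circ> f - T\<^sub>i\<close>, which control how well
  \<open>A\<^sub>i\<close> is recovered, and of the moments of \<open>f\<^sub>j\<close>, which control the cut-off.\<close>

lemma microstates_transfer:
  fixes a :: "'i \<Rightarrow> 'a::cstar_algebra" and b :: "'j \<Rightarrow> 'a"
  assumes gen: "generating I a" and S: "R_bounded S J b"
    and F: "finite F" "F \<subseteq> I" and F': "F' \<subseteq> J" "finite F'"
    and g: "\<forall>i\<in>F. g i \<in> ncpolys F'" "\<forall>i\<in>F. norm (nceval b (g i) - a i) < \<eta>"
    and \<eta>: "0 < \<eta>" and Q': "finite Q'" "Q' \<subseteq> ncpolys J" and \<delta>': "0 < \<delta>'"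
  shows "\<exists>Q \<delta>. finite Q \<and> Q \<subseteq> ncpolys I \<and> 0 < \<delta> \<and>
    (\<forall>N>0. \<forall>A\<in>size_microstates \<mu> N R I a Q \<delta>. \<exists>B\<in>size_microstates \<mu> N S J b Q' \<delta>'.
      \<forall>i\<in>F. nrm N (A i - mat_nceval N B (g i)) \<le> 4 * \<eta>)"
proof -
  obtain J1 where J1: "finite J1" "J1 \<subseteq> J" "Q' \<subseteq> ncpolys J1"
    using ncpolys_finite_support_finite[OF Q'] by metis
  define J0 where "J0 = J1 \<union> F'"
  have J0: "finite J0" "J0 \<subseteq> J" using J1 F' by (auto simp: J0_def)
  define G where "G = Q' \<union> g ` F"
  have G: "finite G" "G \<subseteq> ncpolys J0"
  proof -
    show "finite G" using Q' F by (simp add: G_def)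
    have "ncpolys J1 \<subseteq> ncpolys J0" "ncpolys F' \<subseteq> ncpolys J0"
      by (auto simp: J0_def intro!: ncpolys_mono)
    then show "G \<subseteq> ncpolys J0" using J1 g(1) by (auto simp: G_def)
  qed
  have GJ: "G \<subseteq> ncpolys J" using G(2) ncpolys_mono[OF J0(2)] by blast
  define S0 where "S0 = max S 0"
  have S0: "0 \<le> S0" and SS0: "j \<in> J \<Longrightarrow> S0 = S" for j
  proof -
    show "0 \<le> S0" by (simp add: S0_def)
    assume "j \<in> J"
    then have "norm (b j) \<le> S" using S by (auto simp: R_bounded_def)
    then have "0 \<le> S" using norm_ge_zero[of "b j"] by linarith
    then show "S0 = S" by (simp add: S0_def)
  qed
  obtain C1 where C1: "0 < C1"
    and lip1: "\<And>P N \<eta> A B. P \<in> G \<Longrightarrow> 0 \<le> \<eta> \<Longrightarrow> (\<forall>i\<in>J0. A i \<in> carrier_mat N N \<and> B i \<in> carrier_mat N N \<and>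
      mat_opnorm N (A i) \<le> S0 + 1 \<and> mat_opnorm N (B i) \<le> S0 + 1 \<and> nrm N (A i - B i) \<le> \<eta>) \<Longrightarrow>
    nrm N (mat_nceval N A P - mat_nceval N B P) \<le> C1 * \<eta>"
    using nceval_lipschitz_finite[OF G] by metis
  define m where "m = min (\<delta>' / 4) \<eta>"
  have m: "0 < m" "m \<le> \<delta>' / 4" "m \<le> \<eta>" using \<delta>' \<eta> by (auto simp: m_def)
  \<comment> \<open>cut-off matrices have norm at most \<open>S0 + 2 * d\<close>, and scaling them to norm \<open>S0\<close> moves them by
    at most \<open>2 * d\<close>; since \<open>C1\<close> does not depend on the approximants, neither does \<open>d\<close>\<close>
  define d where "d = min (1 / 2) (m / (2 * C1))"
  have d: "0 < d" "2 * d \<le> 1" using m C1 by (auto simp: d_def)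
  have C1d: "C1 * (2 * d) \<le> m"
  proof -
    have "d \<le> m / (2 * C1)" by (simp add: d_def)
    then show ?thesis using C1 by (simp add: field_simps)
  qed
  have "\<forall>j. \<exists>p. (\<forall>n. p n \<in> ncpolys I) \<and> (\<lambda>n. nceval a (p n)) \<longlonglongrightarrow> b j"
    using approximating_polys[OF gen] by metis
  then obtain p where p: "\<And>j n. p j n \<in> ncpolys I" "\<And>j. (\<lambda>n. nceval a (p j n)) \<longlonglongrightarrow> b j"
    by metis
  have "\<forall>\<^sub>F n in sequentially. (\<forall>P\<in>Q'. norm (nceval (\<lambda>j. nceval a (p j n)) P) < norm (nceval b P) + \<delta>' / 4) \<and>
     (\<forall>i\<in>F. norm (nceval (\<lambda>j. nceval a (p j n)) (g i) - a i) < \<eta>) \<and>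
     (\<forall>j\<in>J0. norm (nceval a (p j n)) < S0 + d / 2)"
  proof (intro eventually_conj eventually_ball_finite ballI Q'(1) F(1) J0(1))
    fix P show "\<forall>\<^sub>F n in sequentially. norm (nceval (\<lambda>j. nceval a (p j n)) P) < norm (nceval b P) + \<delta>' / 4"
      by (rule order_tendstoD(2)[OF tendsto_norm[OF nceval_tendsto[OF p(2)]]]) (use \<delta>' in simp)
  next
    fix i assume "i \<in> F"
    then show "\<forall>\<^sub>F n in sequentially. norm (nceval (\<lambda>j. nceval a (p j n)) (g i) - a i) < \<eta>"
      by (intro order_tendstoD(2)[OF tendsto_norm[OF tendsto_diff[OF nceval_tendsto[OF p(2)] tendsto_const]]] g(2)[rule_format])
  next
    fix j assume j: "j \<in> J0"
    have "norm (b j) \<le> S" using S j J0(2) by (auto simp: R_bounded_def)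
    then have "norm (b j) < S0 + d / 2" using d by (simp add: S0_def)
    then show "\<forall>\<^sub>F n in sequentially. norm (nceval a (p j n)) < S0 + d / 2"
      by (intro order_tendstoD(2)[OF tendsto_norm[OF p(2)]])
  qed
  then obtain n where n: "\<forall>P\<in>Q'. norm (nceval (\<lambda>j. nceval a (p j n)) P) < norm (nceval b P) + \<delta>' / 4"
     "\<forall>i\<in>F. norm (nceval (\<lambda>j. nceval a (p j n)) (g i) - a i) < \<eta>"
     "\<forall>j\<in>J0. norm (nceval a (p j n)) < S0 + d / 2"
    using eventually_happens'[OF sequentially_bot] by blast
  define f where "f j = p j n" for j
  have f: "f j \<in> ncpolys I" for j using p(1) by (simp add: f_def)
  note nf = n[folded f_def]
  obtain M where M: "S0 + 1 \<le> M"
    and boundM: "\<And>j N A. j \<in> J0 \<Longrightarrow> (\<forall>i\<in>I. A i \<in> carrier_mat N N \<and> mat_opnorm N (A i) \<le> R) \<Longrightarrow>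
      mat_opnorm N (mat_nceval N A (f j)) \<le> M"
  proof -
    have "\<forall>j\<in>J0. \<exists>C\<ge>0. \<forall>N A. (\<forall>i\<in>I. A i \<in> carrier_mat N N \<and> mat_opnorm N (A i) \<le> R) \<longrightarrow>
      mat_opnorm N (mat_nceval N A (f j)) \<le> C"
      using nceval_opnorm_bound[OF f] by blast
    from bchoice[OF this] obtain C where C: "\<forall>j\<in>J0. 0 \<le> C j \<and>
      (\<forall>N A. (\<forall>i\<in>I. A i \<in> carrier_mat N N \<and> mat_opnorm N (A i) \<le> R) \<longrightarrow>
      mat_opnorm N (mat_nceval N A (f j)) \<le> C j)" ..
    have sum: "C j \<le> (\<Sum>j\<in>J0. C j)" if "j \<in> J0" for j
      using that C J0(1) by (intro member_le_sum) auto
    have sum0: "0 \<le> (\<Sum>j\<in>J0. C j)" using C by (intro sum_nonneg) auto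
    show ?thesis
    proof (rule that[of "S0 + 1 + (\<Sum>j\<in>J0. C j)"])
      fix j N A assume "j \<in> J0" "\<forall>i\<in>I. A i \<in> carrier_mat N N \<and> mat_opnorm N (A i) \<le> R"
      then have "mat_opnorm N (mat_nceval N A (f j)) \<le> C j" using C by blast
      then show "mat_opnorm N (mat_nceval N A (f j)) \<le> S0 + 1 + (\<Sum>j\<in>J0. C j)"
        using sum[OF \<open>j \<in> J0\<close>] S0 by linarith
    qed (use sum0 in simp)
  qed
  obtain C2 where C2: "0 < C2"
    and lip2: "\<And>P N \<eta> A B. P \<in> G \<Longrightarrow> 0 \<le> \<eta> \<Longrightarrow> (\<forall>i\<in>J0. A i \<in> carrier_mat N N \<and> B i \<in> carrier_mat N N \<and>
      mat_opnorm N (A i) \<le> M \<and> mat_opnorm N (B i) \<le> M \<and> nrm N (A i - B i) \<le> \<eta>) \<Longrightarrow>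
    nrm N (mat_nceval N A P - mat_nceval N B P) \<le> C2 * \<eta>"
    using nceval_lipschitz_finite[OF G] by metis
  \<comment> \<open>the cut-off acts on matrices of norm up to \<open>M\<close>, so its accuracy is chosen after \<open>M\<close>\<close>
  define e where "e = m / C2"
  have e: "0 < e" "C2 * e = m" using m C2 by (auto simp: e_def)
  obtain k where k: "0 < k" and trunc: "\<And>N X. 0 < N \<Longrightarrow> X \<in> carrier_mat N N \<Longrightarrow> mat_opnorm N X \<le> M \<Longrightarrow>
      \<mu> N ((mat_adjoint X * X) ^\<^sub>m k) \<le> (S0 + d) ^ (2 * k) \<Longrightarrow>
      \<exists>Y\<in>carrier_mat N N. mat_opnorm N Y \<le> S0 + 2 * d \<and> nrm N (X - Y) \<le> e"
    using truncation[of "S0 + d" "S0 + 2 * d" e M] S0 d(1) e(1) by auto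
  have "\<forall>P\<in>G. \<exists>P'\<in>ncpolys I. nceval a P' = nceval (\<lambda>j. nceval a (f j)) P \<and>
    (\<forall>N A. (\<forall>i\<in>I. A i \<in> carrier_mat N N) \<longrightarrow>
       mat_nceval N A P' = mat_nceval N (\<lambda>j. mat_nceval N A (f j)) P)"
    using ncpolys_substitute[where f = f and J = J and I = I and 'a = 'a] f GJ by blast
  from bchoice[OF this[unfolded Bex_def]] obtain sub where sub: "\<And>P. P \<in> G \<Longrightarrow> sub P \<in> ncpolys I"
    and sub_ev: "\<And>P. P \<in> G \<Longrightarrow> nceval a (sub P) = nceval (\<lambda>j. nceval a (f j)) P"
    and sub_mat: "\<And>P N A. P \<in> G \<Longrightarrow> \<forall>i\<in>I. A i \<in> carrier_mat N N \<Longrightarrow>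
       mat_nceval N A (sub P) = mat_nceval N (\<lambda>j. mat_nceval N A (f j)) P"
    by blast
  define h where "h i = sub (g i) + ncconst (-1) * ncvar i" for i
  have h: "h i \<in> ncpolys I" if "i \<in> F" for i
    unfolding h_def using that F
    by (intro ncpolys_add ncpolys_mult ncpolys_const ncpolys_var sub) (auto simp: G_def)
  define Q where "Q = sub ` Q' \<union> (\<lambda>i. ncadj (h i) * h i) ` F \<union> (\<lambda>j. (ncadj (f j) * f j) ^ k) ` J0"
  define \<delta> where "\<delta> = min (\<delta>' / 4) (min (\<eta>\<^sup>2) ((S0 + d) ^ (2 * k) - (S0 + d / 2) ^ (2 * k)))"
  have \<delta>: "0 < \<delta>" "\<delta> \<le> \<delta>' / 4" "\<delta> \<le> \<eta>\<^sup>2" "(S0 + d / 2) ^ (2 * k) + \<delta> \<le> (S0 + d) ^ (2 * k)"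
  proof -
    have "(S0 + d / 2) ^ (2 * k) < (S0 + d) ^ (2 * k)"
      using S0 d k by (intro power_strict_mono) auto
    then show "0 < \<delta>" using \<delta>' \<eta> by (simp add: \<delta>_def)
    show "\<delta> \<le> \<delta>' / 4" unfolding \<delta>_def by (rule min.cobounded1)
    show "\<delta> \<le> \<eta>\<^sup>2" by (simp add: \<delta>_def)
    have "\<delta> \<le> (S0 + d) ^ (2 * k) - (S0 + d / 2) ^ (2 * k)" by (simp add: \<delta>_def)
    then show "(S0 + d / 2) ^ (2 * k) + \<delta> \<le> (S0 + d) ^ (2 * k)" by linarith
  qed
  have "\<exists>B\<in>size_microstates \<mu> N S J b Q' \<delta>'. \<forall>i\<in>F. nrm N (A i - mat_nceval N B (g i)) \<le> 4 * \<eta>"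
    if N: "0 < N" and A: "A \<in> size_microstates \<mu> N R I a Q \<delta>" for N A
  proof -
    have At: "A \<in> mat_tuples N R I" and AQ: "\<And>P. P \<in> Q \<Longrightarrow> \<mu> N (mat_nceval N A P) \<le> norm (nceval a P) + \<delta>"
      using A by (auto simp: size_microstates_def)
    note Ac = mat_tuplesD(1)[OF At]
    define X where "X j = mat_nceval N A (f j)" for j
    have X: "X j \<in> carrier_mat N N" for j by (simp add: X_def)
    have XM: "mat_opnorm N (X j) \<le> M" if "j \<in> J0" for j
      unfolding X_def using boundM[OF that] mat_tuplesD[OF At] by blast
    have "\<exists>Y. Y \<in> carrier_mat N N \<and> mat_opnorm N Y \<le> S0 + 2 * d \<and> nrm N (X j - Y) \<le> e"
      if j: "j \<in> J0" for j
    proof -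
      have "mat_nceval N A ((ncadj (f j) * f j) ^ k) = (mat_adjoint (X j) * X j) ^\<^sub>m k"
        using mat_nceval_power[OF Ac ncpolys_mult[OF ncpolys_adj[OF f] f]]
          mat_nceval_mult[OF Ac ncpolys_adj[OF f] f] mat_nceval_adj[OF Ac f]
        by (simp add: X_def)
      moreover have "(ncadj (f j) * f j) ^ k \<in> Q" using j by (simp add: Q_def)
      ultimately have "\<mu> N ((mat_adjoint (X j) * X j) ^\<^sub>m k) \<le> norm (nceval a ((ncadj (f j) * f j) ^ k)) + \<delta>"
        using AQ by metis
      also have "norm (nceval a ((ncadj (f j) * f j) ^ k)) \<le> ((norm (nceval a (f j)))\<^sup>2) ^ k"
        using norm_power_ineq[of "adj (nceval a (f j)) * nceval a (f j)" k]
        by (simp add: nceval_power nceval_mult nceval_adj cstar_identity)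
      also have "\<dots> \<le> (S0 + d / 2) ^ (2 * k)"
        unfolding power_mult[symmetric] using nf(3) j by (intro power_mono) auto
      finally have "\<mu> N ((mat_adjoint (X j) * X j) ^\<^sub>m k) \<le> (S0 + d) ^ (2 * k)"
        using \<delta>(4) by linarith
      from trunc[OF N X XM[OF j] this] show ?thesis by blast
    qed
    then have "\<forall>j\<in>J0. \<exists>Y. Y \<in> carrier_mat N N \<and> mat_opnorm N Y \<le> S0 + 2 * d \<and> nrm N (X j - Y) \<le> e" by blast
    from bchoice[OF this] obtain Y where Y: "\<And>j. j \<in> J0 \<Longrightarrow> Y j \<in> carrier_mat N N"
      "\<And>j. j \<in> J0 \<Longrightarrow> mat_opnorm N (Y j) \<le> S0 + 2 * d" "\<And>j. j \<in> J0 \<Longrightarrow> nrm N (X j - Y j) \<le> e"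
      by blast
    \<comment> \<open>the coordinates outside \<open>J0\<close> occur in none of the polynomials, and are set to \<open>0\<close>\<close>
    define l where "l = S0 / (S0 + 2 * d)"
    have l: "0 \<le> l" "l \<le> 1" "l * (S0 + 2 * d) = S0" "(1 - l) * (S0 + 2 * d) = 2 * d"
      using S0 d(1) by (auto simp: l_def field_simps)
    define B where "B j = (if j \<in> J0 then complex_of_real l \<cdot>\<^sub>m Y j
      else if j \<in> J then 0\<^sub>m N N else undefined)" for j
    have Bc: "\<And>j. j \<in> J \<Longrightarrow> B j \<in> carrier_mat N N"
      and BS: "\<And>j. j \<in> J \<Longrightarrow> mat_opnorm N (B j) \<le> S0"
    proof -
      fix j assume j: "j \<in> J"
      show "B j \<in> carrier_mat N N" using Y(1) j by (simp add: B_def)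
      show "mat_opnorm N (B j) \<le> S0"
      proof (cases "j \<in> J0")
        case True
        have "mat_opnorm N (B j) \<le> cmod (complex_of_real l) * mat_opnorm N (Y j)"
          using opnorm_smult_le[OF Y(1)[OF True], of "complex_of_real l"] True by (simp add: B_def)
        also have "\<dots> \<le> l * (S0 + 2 * d)" using Y(2)[OF True] l(1) by (simp add: mult_left_mono)
        finally show ?thesis using l(3) by simp
      next
        case False
        have "mat_opnorm N (0\<^sub>m N N) \<le> mat_opnorm N (complex_of_real 0 \<cdot>\<^sub>m 0\<^sub>m N N)" by simp
        also have "\<dots> \<le> cmod (complex_of_real 0) * mat_opnorm N (0\<^sub>m N N)"
          by (rule opnorm_smult_le[OF zero_carrier_mat])
        finally show ?thesis using False j S0 by (simp add: B_def)
      qed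
    qed
    have Bt: "B \<in> mat_tuples N S J"
    proof -
      have "mat_opnorm N (B j) \<le> S" if "j \<in> J" for j using BS[OF that] SS0[OF that] by simp
      then show ?thesis
        using Bc J0(2) by (auto simp: mat_tuples_def PiE_def extensional_def B_def)
    qed
    have YB: "nrm N (Y j - B j) \<le> 2 * d" if j: "j \<in> J0" for j
    proof -
      have "Y j - B j = complex_of_real (1 - l) \<cdot>\<^sub>m Y j"
        using Y(1)[OF j] j by (intro eq_matI) (auto simp: B_def algebra_simps)
      then have "nrm N (Y j - B j) \<le> cmod (complex_of_real (1 - l)) * nrm N (Y j)"
        using smult[OF Y(1)[OF j]] by simp
      also have "\<dots> = (1 - l) * nrm N (Y j)"
        using l(2) by (simp only: norm_of_real abs_of_nonneg diff_ge_0_iff_ge)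
      also have "\<dots> \<le> (1 - l) * (S0 + 2 * d)"
        using le_opnorm[OF Y(1)[OF j]] Y(2)[OF j] l(2) by (intro mult_left_mono) auto
      finally show ?thesis using l(4) by simp
    qed
    have close: "nrm N (mat_nceval N X P - mat_nceval N B P) \<le> 2 * m" if P: "P \<in> G" for P
    proof -
      have "nrm N (mat_nceval N X P - mat_nceval N Y P) \<le> C2 * e"
      proof (rule lip2[OF P])
        show "\<forall>j\<in>J0. X j \<in> carrier_mat N N \<and> Y j \<in> carrier_mat N N \<and>
            mat_opnorm N (X j) \<le> M \<and> mat_opnorm N (Y j) \<le> M \<and> nrm N (X j - Y j) \<le> e"
        proof
          fix j assume j: "j \<in> J0"
          have "mat_opnorm N (Y j) \<le> M" using Y(2)[OF j] M d by linarith
          then show "X j \<in> carrier_mat N N \<and> Y j \<in> carrier_mat N N \<and>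
            mat_opnorm N (X j) \<le> M \<and> mat_opnorm N (Y j) \<le> M \<and> nrm N (X j - Y j) \<le> e"
            using X XM[OF j] Y[OF j] by blast
        qed
      qed (use e in simp)
      moreover have "nrm N (mat_nceval N Y P - mat_nceval N B P) \<le> C1 * (2 * d)"
      proof (rule lip1[OF P])
        show "\<forall>j\<in>J0. Y j \<in> carrier_mat N N \<and> B j \<in> carrier_mat N N \<and>
            mat_opnorm N (Y j) \<le> S0 + 1 \<and> mat_opnorm N (B j) \<le> S0 + 1 \<and> nrm N (Y j - B j) \<le> 2 * d"
        proof
          fix j assume j: "j \<in> J0"
          then have "j \<in> J" using J0 by blast
          have "mat_opnorm N (Y j) \<le> S0 + 1" "mat_opnorm N (B j) \<le> S0 + 1"
            using Y(2)[OF j] BS[OF \<open>j \<in> J\<close>] d by linarith+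
          then show "Y j \<in> carrier_mat N N \<and> B j \<in> carrier_mat N N \<and>
            mat_opnorm N (Y j) \<le> S0 + 1 \<and> mat_opnorm N (B j) \<le> S0 + 1 \<and> nrm N (Y j - B j) \<le> 2 * d"
            using Y(1)[OF j] Bc[OF \<open>j \<in> J\<close>] YB[OF j] by blast
        qed
      qed (use d in simp)
      moreover have "nrm N (mat_nceval N X P - mat_nceval N B P) \<le>
          nrm N (mat_nceval N X P - mat_nceval N Y P) + nrm N (mat_nceval N Y P - mat_nceval N B P)"
        by (rule triangle_minus) auto
      ultimately show ?thesis using C1d e(2) by linarith
    qed
    have XP: "mat_nceval N X P = mat_nceval N A (sub P)" if "P \<in> G" for P
      unfolding X_def[abs_def] using sub_mat[OF that Ac] by (rule sym)
    have "\<mu> N (mat_nceval N B P) \<le> norm (nceval b P) + \<delta>'" if P: "P \<in> Q'" for P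
    proof -
      have PG: "P \<in> G" using P by (simp add: G_def)
      have "\<mu> N (mat_nceval N B P) \<le> \<mu> N (mat_nceval N X P) + nrm N (mat_nceval N B P - mat_nceval N X P)"
        by (rule size_close) auto
      also have "nrm N (mat_nceval N B P - mat_nceval N X P) = nrm N (mat_nceval N X P - mat_nceval N B P)"
        by (rule minus_commute) auto
      also have "\<dots> \<le> 2 * m" by (rule close[OF PG])
      also have "\<mu> N (mat_nceval N X P) \<le> norm (nceval a (sub P)) + \<delta>"
        unfolding XP[OF PG] using P by (intro AQ) (simp add: Q_def)
      also have "norm (nceval a (sub P)) < norm (nceval b P) + \<delta>' / 4"
        unfolding sub_ev[OF PG] using nf(1) P by blast
      finally show ?thesis using m \<delta>(2) by simp
    qed
    then have "B \<in> size_microstates \<mu> N S J b Q' \<delta>'" using Bt by (simp add: size_microstates_def)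
    moreover have "nrm N (A i - mat_nceval N B (g i)) \<le> 4 * \<eta>" if i: "i \<in> F" for i
    proof -
      have iI: "i \<in> I" using F(2) i by blast
      have gG: "g i \<in> G" using i by (simp add: G_def)
      have Ai: "A i \<in> carrier_mat N N" using Ac iI by blast
      let ?H = "mat_nceval N A (h i)"
      have "?H = mat_nceval N X (g i) + (-1) \<cdot>\<^sub>m A i"
        using XP[OF gG] mat_nceval_const_mult[OF Ac ncpolys_var[OF iI], of "-1"] mat_nceval_var[of A i N] Ai
        by (simp add: h_def mat_nceval_add)
      also have "\<dots> = mat_nceval N X (g i) - A i"
        using Ai by (intro eq_matI) auto
      finally have H: "?H = mat_nceval N X (g i) - A i" .
      have "(nrm N ?H)\<^sup>2 \<le> \<mu> N (mat_adjoint ?H * ?H)"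
        by (rule square_le_size[OF N]) simp
      also have "mat_adjoint ?H * ?H = mat_nceval N A (ncadj (h i) * h i)"
        using mat_nceval_mult[OF Ac ncpolys_adj[OF h[OF i]] h[OF i]] mat_nceval_adj[OF Ac h[OF i]] by simp
      also have "\<mu> N (mat_nceval N A (ncadj (h i) * h i)) \<le> norm (nceval a (ncadj (h i) * h i)) + \<delta>"
        using i by (intro AQ) (simp add: Q_def)
      also have "norm (nceval a (ncadj (h i) * h i)) = (norm (nceval a (h i)))\<^sup>2"
        by (simp add: nceval_mult nceval_adj cstar_identity)
      also have "norm (nceval a (h i)) = norm (nceval (\<lambda>j. nceval a (f j)) (g i) - a i)"
        by (simp add: h_def nceval_add nceval_const_mult scaleC_minus1 sub_ev[OF gG])
      also have "(norm (nceval (\<lambda>j. nceval a (f j)) (g i) - a i))\<^sup>2 \<le> \<eta>\<^sup>2"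
        using nf(2) i by (intro power_mono) (auto intro: less_imp_le)
      finally have "(nrm N ?H)\<^sup>2 \<le> (2 * \<eta>)\<^sup>2" using \<delta>(1,3) unfolding power_mult_distrib by simp
      then have "nrm N ?H \<le> 2 * \<eta>" by (rule power2_le_imp_le) (use \<eta> in simp)
      moreover have "nrm N ?H = nrm N (A i - mat_nceval N X (g i))"
        unfolding H by (rule minus_commute[OF mat_nceval_carrier Ai])
      moreover have "nrm N (A i - mat_nceval N B (g i)) \<le>
          nrm N (A i - mat_nceval N X (g i)) + nrm N (mat_nceval N X (g i) - mat_nceval N B (g i))"
        by (rule triangle_minus[OF Ai]) auto
      ultimately show ?thesis using close[OF gG] m(3) by linarith
    qed
    ultimately show ?thesis by blast
  qed
  moreover have "finite Q" using Q' F J0 by (simp add: Q_def)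
  moreover have "Q \<subseteq> ncpolys I"
    using sub h f by (auto simp: Q_def G_def intro!: ncpolys_mult ncpolys_adj ncpolys_power)
  ultimately show ?thesis using \<delta>(1) by blast
qed

text \<open>An element of a cover for \<open>\<Omega>'\<close> is turned by \<open>g\<close> into a centre for \<open>\<Omega>\<close>, at distance at
  most \<open>4 \<eta> + \<eta> < 12 \<eta> / 2\<close>.\<close>

lemma K_orb_transfer:
  fixes \<Omega> :: "('i \<Rightarrow> complex mat) set" and \<Omega>' :: "('j \<Rightarrow> complex mat) set"
  assumes \<Omega>: "\<Omega> \<subseteq> mat_tuples N R I" and \<Omega>': "\<Omega>' \<subseteq> mat_tuples N S J"
    and F: "F \<subseteq> I" and F': "F' \<subseteq> J" and g: "\<And>i. i \<in> F \<Longrightarrow> g i \<in> ncpolys F'"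
    and lip: "\<And>P \<epsilon> A B. P \<in> g ` F \<Longrightarrow> 0 \<le> \<epsilon> \<Longrightarrow> (\<forall>i\<in>F'. A i \<in> carrier_mat N N \<and> B i \<in> carrier_mat N N \<and>
      mat_opnorm N (A i) \<le> S \<and> mat_opnorm N (B i) \<le> S \<and> nrm N (A i - B i) \<le> \<epsilon>) \<Longrightarrow>
      nrm N (mat_nceval N A P - mat_nceval N B P) \<le> C * \<epsilon>"
    and \<eta>: "0 < \<eta>" and \<epsilon>': "0 < \<epsilon>'" "C * \<epsilon>' \<le> \<eta>"
    and near: "\<And>A. A \<in> \<Omega> \<Longrightarrow> \<exists>B\<in>\<Omega>'. \<forall>i\<in>F. nrm N (A i - mat_nceval N B (g i)) \<le> 4 * \<eta>"
  shows "K_orb nrm N F (12 * \<eta>) \<Omega> \<le> K_orb nrm N F' \<epsilon>' \<Omega>'"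
  unfolding K_orb_def[of nrm N F' \<epsilon>' \<Omega>']
proof (rule INF_greatest, clarify)
  fix T assume T: "finite T" "T \<subseteq> \<Omega>'" and cover: "\<forall>C\<in>\<Omega>'. \<exists>B\<in>T. \<exists>U\<in>unitary_mats N.
    \<forall>i\<in>F'. nrm N (C i - U * B i * mat_adjoint U) < \<epsilon>'"
  have Bc: "\<forall>j\<in>F'. B j \<in> carrier_mat N N" "\<forall>j\<in>F'. mat_opnorm N (B j) \<le> S" if "B \<in> \<Omega>'" for B
    using that \<Omega>' F' mat_tuplesD[of B N S J] by blast+
  show "K_orb nrm N F (12 * \<eta>) \<Omega> \<le> enat (card T)"
  proof (rule K_orb_le_external[where c = "\<lambda>B i. mat_nceval N B (g i)", OF T(1)])
    fix A assume A: "A \<in> \<Omega>"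
    then obtain B where B: "B \<in> \<Omega>'" "\<forall>i\<in>F. nrm N (A i - mat_nceval N B (g i)) \<le> 4 * \<eta>"
      using near by blast
    then obtain D U where D: "D \<in> T" and U: "U \<in> unitary_mats N"
      and BD: "\<forall>i\<in>F'. nrm N (B i - U * D i * mat_adjoint U) < \<epsilon>'"
      using cover by blast
    have D': "D \<in> \<Omega>'" using D T by blast
    note u = unitary_matsD[OF U]
    have "nrm N (A i - U * mat_nceval N D (g i) * mat_adjoint U) < 12 * \<eta> / 2" if i: "i \<in> F" for i
    proof -
      let ?E = "\<lambda>j. U * D j * mat_adjoint U"
      have "nrm N (mat_nceval N B (g i) - mat_nceval N ?E (g i)) \<le> C * \<epsilon>'"
      proof (rule lip)
        show "\<forall>j\<in>F'. B j \<in> carrier_mat N N \<and> ?E j \<in> carrier_mat N N \<and>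
          mat_opnorm N (B j) \<le> S \<and> mat_opnorm N (?E j) \<le> S \<and> nrm N (B j - ?E j) \<le> \<epsilon>'"
        proof
          fix j assume j: "j \<in> F'"
          have Dj: "D j \<in> carrier_mat N N" "mat_opnorm N (D j) \<le> S" using Bc[OF D'] j by auto
          have UD: "U * D j \<in> carrier_mat N N" using u Dj by auto
          have "mat_opnorm N (?E j) \<le> mat_opnorm N (U * D j) * mat_opnorm N (mat_adjoint U)"
            by (rule opnorm_mult[OF UD u(2)])
          also have "\<dots> \<le> mat_opnorm N (U * D j)"
            using unitary_opnorm_le[OF unitary_mats_adjoint[OF U]] opnorm_nonneg[OF UD]
            by (simp add: mult_left_le)
          also have "\<dots> \<le> mat_opnorm N U * mat_opnorm N (D j)" by (rule opnorm_mult[OF u(1) Dj(1)])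
          also have "\<dots> \<le> mat_opnorm N (D j)"
            using unitary_opnorm_le[OF U] opnorm_nonneg[OF Dj(1)] opnorm_nonneg[OF u(1)]
            by (simp add: mult_left_le_one_le)
          finally have "mat_opnorm N (?E j) \<le> S" using Dj(2) by linarith
          then show "B j \<in> carrier_mat N N \<and> ?E j \<in> carrier_mat N N \<and>
            mat_opnorm N (B j) \<le> S \<and> mat_opnorm N (?E j) \<le> S \<and> nrm N (B j - ?E j) \<le> \<epsilon>'"
            using Bc[OF B(1)] BD j conjugate_carrier[OF u(1) Dj(1)] by (auto intro: less_imp_le)
        qed
      qed (use i \<epsilon>' in auto)
      also have "mat_nceval N ?E (g i) = U * mat_nceval N D (g i) * mat_adjoint U"
        by (rule mat_nceval_conjugate[OF U Bc(1)[OF D'] g[OF i]])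
      finally have "nrm N (mat_nceval N B (g i) - U * mat_nceval N D (g i) * mat_adjoint U) \<le> \<eta>"
        using \<epsilon>'(2) by simp
      moreover have "A i \<in> carrier_mat N N" using mat_tuplesD[of A N R I] A \<Omega> i F by blast
      then have "nrm N (A i - U * mat_nceval N D (g i) * mat_adjoint U) \<le>
          nrm N (A i - mat_nceval N B (g i)) +
          nrm N (mat_nceval N B (g i) - U * mat_nceval N D (g i) * mat_adjoint U)"
        by (rule triangle_minus[OF _ mat_nceval_carrier conjugate_carrier[OF u(1) mat_nceval_carrier]])
      ultimately show ?thesis using B(2) i \<eta> by fastforce
    qed
    then show "\<exists>t\<in>T. \<exists>U\<in>unitary_mats N. \<forall>i\<in>F.
      nrm N (A i - U * mat_nceval N t (g i) * mat_adjoint U) < 12 * \<eta> / 2"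
      using D U by blast
  next
    fix A i assume "A \<in> \<Omega>" "i \<in> F"
    then show "A i \<in> carrier_mat N N" using mat_tuplesD[of A N R I] \<Omega> F by blast
  qed simp
qed

text \<open>The polynomials \<open>g\<^sub>i\<close> and the radius \<open>\<epsilon>'\<close> depend on \<open>F\<close> and \<open>\<epsilon>\<close> only, as the nesting of
  supremum and infimum in the entropy demands; the approximants of \<open>b\<close> depend on \<open>Q'\<close> and \<open>\<delta>'\<close>.\<close>

lemma size_entropy_le:
  fixes a :: "'i \<Rightarrow> 'a::cstar_algebra" and b :: "'j \<Rightarrow> 'a"
  assumes a: "generating I a" and b: "generating J b" "R_bounded S J b"
  shows "size_entropy nrm \<mu> R I a \<le> size_entropy nrm \<mu> S J b"
  unfolding size_entropy_def[of nrm \<mu> R I a]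
proof (rule SUP_least, clarify)
  fix F and \<epsilon> :: real assume F: "finite F" "F \<subseteq> I" and \<epsilon>: "0 < \<epsilon>"
  define \<eta> where "\<eta> = \<epsilon> / 12"
  have \<eta>: "0 < \<eta>" and \<epsilon>\<eta>: "\<epsilon> = 12 * \<eta>" using \<epsilon> by (auto simp: \<eta>_def)
  have "\<exists>P. P \<in> ncpolys J \<and> norm (nceval b P - a i) < \<eta>" for i
  proof -
    obtain p where p: "\<And>n. p n \<in> ncpolys J" "(\<lambda>n. nceval b (p n)) \<longlonglongrightarrow> a i"
      using approximating_polys[OF b(1)] by blast
    from LIMSEQ_D[OF p(2) \<eta>] obtain n where "norm (nceval b (p n) - a i) < \<eta>" by blast
    then show ?thesis using p(1) by blast
  qed
  then obtain g where gJ: "\<And>i. g i \<in> ncpolys J" and g: "\<And>i. norm (nceval b (g i) - a i) < \<eta>" by metis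
  obtain F' where F': "finite F'" "F' \<subseteq> J" "g ` F \<subseteq> ncpolys F'"
    using ncpolys_finite_support_finite[of "g ` F" J] F gJ by blast
  have gF': "\<forall>i\<in>F. g i \<in> ncpolys F'" using F'(3) by blast
  obtain C where C: "0 < C"
    and lip: "\<And>P N \<eta> A B. P \<in> g ` F \<Longrightarrow> 0 \<le> \<eta> \<Longrightarrow> (\<forall>i\<in>F'. A i \<in> carrier_mat N N \<and> B i \<in> carrier_mat N N \<and>
      mat_opnorm N (A i) \<le> S \<and> mat_opnorm N (B i) \<le> S \<and> nrm N (A i - B i) \<le> \<eta>) \<Longrightarrow>
    nrm N (mat_nceval N A P - mat_nceval N B P) \<le> C * \<eta>"
    using nceval_lipschitz_finite[OF finite_imageI[OF F(1)] F'(3)] by metis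
  define \<epsilon>' where "\<epsilon>' = \<eta> / C"
  have \<epsilon>': "0 < \<epsilon>'" "C * \<epsilon>' \<le> \<eta>" using \<eta> C by (auto simp: \<epsilon>'_def)
  let ?f = "\<lambda>\<delta> Q. limsup (\<lambda>N. ereal (1 / (real N)\<^sup>2) *
          log_enat (K_orb nrm N F \<epsilon> (size_microstates \<mu> N R I a Q \<delta>)))"
  let ?g = "\<lambda>F \<epsilon> \<delta> Q. limsup (\<lambda>N. ereal (1 / (real N)\<^sup>2) *
          log_enat (K_orb nrm N F \<epsilon> (size_microstates \<mu> N S J b Q \<delta>)))"
  have "(INF (\<delta>, Q)\<in>{(\<delta>, Q). 0 < \<delta> \<and> finite Q \<and> Q \<subseteq> ncpolys I}. ?f \<delta> Q) \<le>
      (INF (\<delta>, Q)\<in>{(\<delta>, Q). 0 < \<delta> \<and> finite Q \<and> Q \<subseteq> ncpolys J}. ?g F' \<epsilon>' \<delta> Q)"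
  proof (rule INF_greatest, clarify)
    fix \<delta>' :: real and Q' assume Q': "0 < \<delta>'" "finite Q'" "Q' \<subseteq> ncpolys J"
    obtain Q \<delta> where Q: "finite Q" "Q \<subseteq> ncpolys I" "0 < \<delta>"
      and near: "\<And>N A. 0 < N \<Longrightarrow> A \<in> size_microstates \<mu> N R I a Q \<delta> \<Longrightarrow>
      \<exists>B\<in>size_microstates \<mu> N S J b Q' \<delta>'. \<forall>i\<in>F. nrm N (A i - mat_nceval N B (g i)) \<le> 4 * \<eta>"
      using microstates_transfer[where R = R, OF a b(2) F F'(2,1) gF' ballI[OF g] \<eta> Q'(2,3,1)]
      by blast
    have "K_orb nrm N F \<epsilon> (size_microstates \<mu> N R I a Q \<delta>) \<le>
        K_orb nrm N F' \<epsilon>' (size_microstates \<mu> N S J b Q' \<delta>')" if "0 < N" for N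
      unfolding \<epsilon>\<eta>
    proof (rule K_orb_transfer[where R = R and I = I and S = S and J = J and g = g and C = C])
      show "size_microstates \<mu> N R I a Q \<delta> \<subseteq> mat_tuples N R I"
        "size_microstates \<mu> N S J b Q' \<delta>' \<subseteq> mat_tuples N S J"
        by (auto simp: size_microstates_def)
    qed (use F F' gF' lip \<eta> \<epsilon>' near[OF that] in auto)
    then have le: "log_enat (K_orb nrm N F \<epsilon> (size_microstates \<mu> N R I a Q \<delta>)) \<le>
        log_enat (K_orb nrm N F' \<epsilon>' (size_microstates \<mu> N S J b Q' \<delta>'))" if "0 < N" for N
      using that log_enat_mono by blast
    have "?f \<delta> Q \<le> ?g F' \<epsilon>' \<delta>' Q'"
      by (intro Limsup_mono eventually_sequentiallyI[of 1] ereal_mult_left_mono le) auto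
    moreover have "(INF (\<delta>, Q)\<in>{(\<delta>, Q). 0 < \<delta> \<and> finite Q \<and> Q \<subseteq> ncpolys I}. ?f \<delta> Q) \<le> ?f \<delta> Q"
      by (rule INF_lower2[of "(\<delta>, Q)"]) (use Q in auto)
    ultimately show "(INF (\<delta>, Q)\<in>{(\<delta>, Q). 0 < \<delta> \<and> finite Q \<and> Q \<subseteq> ncpolys I}. ?f \<delta> Q) \<le> ?g F' \<epsilon>' \<delta>' Q'"
      by (rule order_trans[rotated])
  qed
  also have "\<dots> \<le> size_entropy nrm \<mu> S J b"
    unfolding size_entropy_def by (rule SUP_upper2[of "(F', \<epsilon>')"]) (use F' \<epsilon>' in auto)
  finally show "(INF (\<delta>, Q)\<in>{(\<delta>, Q). 0 < \<delta> \<and> finite Q \<and> Q \<subseteq> ncpolys I}. ?f \<delta> Q) \<le>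
      size_entropy nrm \<mu> S J b" .
qed

lemma size_entropy_independent:
  fixes a :: "'i \<Rightarrow> 'a::cstar_algebra" and b :: "'j \<Rightarrow> 'a"
  assumes "generating I a" "R_bounded R I a" "generating J b" "R_bounded S J b"
  shows "size_entropy nrm \<mu> R I a = size_entropy nrm \<mu> S J b"
  using assms by (intro antisym size_entropy_le)

end

section \<open>The operator norm and the normalised trace\<close>

text \<open>In operator norm no singular value can be too large: by the C*-identity the moment with
  exponent \<open>1\<close> bounds the norm, and nothing has to be cut off.\<close>

interpretation opnorm: entropy_pair mat_opnorm mat_opnorm
proof
  fix A B :: "complex mat" and N c
  assume A: "A \<in> carrier_mat N N"
  show "mat_opnorm N (c \<cdot>\<^sub>m A) \<le> cmod c * mat_opnorm N A" by (rule opnorm_smult_le[OF A])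
  show "0 \<le> mat_opnorm N A" by (rule opnorm_nonneg[OF A])
  show "mat_opnorm N (mat_adjoint A) = mat_opnorm N A" by (rule opnorm_adjoint[OF A])
  show "mat_opnorm N A \<le> mat_opnorm N A" ..
  show "(mat_opnorm N A)\<^sup>2 \<le> mat_opnorm N (mat_adjoint A * A)" by (rule opnorm_cstar_le[OF A])
  assume B: "B \<in> carrier_mat N N"
  show "mat_opnorm N (A + B) \<le> mat_opnorm N A + mat_opnorm N B" by (rule opnorm_triangle[OF A B])
  show "mat_opnorm N (A * B) \<le> mat_opnorm N A * mat_opnorm N B" by (rule opnorm_mult[OF A B])
  have "A = B + (A - B)" using A B by (intro eq_matI) auto
  then show "mat_opnorm N A \<le> mat_opnorm N B + mat_opnorm N (A - B)"
    using opnorm_triangle[OF B minus_carrier_mat[OF B, of A]] by simp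
next
  fix s t e M :: real
  assume s: "0 \<le> s" and t: "s < t" and e: "0 < e"
  have "\<exists>Y\<in>carrier_mat N N. mat_opnorm N Y \<le> t \<and> mat_opnorm N (X - Y) \<le> e"
    if X: "X \<in> carrier_mat N N" and le: "mat_opnorm N ((mat_adjoint X * X) ^\<^sub>m 1) \<le> s ^ (2 * 1)" for N X
  proof -
    have "(mat_adjoint X * X) ^\<^sub>m 1 = mat_adjoint X * X" using X by auto
    then have "(mat_opnorm N X)\<^sup>2 \<le> s\<^sup>2" using opnorm_cstar_le[OF X] le by simp
    then have "mat_opnorm N X \<le> s" by (rule power2_le_imp_le) (rule s)
    moreover have "mat_opnorm N (X - X) \<le> 0" by (rule opnorm_minus_self[OF X])
    ultimately show ?thesis using X t e by (intro bexI[of _ X]) auto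
  qed
  then show "\<exists>k>0. \<forall>N>0. \<forall>X\<in>carrier_mat N N. mat_opnorm N X \<le> M \<longrightarrow>
      mat_opnorm N ((mat_adjoint X * X) ^\<^sub>m k) \<le> s ^ (2 * k) \<longrightarrow>
      (\<exists>Y\<in>carrier_mat N N. mat_opnorm N Y \<le> t \<and> mat_opnorm N (X - Y) \<le> e)"
    by (intro exI[of _ 1]) blast
qed

lemma mat_norm2_ideal_norm: "ideal_norm mat_norm2"
proof
  fix A B :: "complex mat" and N c
  assume A: "A \<in> carrier_mat N N"
  show "0 \<le> mat_norm2 N A" by (simp add: mat_norm2_eq_fro[OF A])
  show "mat_norm2 N (c \<cdot>\<^sub>m A) \<le> cmod c * mat_norm2 N A"
    by (simp add: mat_norm2_eq_fro[OF A] mat_norm2_eq_fro[OF smult_carrier_mat[OF A]] fro_norm_smult)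
  show "mat_norm2 N (mat_adjoint A) = mat_norm2 N A"
    by (simp add: mat_norm2_eq_fro[OF A] mat_norm2_eq_fro[OF mat_adjoint_carrier[OF A]])
  show "mat_norm2 N A \<le> mat_opnorm N A" by (rule mat_norm2_le_opnorm[OF A])
  assume B: "B \<in> carrier_mat N N"
  show "mat_norm2 N (A + B) \<le> mat_norm2 N A + mat_norm2 N B"
    using divide_right_mono[OF fro_norm_triangle[OF A B], of "sqrt (real N)"]
    by (simp add: mat_norm2_eq_fro[OF A] mat_norm2_eq_fro[OF B]
        mat_norm2_eq_fro[OF add_carrier_mat[OF B]] add_divide_distrib)
  show "mat_norm2 N (A * B) \<le> mat_opnorm N A * mat_norm2 N B"
    using divide_right_mono[OF fro_norm_mult_left[OF A B], of "sqrt (real N)"]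
    by (simp add: mat_norm2_eq_fro[OF B] mat_norm2_eq_fro[OF mult_carrier_mat[OF A B]])
  show "mat_norm2 N (A * B) \<le> mat_norm2 N A * mat_opnorm N B"
    using divide_right_mono[OF fro_norm_mult_right[OF A B], of "sqrt (real N)"]
    by (simp add: mat_norm2_eq_fro[OF A] mat_norm2_eq_fro[OF mult_carrier_mat[OF A B]])
qed

text \<open>For the trace, the error \<open>M (s/t)\<^sup>n\<close> of the cut-off tends to \<open>0\<close> along the exponents
  \<open>n = 2\<^sup>p\<^sup>+\<^sup>1\<close>.\<close>

interpretation norm2: entropy_pair mat_norm2 abs_ntr
proof (intro entropy_pair.intro mat_norm2_ideal_norm entropy_pair_axioms.intro)
  fix X Y :: "complex mat" and N
  assume X: "X \<in> carrier_mat N N"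
  show "(mat_norm2 N X)\<^sup>2 \<le> abs_ntr N (mat_adjoint X * X)"
  proof -
    have "0 \<le> Re (mat_tr N (mat_adjoint X * X))" "Im (mat_tr N (mat_adjoint X * X)) = 0"
      using mat_tr_square_nonneg[OF X] by (auto simp: less_eq_complex_def)
    then show ?thesis by (simp add: mat_norm2_def abs_ntr_def norm_divide cmod_eq_Re)
  qed
  assume Y: "Y \<in> carrier_mat N N"
  have "X = Y + (X - Y)" using X Y by (intro eq_matI) auto
  then have "mat_tr N X / of_nat N = mat_tr N Y / of_nat N + mat_tr N (X - Y) / of_nat N"
    using mat_tr_add[OF Y minus_carrier_mat[OF Y, of X]] by (metis add_divide_distrib)
  then have "abs_ntr N X \<le> abs_ntr N Y + abs_ntr N (X - Y)"
    unfolding abs_ntr_def by (metis norm_triangle_ineq)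
  then show "abs_ntr N X \<le> abs_ntr N Y + mat_norm2 N (X - Y)"
    using abs_ntr_le_norm2[OF minus_carrier_mat[OF Y, of X]] by linarith
next
  fix s t e M :: real
  assume s: "0 \<le> s" and t: "s < t" and e: "0 < e"
  have st: "0 \<le> s / t" "s / t < 1" using s t by auto
  have "(\<lambda>p. max M 0 * (s / t) ^ p) \<longlonglongrightarrow> max M 0 * 0"
    by (intro tendsto_mult tendsto_const LIMSEQ_realpow_zero st)
  then have "\<forall>\<^sub>F p in sequentially. max M 0 * (s / t) ^ p < e"
    by (rule order_tendstoD(2)) (use e in simp)
  then obtain p where p: "max M 0 * (s / t) ^ p < e"
    using eventually_happens'[OF sequentially_bot] by blast
  have "Suc p < 2 ^ Suc p" by (rule less_exp)
  then have "p \<le> 2 ^ Suc p" by linarith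
  then have "max M 0 * (s / t) ^ (2 ^ Suc p) \<le> max M 0 * (s / t) ^ p"
    using st by (intro mult_left_mono power_decreasing) (auto simp del: power_Suc)
  then have small: "max M 0 * (s / t) ^ (2 ^ Suc p) \<le> e" using p by linarith
  show "\<exists>k>0. \<forall>N>0. \<forall>X\<in>carrier_mat N N. mat_opnorm N X \<le> M \<longrightarrow>
      abs_ntr N ((mat_adjoint X * X) ^\<^sub>m k) \<le> s ^ (2 * k) \<longrightarrow>
      (\<exists>Y\<in>carrier_mat N N. mat_opnorm N Y \<le> t \<and> mat_norm2 N (X - Y) \<le> e)"
  proof (intro exI[of _ "2 ^ Suc p"] conjI allI impI ballI)
    fix N :: nat and X :: "complex mat"
    assume "0 < N" "X \<in> carrier_mat N N" "mat_opnorm N X \<le> M"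
      and mom: "abs_ntr N ((mat_adjoint X * X) ^\<^sub>m (2 ^ Suc p)) \<le> s ^ (2 * 2 ^ Suc p)"
    then obtain Y where "Y \<in> carrier_mat N N" "mat_opnorm N Y \<le> t"
      "mat_norm2 N (X - Y) \<le> max M 0 * (s / t) ^ (2 ^ Suc p)"
      using moment_truncation[of X N "max M 0" s t p] s t by (metis max.coboundedI1)
    then show "\<exists>Y\<in>carrier_mat N N. mat_opnorm N Y \<le> t \<and> mat_norm2 N (X - Y) \<le> e"
      using small by (intro bexI[of _ Y]) auto
  qed simp
qed

section \<open>The entropy of the set of trace laws\<close>

lemma law_microstates_subset:
  fixes a :: "'i \<Rightarrow> 'a::cstar_algebra"
  assumes "Q \<subseteq> ncpolys I"
  shows "microstates N R I {l \<in> law_space R I. \<forall>P\<in>Q. cmod (l P) < norm (nceval a P) + \<delta>} \<subseteq>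
    size_microstates abs_ntr N R I a Q \<delta>"
proof
  fix A assume A: "A \<in> microstates N R I {l \<in> law_space R I. \<forall>P\<in>Q. cmod (l P) < norm (nceval a P) + \<delta>}"
  have "abs_ntr N (mat_nceval N A P) \<le> norm (nceval a P) + \<delta>" if P: "P \<in> Q" for P
  proof -
    have "mat_law N I A P = mat_tr N (mat_nceval N A P) / of_nat N"
      using P assms by (auto simp: mat_law_def)
    then show ?thesis using A P by (auto simp: microstates_def abs_ntr_def)
  qed
  then show "A \<in> size_microstates abs_ntr N R I a Q \<delta>"
    using A by (simp add: microstates_def size_microstates_def)
qed

lemma size_microstates_subset:
  fixes a :: "'i \<Rightarrow> 'a::cstar_algebra"
  assumes gen: "generating I a" and \<O>: "openin (law_topology R I) \<O>" "trace_laws I a \<subseteq> \<O>"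
  shows "\<exists>Q \<delta>. finite Q \<and> Q \<subseteq> ncpolys I \<and> 0 < \<delta> \<and>
    (\<forall>N>0. size_microstates abs_ntr N R I a Q \<delta> \<subseteq> microstates N R I \<O>)"
proof -
  have "\<forall>P\<in>ncpolys I. \<exists>C\<ge>0. \<forall>N A. (\<forall>i\<in>I. A i \<in> carrier_mat N N \<and> mat_opnorm N (A i) \<le> R) \<longrightarrow>
      mat_opnorm N (mat_nceval N A P) \<le> C"
    using nceval_opnorm_bound by blast
  from bchoice[OF this] obtain c where c: "\<forall>P\<in>ncpolys I. 0 \<le> c P \<and>
      (\<forall>N A. (\<forall>i\<in>I. A i \<in> carrier_mat N N \<and> mat_opnorm N (A i) \<le> R) \<longrightarrow>
      mat_opnorm N (mat_nceval N A P) \<le> c P)" ..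
  obtain \<delta> Q where Q: "0 < \<delta>" "finite Q" "Q \<subseteq> ncpolys I"
    and sub: "\<And>l. l \<in> law_space R I \<Longrightarrow> (\<forall>P\<in>ncpolys I. cmod (l P) \<le> c P) \<Longrightarrow>
       (\<forall>P\<in>Q. cmod (l P) \<le> norm (nceval a P) + \<delta>) \<Longrightarrow> l \<in> \<O>"
    using trace_laws_neighbourhood[OF gen \<O>, of c] by blast
  have "A \<in> microstates N R I \<O>" if N: "0 < N" and A: "A \<in> size_microstates abs_ntr N R I a Q \<delta>" for N A
  proof -
    have At: "A \<in> mat_tuples N R I" and AQ: "\<forall>P\<in>Q. abs_ntr N (mat_nceval N A P) \<le> norm (nceval a P) + \<delta>"
      using A by (auto simp: size_microstates_def)
    have "cmod (mat_law N I A P) \<le> c P" if P: "P \<in> ncpolys I" for P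
    proof -
      have "cmod (mat_law N I A P) = abs_ntr N (mat_nceval N A P)"
        using P by (simp add: mat_law_def abs_ntr_def)
      also have "\<dots> \<le> mat_opnorm N (mat_nceval N A P)"
        using abs_ntr_le_norm2[OF mat_nceval_carrier[of N A P]]
          mat_norm2_le_opnorm[OF mat_nceval_carrier[of N A P]] by linarith
      also have "\<dots> \<le> c P" using c P mat_tuplesD[OF At] by blast
      finally show ?thesis .
    qed
    moreover have "cmod (mat_law N I A P) \<le> norm (nceval a P) + \<delta>" if P: "P \<in> Q" for P
    proof -
      have "P \<in> ncpolys I" using P Q(3) by blast
      then have "cmod (mat_law N I A P) = abs_ntr N (mat_nceval N A P)"
        by (simp add: mat_law_def abs_ntr_def)
      then show ?thesis using AQ P by simp
    qed
    ultimately have "mat_law N I A \<in> \<O>"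
      using sub[OF mat_law_in_law_space[OF At N]] by blast
    then show ?thesis using At by (simp add: microstates_def)
  qed
  then show ?thesis using Q by blast
qed

context ideal_norm
begin

text \<open>Halving the radius absorbs the failure of monotonicity that comes from requiring centres
  in the covered set.\<close>

lemma K_orb_mono_half:
  assumes \<Omega>: "\<Omega> \<subseteq> mat_tuples N R I" and sub: "\<Omega>' \<subseteq> \<Omega>" and F: "F \<subseteq> I"
  shows "K_orb nrm N F \<epsilon> \<Omega>' \<le> K_orb nrm N F (\<epsilon> / 2) \<Omega>"
  unfolding K_orb_def[of nrm N F "\<epsilon> / 2" \<Omega>]
proof (rule INF_greatest, clarify)
  fix T assume T: "finite T" "T \<subseteq> \<Omega>" and cover: "\<forall>C\<in>\<Omega>. \<exists>B\<in>T. \<exists>U\<in>unitary_mats N.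
    \<forall>i\<in>F. nrm N (C i - U * B i * mat_adjoint U) < \<epsilon> / 2"
  have c: "C i \<in> carrier_mat N N" if "C \<in> \<Omega>" "i \<in> F" for C i
    using that mat_tuplesD[of C N R I] \<Omega> F by blast
  show "K_orb nrm N F \<epsilon> \<Omega>' \<le> enat (card T)"
    by (rule K_orb_le_external[OF T(1), where c = "\<lambda>B. B"]) (use c T sub cover in blast)+
qed

lemma entropy_mono_inclusion:
  fixes \<Omega> :: "'x \<Rightarrow> nat \<Rightarrow> ('i \<Rightarrow> complex mat) set" and \<Omega>' :: "'y \<Rightarrow> nat \<Rightarrow> ('i \<Rightarrow> complex mat) set"
  assumes incl: "\<And>y. y \<in> Y \<Longrightarrow> \<exists>x\<in>X. \<forall>N>0. \<Omega> x N \<subseteq> \<Omega>' y N"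
    and tuples: "\<And>y N. \<Omega>' y N \<subseteq> mat_tuples N R I"
  shows "(SUP (F, \<epsilon>)\<in>{(F, \<epsilon>). finite F \<and> F \<subseteq> I \<and> 0 < \<epsilon>}. INF x\<in>X.
      limsup (\<lambda>N. ereal (1 / (real N)\<^sup>2) * log_enat (K_orb nrm N F \<epsilon> (\<Omega> x N)))) \<le>
    (SUP (F, \<epsilon>)\<in>{(F, \<epsilon>). finite F \<and> F \<subseteq> I \<and> 0 < \<epsilon>}. INF y\<in>Y.
      limsup (\<lambda>N. ereal (1 / (real N)\<^sup>2) * log_enat (K_orb nrm N F \<epsilon> (\<Omega>' y N))))"
proof (rule SUP_least, clarify)
  fix F and \<epsilon> :: real assume F: "finite F" "F \<subseteq> I" and \<epsilon>: "0 < \<epsilon>"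
  let ?f = "\<lambda>x. limsup (\<lambda>N. ereal (1 / (real N)\<^sup>2) * log_enat (K_orb nrm N F \<epsilon> (\<Omega> x N)))"
  let ?g = "\<lambda>F \<epsilon> y. limsup (\<lambda>N. ereal (1 / (real N)\<^sup>2) * log_enat (K_orb nrm N F \<epsilon> (\<Omega>' y N)))"
  have "(INF x\<in>X. ?f x) \<le> (INF y\<in>Y. ?g F (\<epsilon> / 2) y)"
  proof (rule INF_greatest)
    fix y assume "y \<in> Y"
    then obtain x where x: "x \<in> X" "\<And>N. 0 < N \<Longrightarrow> \<Omega> x N \<subseteq> \<Omega>' y N" using incl by blast
    have "?f x \<le> ?g F (\<epsilon> / 2) y"
      by (intro Limsup_mono eventually_sequentiallyI[of 1] ereal_mult_left_mono log_enat_mono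
          K_orb_mono_half[OF tuples _ F(2)] x) auto
    then show "(INF x\<in>X. ?f x) \<le> ?g F (\<epsilon> / 2) y" using x(1) by (rule INF_lower2[rotated])
  qed
  also have "\<dots> \<le> (SUP (F, \<epsilon>)\<in>{(F, \<epsilon>). finite F \<and> F \<subseteq> I \<and> 0 < \<epsilon>}. INF y\<in>Y. ?g F \<epsilon> y)"
    by (rule SUP_upper2[of "(F, \<epsilon> / 2)"]) (use F \<epsilon> in auto)
  finally show "(INF x\<in>X. ?f x) \<le>
      (SUP (F, \<epsilon>)\<in>{(F, \<epsilon>). finite F \<and> F \<subseteq> I \<and> 0 < \<epsilon>}. INF y\<in>Y. ?g F \<epsilon> y)" .
qed

end

text \<open>The sets given by finitely many inequalities \<open>|\<ell>(P)| < \<parallel>P(a)\<parallel> + \<delta>\<close> are open neighbourhoods of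
  the trace laws, and every neighbourhood contains one of them as far as matrix laws are
  concerned.\<close>

lemma h_laws_eq_size_entropy:
  fixes a :: "'i \<Rightarrow> 'a::cstar_algebra"
  assumes gen: "generating I a" and R: "R_bounded R I a"
  shows "h_laws R I (trace_laws I a) = size_entropy mat_norm2 abs_ntr R I a"
proof (rule antisym)
  let ?X = "{(\<delta> :: real, Q). 0 < \<delta> \<and> finite Q \<and> Q \<subseteq> ncpolys I}"
  let ?Y = "{\<O>. openin (law_topology R I) \<O> \<and> trace_laws I a \<subseteq> \<O>}"
  have gen_eq: "size_entropy mat_norm2 abs_ntr R I a =
    (SUP (F, \<epsilon>)\<in>{(F, \<epsilon>). finite F \<and> F \<subseteq> I \<and> 0 < \<epsilon>}. INF x\<in>?X.
      limsup (\<lambda>N. ereal (1 / (real N)\<^sup>2) * log_enat (K_orb mat_norm2 N F \<epsilon>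
        (size_microstates abs_ntr N R I a (snd x) (fst x)))))"
    unfolding size_entropy_def by (simp only: case_prod_unfold)
  have "\<exists>\<O>\<in>?Y. \<forall>N>0. microstates N R I \<O> \<subseteq> size_microstates abs_ntr N R I a (snd x) (fst x)"
    if x: "x \<in> ?X" for x
  proof -
    obtain \<delta> Q where x': "x = (\<delta>, Q)" "0 < \<delta>" "finite Q" "Q \<subseteq> ncpolys I" using x by auto
    let ?O = "{l \<in> law_space R I. \<forall>P\<in>Q. cmod (l P) < norm (nceval a P) + \<delta>}"
    have "?O \<in> ?Y" using openin_law_bounds[OF x'(3,4)] trace_laws_in_bounds[OF R x'(4,2)] by blast
    moreover have "microstates N R I ?O \<subseteq> size_microstates abs_ntr N R I a Q \<delta>" for N
      by (rule law_microstates_subset[OF x'(4)])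
    ultimately show ?thesis using x'(1) by (intro bexI[of _ ?O]) auto
  qed
  then show "h_laws R I (trace_laws I a) \<le> size_entropy mat_norm2 abs_ntr R I a"
    unfolding h_laws_def gen_eq
    by (intro norm2.entropy_mono_inclusion) (auto simp: size_microstates_def)
  have "\<exists>x\<in>?X. \<forall>N>0. size_microstates abs_ntr N R I a (snd x) (fst x) \<subseteq> microstates N R I \<O>"
    if \<O>: "\<O> \<in> ?Y" for \<O>
  proof -
    have \<O>': "openin (law_topology R I) \<O>" "trace_laws I a \<subseteq> \<O>" using \<O> by auto
    obtain Q \<delta> where "finite Q" "Q \<subseteq> ncpolys I" "0 < \<delta>"
      "\<And>N. 0 < N \<Longrightarrow> size_microstates abs_ntr N R I a Q \<delta> \<subseteq> microstates N R I \<O>"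
      using size_microstates_subset[OF gen \<O>'] by blast
    then show ?thesis by (intro bexI[of _ "(\<delta>, Q)"]) auto
  qed
  then show "size_entropy mat_norm2 abs_ntr R I a \<le> h_laws R I (trace_laws I a)"
    unfolding h_laws_def gen_eq
    by (intro norm2.entropy_mono_inclusion) (auto simp: microstates_def)
qed

lemma h_top_eq_size_entropy: "h_top R I a = size_entropy mat_opnorm mat_opnorm R I a"
proof -
  let ?f = "\<lambda>F \<epsilon>. INF (\<delta>, Q)\<in>{(\<delta>, Q). 0 < \<delta> \<and> finite Q \<and> Q \<subseteq> ncpolys I}.
        limsup (\<lambda>N. ereal (1 / (real N)\<^sup>2) *
          log_enat (K_orb mat_opnorm N F \<epsilon> (top_microstates N R I a Q \<delta>)))"
  have "(SUP (\<epsilon> :: real, F)\<in>{(\<epsilon>, F). 0 < \<epsilon> \<and> finite F \<and> F \<subseteq> I}. ?f F \<epsilon>) =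
      (SUP (F, \<epsilon> :: real)\<in>{(F, \<epsilon>). finite F \<and> F \<subseteq> I \<and> 0 < \<epsilon>}. ?f F \<epsilon>)"
  proof (rule antisym; rule SUP_least; clarify)
    fix F and \<epsilon> :: real assume F: "finite F" "F \<subseteq> I" and \<epsilon>: "0 < \<epsilon>"
    show "?f F \<epsilon> \<le> (SUP (F, \<epsilon> :: real)\<in>{(F, \<epsilon>). finite F \<and> F \<subseteq> I \<and> 0 < \<epsilon>}. ?f F \<epsilon>)"
      by (rule SUP_upper2[of "(F, \<epsilon>)"]) (use F \<epsilon> in auto)
    show "?f F \<epsilon> \<le> (SUP (\<epsilon> :: real, F)\<in>{(\<epsilon>, F). 0 < \<epsilon> \<and> finite F \<and> F \<subseteq> I}. ?f F \<epsilon>)"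
      by (rule SUP_upper2[of "(\<epsilon>, F)"]) (use F \<epsilon> in auto)
  qed
  then show ?thesis
    unfolding h_top_def size_entropy_def top_microstates_def size_microstates_def .
qed

lemma mat_diff_diff_eq:
  fixes X Y Z :: "complex mat"
  assumes "X \<in> carrier_mat m n" "Y \<in> carrier_mat m n" "Z \<in> carrier_mat m n"
  shows "X - Y - Z = X - (Y + Z)"
  using assms by (intro eq_matI) auto

section \<open>From the normalised Hilbert-Schmidt norm to the operator norm\<close>

text \<open>If \<open>C\<close> is close to a conjugate of \<open>B\<close> in the normalised Hilbert-Schmidt norm, then the
  difference is close in operator norm to a matrix of rank at most \<open>k\<close>, because its squared
  Frobenius norm is at most \<open>\<epsilon>\<^sup>2 N\<close>.
  Matrices of such rank have operator norm nets of size exponential in \<open>N k\<close>.\<close>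

lemma K_orb_opnorm_le:
  assumes \<Omega>: "\<Omega> \<subseteq> mat_tuples N R I" and sub: "\<Omega>' \<subseteq> \<Omega>" and F: "finite F" "F \<subseteq> I" and N: "0 < N"
    and R': "R \<le> R'" "1 \<le> R'" and \<epsilon>': "0 < \<epsilon>'" and \<epsilon>: "0 < \<epsilon>"
    and q: "128 * R'\<^sup>2 / \<epsilon>' + 2 \<le> real q"
    and k: "\<epsilon>\<^sup>2 * real N \<le> real k * (\<epsilon>' / 8)\<^sup>2"
  shows "K_orb mat_opnorm N F \<epsilon>' \<Omega>' \<le> K_orb mat_norm2 N F \<epsilon> \<Omega> * enat (q ^ (4 * N * k * card F))"
proof -
  define t where "t = \<epsilon>' / 8"
  \<comment> \<open>of the allowed \<open>\<epsilon>' / 2\<close>, the low-rank approximation uses \<open>t\<close>, and replacing its two factors, of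
    norms at most \<open>2 R'\<close> and \<open>1\<close>, by elements of the nets uses \<open>\<tau> + 2 R' \<tau>\<close>\<close>
  define \<tau> where "\<tau> = \<epsilon>' / (16 * R')"
  have t: "0 < t" and \<tau>: "0 < \<tau>" using \<epsilon>' R' by (auto simp: t_def \<tau>_def)
  have q': "4 * (2 * R') / \<tau> + 2 \<le> real q"
    using q R' \<epsilon>' by (simp add: \<tau>_def field_simps power2_eq_square)
  have R0: "0 \<le> 2 * R'" using R' by simp
  have q0: "0 < q" using q R' \<epsilon>'
    by (metis add_nonneg_pos divide_nonneg_pos less_le_trans mult_nonneg_nonneg of_nat_0_less_iff
        zero_le_numeral zero_le_power2 zero_less_numeral)
  obtain S1 where S1: "finite S1" "S1 \<subseteq> carrier_mat N k" "card S1 \<le> q ^ (2 * N * k)"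
    "\<And>Y. Y \<in> S1 \<Longrightarrow> mat_opnorm k Y \<le> 2 * R'"
    "\<And>Y. Y \<in> carrier_mat N k \<Longrightarrow> mat_opnorm k Y \<le> 2 * R' \<Longrightarrow> \<exists>Y0\<in>S1. mat_opnorm k (Y - Y0) < \<tau>"
    using opnorm_net[OF \<tau> R0 q', of N k] by blast
  obtain S2 where S2: "finite S2" "S2 \<subseteq> carrier_mat k N" "card S2 \<le> q ^ (2 * k * N)"
    "\<And>Z. Z \<in> carrier_mat k N \<Longrightarrow> mat_opnorm N Z \<le> 2 * R' \<Longrightarrow> \<exists>Z0\<in>S2. mat_opnorm N (Z - Z0) < \<tau>"
    using opnorm_net[OF \<tau> R0 q', of k N] by blast
  have cards: "card (F \<rightarrow>\<^sub>E S1 \<times> S2) \<le> q ^ (4 * N * k * card F)"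
  proof -
    have "card (F \<rightarrow>\<^sub>E S1 \<times> S2) = (card S1 * card S2) ^ card F"
      using F by (simp add: card_PiE card_cartesian_product)
    also have "\<dots> \<le> (q ^ (2 * N * k) * q ^ (2 * k * N)) ^ card F"
      using S1(3) S2(3) by (intro power_mono mult_mono) auto
    also have "\<dots> = q ^ (4 * N * k * card F)"
      by (simp flip: power_add power_mult) (simp add: mult_ac)
    finally show ?thesis .
  qed
  let ?covers = "{T. finite T \<and> T \<subseteq> \<Omega> \<and> (\<forall>C\<in>\<Omega>. \<exists>B\<in>T. \<exists>U\<in>unitary_mats N.
           \<forall>i\<in>F. mat_norm2 N (C i - U * B i * mat_adjoint U) < \<epsilon>)}"
  show ?thesis
  proof (cases "?covers = {}")
    case True
    then have "K_orb mat_norm2 N F \<epsilon> \<Omega> = \<infinity>"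
      unfolding K_orb_def by (simp only: image_empty Inf_empty top_enat_def)
    then show ?thesis using q0 by (simp add: enat_0_iff)
  next
    case False
    then have "K_orb mat_norm2 N F \<epsilon> \<Omega> \<in> (\<lambda>T. enat (card T)) ` ?covers"
      unfolding K_orb_def by (metis (no_types, lifting) ex_in_conv image_eqI wellorder_InfI)
    then obtain T where T: "finite T" "T \<subseteq> \<Omega>" and cover: "\<And>C. C \<in> \<Omega> \<Longrightarrow> \<exists>B\<in>T. \<exists>U\<in>unitary_mats N.
           \<forall>i\<in>F. mat_norm2 N (C i - U * B i * mat_adjoint U) < \<epsilon>"
      and K: "K_orb mat_norm2 N F \<epsilon> \<Omega> = enat (card T)" by blast
    have tup: "C i \<in> carrier_mat N N" "mat_opnorm N (C i) \<le> R'" if "C \<in> \<Omega>" "i \<in> F" for C i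
      using that mat_tuplesD[of C N R I] \<Omega> F R' by fastforce+
    have "K_orb mat_opnorm N F \<epsilon>' \<Omega>' \<le> enat (card (T \<times> (F \<rightarrow>\<^sub>E S1 \<times> S2)))"
    proof (rule opnorm.K_orb_le_external[where c = "\<lambda>(B, n) i. B i + fst (n i) * snd (n i)"])
      show "finite (T \<times> (F \<rightarrow>\<^sub>E S1 \<times> S2))" using T S1 S2 F by (auto intro: finite_PiE)
      show "C i \<in> carrier_mat N N" if "C \<in> \<Omega>'" "i \<in> F" for C i using tup that sub by blast
      show "(case x of (B, n) \<Rightarrow> \<lambda>i. B i + fst (n i) * snd (n i)) i \<in> carrier_mat N N"
        if x: "x \<in> T \<times> (F \<rightarrow>\<^sub>E S1 \<times> S2)" and i: "i \<in> F" for x i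
      proof -
        obtain B n where Bn: "x = (B, n)" "B \<in> T" "n \<in> F \<rightarrow>\<^sub>E S1 \<times> S2" using x by auto
        have "n i \<in> S1 \<times> S2" using Bn(3) i by blast
        then have "fst (n i) \<in> carrier_mat N k" "snd (n i) \<in> carrier_mat k N" using S1(2) S2(2) by auto
        then have "fst (n i) * snd (n i) \<in> carrier_mat N N" by (rule mult_carrier_mat)
        then show ?thesis unfolding Bn(1) prod.case by (rule add_carrier_mat)
      qed
      fix C assume C: "C \<in> \<Omega>'"
      then have C\<Omega>: "C \<in> \<Omega>" using sub by blast
      then obtain B U where B: "B \<in> T" and U: "U \<in> unitary_mats N"
        and CB: "\<forall>i\<in>F. mat_norm2 N (C i - U * B i * mat_adjoint U) < \<epsilon>" using cover by blast
      have B\<Omega>: "B \<in> \<Omega>" using B T by blast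
      note u = unitary_matsD[OF U]
      have V: "mat_adjoint U \<in> unitary_mats N" by (rule unitary_mats_adjoint[OF U])
      have "\<exists>n\<in>S1 \<times> S2. mat_opnorm N (C i - U * (B i + fst n * snd n) * mat_adjoint U) < \<epsilon>' / 2"
        if i: "i \<in> F" for i
      proof -
        have Ci: "C i \<in> carrier_mat N N" "mat_opnorm N (C i) \<le> R'" using tup[OF C\<Omega> i] .
        have Bi: "B i \<in> carrier_mat N N" "mat_opnorm N (B i) \<le> R'" using tup[OF B\<Omega> i] .
        let ?C = "mat_adjoint U * C i * mat_adjoint (mat_adjoint U)"
        let ?UB = "U * B i * mat_adjoint U"
        have UB: "?UB \<in> carrier_mat N N" by (rule conjugate_carrier[OF u(1) Bi(1)])
        have C': "?C \<in> carrier_mat N N" by (rule conjugate_carrier[OF u(2) Ci(1)])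
        let ?D = "?C - B i"
        have D: "?D \<in> carrier_mat N N" by (rule minus_carrier_mat[OF Bi(1)])
        have "mat_adjoint U * (C i - ?UB) * mat_adjoint (mat_adjoint U) = ?D"
          using conjugate_minus[OF u(2) Ci(1) UB] unitary_conjugate_inverse[OF U Bi(1)] by simp
        then have "mat_norm2 N ?D \<le> mat_norm2 N (C i - ?UB)"
          using norm2.unitary_conjugate_le[OF V minus_carrier_mat[OF UB]] by metis
        then have "mat_norm2 N ?D < \<epsilon>" using CB i by fastforce
        then have "fro_norm ?D < \<epsilon> * sqrt (real N)"
          unfolding mat_norm2_eq_fro[OF D] using N by (simp only: pos_divide_less_eq real_sqrt_gt_zero of_nat_0_less_iff)
        then have "(fro_norm ?D)\<^sup>2 \<le> (\<epsilon> * sqrt (real N))\<^sup>2"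
          by (intro power_mono) auto
        also have "\<dots> = \<epsilon>\<^sup>2 * real N" by (simp add: power_mult_distrib)
        finally have fro: "(fro_norm ?D)\<^sup>2 \<le> real k * t\<^sup>2" using k unfolding t_def by linarith
        have "mat_opnorm N ?D \<le> mat_opnorm N ?C + mat_opnorm N (B i)"
        proof -
          have "?D = ?C + (-1) \<cdot>\<^sub>m B i" using C' Bi(1) by (intro eq_matI) auto
          then show ?thesis
            using opnorm_triangle[OF C' smult_carrier_mat[OF Bi(1)], of "-1"]
              opnorm_smult_le[OF Bi(1), of "-1"] by simp
        qed
        then have D2: "mat_opnorm N ?D \<le> 2 * R'"
          using opnorm.unitary_conjugate_le[OF V Ci(1)] Ci(2) Bi(2) by linarith
        obtain Y Z where Y: "Y \<in> carrier_mat N k" "mat_opnorm k Y \<le> mat_opnorm N ?D"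
          and Z: "Z \<in> carrier_mat k N" "mat_opnorm N Z \<le> 1"
          and YZ: "mat_opnorm N (?D - Y * Z) \<le> t"
          using low_rank_approximation[OF D t fro] by metis
        obtain Y0 where Y0: "Y0 \<in> S1" "mat_opnorm k (Y - Y0) < \<tau>"
          using S1(5)[OF Y(1)] Y(2) D2 by force
        obtain Z0 where Z0: "Z0 \<in> S2" "mat_opnorm N (Z - Z0) < \<tau>"
          using S2(4)[OF Z(1)] Z(2) R' by force
        have Y0c: "Y0 \<in> carrier_mat N k" "mat_opnorm k Y0 \<le> 2 * R'" and Z0c: "Z0 \<in> carrier_mat k N"
          using Y0 Z0 S1 S2 by auto
        have YZc: "Y * Z \<in> carrier_mat N N" and Y0Zc: "Y0 * Z \<in> carrier_mat N N"
          and Y0Z0c: "Y0 * Z0 \<in> carrier_mat N N"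
          using Y(1) Z(1) Y0c(1) Z0c by (auto intro: mult_carrier_mat)
        have "mat_opnorm N (Y * Z - Y0 * Z) \<le> mat_opnorm k (Y - Y0) * mat_opnorm N Z"
          using opnorm_mult[OF minus_carrier_mat[OF Y0c(1)] Z(1), of Y]
            minus_mult_distrib_mat[OF Y(1) Y0c(1) Z(1)] by simp
        also have "\<dots> \<le> \<tau> * 1"
          using Y0(2) Z(2) opnorm_nonneg[OF Z(1)] \<tau> by (intro mult_mono) auto
        finally have d1: "mat_opnorm N (Y * Z - Y0 * Z) \<le> \<tau>" by simp
        have "mat_opnorm N (Y0 * Z - Y0 * Z0) \<le> mat_opnorm k Y0 * mat_opnorm N (Z - Z0)"
          using opnorm_mult[OF Y0c(1) minus_carrier_mat[OF Z0c], of Z]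
            mult_minus_distrib_mat[OF Y0c(1) Z(1) Z0c] by simp
        also have "\<dots> \<le> 2 * R' * \<tau>"
          using Y0c(2) Z0(2) opnorm_nonneg[OF minus_carrier_mat[OF Z0c, of Z]] R' by (intro mult_mono) auto
        finally have d2: "mat_opnorm N (Y0 * Z - Y0 * Z0) \<le> 2 * R' * \<tau>" .
        have "mat_opnorm N (?D - Y0 * Z0) \<le> mat_opnorm N (?D - Y * Z) +
            (mat_opnorm N (Y * Z - Y0 * Z) + mat_opnorm N (Y0 * Z - Y0 * Z0))"
          using opnorm.triangle_minus[OF D YZc Y0Z0c] opnorm.triangle_minus[OF YZc Y0Zc Y0Z0c] by linarith
        also have "\<dots> \<le> t + (\<tau> + 2 * R' * \<tau>)" using YZ d1 d2 by linarith
        also have "\<dots> < \<epsilon>' / 2"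
        proof -
          have "2 * R' * \<tau> = \<epsilon>' / 8" using R' by (simp add: \<tau>_def)
          moreover have "\<tau> \<le> \<epsilon>' / 16"
            using R' \<epsilon>' by (simp add: \<tau>_def field_simps)
          ultimately show ?thesis using \<epsilon>' by (simp add: t_def)
        qed
        finally have "mat_opnorm N (?D - Y0 * Z0) < \<epsilon>' / 2" .
        moreover have "C i - U * (B i + Y0 * Z0) * mat_adjoint U = U * (?D - Y0 * Z0) * mat_adjoint U"
        proof -
          have "U * ?C * mat_adjoint U = C i"
            using unitary_conjugate_inverse[OF V Ci(1)] by simp
          moreover have "?D - Y0 * Z0 = ?C - (B i + Y0 * Z0)"
            by (rule mat_diff_diff_eq[OF C' Bi(1) Y0Z0c])
          ultimately show ?thesis
            using conjugate_minus[OF u(1) C' add_carrier_mat[OF Y0Z0c, of "B i"]] by simp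
        qed
        ultimately have "mat_opnorm N (C i - U * (B i + Y0 * Z0) * mat_adjoint U) < \<epsilon>' / 2"
          using opnorm.unitary_conjugate_le[OF U minus_carrier_mat[OF Y0Z0c, of ?D]] by simp
        then show ?thesis using Y0(1) Z0(1) by (intro bexI[of _ "(Y0, Z0)"]) auto
      qed
      then obtain n where n: "\<And>i. i \<in> F \<Longrightarrow> n i \<in> S1 \<times> S2"
        "\<And>i. i \<in> F \<Longrightarrow> mat_opnorm N (C i - U * (B i + fst (n i) * snd (n i)) * mat_adjoint U) < \<epsilon>' / 2"
        by metis
      show "\<exists>x\<in>T \<times> (F \<rightarrow>\<^sub>E S1 \<times> S2). \<exists>U\<in>unitary_mats N. \<forall>i\<in>F. mat_opnorm N
          (C i - U * (case x of (B, n) \<Rightarrow> \<lambda>i. B i + fst (n i) * snd (n i)) i * mat_adjoint U) < \<epsilon>' / 2"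
      proof (rule bexI[of _ "(B, restrict n F)"], rule bexI[OF _ U])
        show "\<forall>i\<in>F. mat_opnorm N (C i - U * (case (B, restrict n F) of (B, n) \<Rightarrow>
            \<lambda>i. B i + fst (n i) * snd (n i)) i * mat_adjoint U) < \<epsilon>' / 2"
          using n(2) by simp
        show "(B, restrict n F) \<in> T \<times> (F \<rightarrow>\<^sub>E S1 \<times> S2)" using B n(1) by auto
      qed
    qed
    also have "\<dots> \<le> enat (card T * q ^ (4 * N * k * card F))"
      using cards by (simp add: card_cartesian_product)
    finally show ?thesis using K by simp
  qed
qed

lemma log_enat_mult_le:
  assumes "0 < c"
  shows "log_enat (m * enat c) \<le> log_enat m + ereal (ln (real c))"
proof (cases m)
  case (enat j)
  then show ?thesis using assms by (auto simp: log_enat_def ln_mult)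
next
  case infinity
  then show ?thesis using assms by (simp add: log_enat_def)
qed

text \<open>The Hilbert-Schmidt radius \<open>\<epsilon>\<close> is taken so small, at a fixed operator norm radius \<open>\<epsilon>'\<close>, that
  the rank proportion \<open>\<epsilon>\<^sup>2 / t\<^sup>2\<close> contributes at most \<open>\<zeta>/2\<close> to the growth rate.  Rounding the rank
  up to an integer costs at most \<open>L / N\<close>, which is at most \<open>\<zeta>/2\<close> for large \<open>N\<close>.\<close>

lemma size_entropy_opnorm_le_norm2:
  fixes a :: "'i \<Rightarrow> 'a::cstar_algebra"
  shows "size_entropy mat_opnorm mat_opnorm R I a \<le> size_entropy mat_norm2 abs_ntr R I a"
  unfolding size_entropy_def[of mat_opnorm]
proof (rule SUP_least, clarify)
  fix F and \<epsilon>' :: real assume F: "finite F" "F \<subseteq> I" and \<epsilon>': "0 < \<epsilon>'"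
  let ?X = "{(\<delta> :: real, Q). 0 < \<delta> \<and> finite Q \<and> Q \<subseteq> ncpolys I}"
  let ?f = "\<lambda>\<delta> Q. limsup (\<lambda>N. ereal (1 / (real N)\<^sup>2) *
          log_enat (K_orb mat_opnorm N F \<epsilon>' (size_microstates mat_opnorm N R I a Q \<delta>)))"
  let ?g = "\<lambda>\<epsilon> \<delta> Q. limsup (\<lambda>N. ereal (1 / (real N)\<^sup>2) *
          log_enat (K_orb mat_norm2 N F \<epsilon> (size_microstates abs_ntr N R I a Q \<delta>)))"
  show "(INF (\<delta>, Q)\<in>?X. ?f \<delta> Q) \<le> size_entropy mat_norm2 abs_ntr R I a"
  proof (rule ereal_le_epsilon2)
    fix \<zeta> :: real assume \<zeta>: "0 < \<zeta>"
    define R' where "R' = max R 1"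
    define q where "q = nat \<lceil>128 * R'\<^sup>2 / \<epsilon>' + 2\<rceil>"
    have R': "R \<le> R'" "1 \<le> R'" by (auto simp: R'_def)
    have q: "128 * R'\<^sup>2 / \<epsilon>' + 2 \<le> real q" unfolding q_def by (rule real_nat_ceiling_ge)
    have "0 \<le> 128 * R'\<^sup>2 / \<epsilon>'" using \<epsilon>' by simp
    then have q1: "1 \<le> real q" using q by linarith
    define L where "L = 4 * real (card F) * ln (real q)"
    have L: "0 \<le> L" using q1 by (simp add: L_def)
    define t where "t = \<epsilon>' / 8"
    have t: "0 < t" using \<epsilon>' by (simp add: t_def)
    define \<epsilon> where "\<epsilon> = t * sqrt (\<zeta> / (2 * (L + 1)))"
    have \<epsilon>: "0 < \<epsilon>" using t \<zeta> L by (simp add: \<epsilon>_def)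
    have \<epsilon>2: "\<epsilon>\<^sup>2 / t\<^sup>2 = \<zeta> / (2 * (L + 1))"
      using t \<zeta> L by (simp add: \<epsilon>_def power_mult_distrib)
    have "L * (\<epsilon>\<^sup>2 / t\<^sup>2) = (L / (L + 1)) * (\<zeta> / 2)" unfolding \<epsilon>2 by simp
    also have "\<dots> \<le> 1 * (\<zeta> / 2)" using L \<zeta> by (intro mult_right_mono) auto
    finally have L\<epsilon>: "L * (\<epsilon>\<^sup>2 / t\<^sup>2) \<le> \<zeta> / 2" by simp
    have main: "?f \<delta> Q \<le> ?g \<epsilon> \<delta> Q + ereal \<zeta>" for \<delta> Q
    proof -
      have ev: "\<forall>\<^sub>F N in sequentially.
          ereal (1 / (real N)\<^sup>2) * log_enat (K_orb mat_opnorm N F \<epsilon>' (size_microstates mat_opnorm N R I a Q \<delta>))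
          \<le> ereal (1 / (real N)\<^sup>2) * log_enat (K_orb mat_norm2 N F \<epsilon> (size_microstates abs_ntr N R I a Q \<delta>)) + ereal \<zeta>"
      proof (rule eventually_sequentiallyI)
        fix N :: nat assume N: "max 1 (nat \<lceil>2 * L / \<zeta>\<rceil>) \<le> N"
        then have N0: "0 < N" by simp
        have "2 * L / \<zeta> \<le> real N" using N by (metis max.bounded_iff of_nat_ceiling of_nat_mono order_trans)
        then have LN: "L / real N \<le> \<zeta> / 2" using N0 \<zeta> by (simp add: field_simps)
        define k where "k = nat \<lceil>\<epsilon>\<^sup>2 * real N / t\<^sup>2\<rceil>"
        have k: "\<epsilon>\<^sup>2 * real N / t\<^sup>2 \<le> real k" unfolding k_def by (rule real_nat_ceiling_ge)
        have "0 \<le> \<epsilon>\<^sup>2 * real N / t\<^sup>2" by simp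
        then have k': "real k \<le> \<epsilon>\<^sup>2 * real N / t\<^sup>2 + 1" unfolding k_def by linarith
        have kt: "\<epsilon>\<^sup>2 * real N \<le> real k * (\<epsilon>' / 8)\<^sup>2"
          using k t unfolding t_def[symmetric] by (simp add: divide_le_eq)
        have sub: "size_microstates mat_opnorm N R I a Q \<delta> \<subseteq> size_microstates abs_ntr N R I a Q \<delta>"
        proof -
          have "abs_ntr N (mat_nceval N A P) \<le> mat_opnorm N (mat_nceval N A P)" for A :: "'i \<Rightarrow> complex mat" and P
            using abs_ntr_le_norm2[OF mat_nceval_carrier[of N A P]]
              mat_norm2_le_opnorm[OF mat_nceval_carrier[of N A P]] by linarith
          then show ?thesis unfolding size_microstates_def using order_trans by blast
        qed
        let ?K = "K_orb mat_norm2 N F \<epsilon> (size_microstates abs_ntr N R I a Q \<delta>)"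
        let ?c = "q ^ (4 * N * k * card F)"
        have c: "0 < ?c" using q1 by simp
        have "log_enat (K_orb mat_opnorm N F \<epsilon>' (size_microstates mat_opnorm N R I a Q \<delta>)) \<le>
            log_enat (?K * enat ?c)"
          by (intro log_enat_mono K_orb_opnorm_le[OF _ sub F N0 R' \<epsilon>' \<epsilon> q kt])
            (auto simp: size_microstates_def)
        also have "\<dots> \<le> log_enat ?K + ereal (ln (real ?c))" by (rule log_enat_mult_le[OF c])
        finally have "ereal (1 / (real N)\<^sup>2) *
            log_enat (K_orb mat_opnorm N F \<epsilon>' (size_microstates mat_opnorm N R I a Q \<delta>)) \<le>
            ereal (1 / (real N)\<^sup>2) * (log_enat ?K + ereal (ln (real ?c)))"
          by (rule ereal_mult_left_mono) simp
        also have "\<dots> = ereal (1 / (real N)\<^sup>2) * log_enat ?K + ereal (1 / (real N)\<^sup>2 * ln (real ?c))"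
          by (subst ereal_pos_distrib) auto
        also have "\<dots> \<le> ereal (1 / (real N)\<^sup>2) * log_enat ?K + ereal \<zeta>"
        proof (rule add_left_mono, simp only: ereal_less_eq)
          have "ln (real ?c) = real N * real k * L"
            using q1 by (simp add: ln_realpow L_def)
          also have "\<dots> \<le> real N * (\<epsilon>\<^sup>2 * real N / t\<^sup>2 + 1) * L"
            using k' L by (intro mult_right_mono mult_left_mono) auto
          finally have "1 / (real N)\<^sup>2 * ln (real ?c) \<le> 1 / (real N)\<^sup>2 * (real N * (\<epsilon>\<^sup>2 * real N / t\<^sup>2 + 1) * L)"
            by (intro mult_left_mono) auto
          also have "\<dots> = L * (\<epsilon>\<^sup>2 / t\<^sup>2) + L / real N"
            using N0 t by (simp add: field_simps power2_eq_square)
          also have "\<dots> \<le> \<zeta>" using L\<epsilon> LN by linarith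
          finally show "1 / (real N)\<^sup>2 * ln (real ?c) \<le> \<zeta>" .
        qed
        finally show "ereal (1 / (real N)\<^sup>2) *
            log_enat (K_orb mat_opnorm N F \<epsilon>' (size_microstates mat_opnorm N R I a Q \<delta>)) \<le>
            ereal (1 / (real N)\<^sup>2) * log_enat ?K + ereal \<zeta>" .
      qed
      have "?f \<delta> Q \<le> limsup (\<lambda>N. ereal (1 / (real N)\<^sup>2) *
          log_enat (K_orb mat_norm2 N F \<epsilon> (size_microstates abs_ntr N R I a Q \<delta>)) + ereal \<zeta>)"
        by (rule Limsup_mono[OF ev])
      also have "\<dots> = ?g \<epsilon> \<delta> Q + ereal \<zeta>"
        by (rule Limsup_add_ereal_right) auto
      finally show ?thesis .
    qed
    have "(INF (\<delta>, Q)\<in>?X. ?f \<delta> Q) - ereal \<zeta> \<le> (INF (\<delta>, Q)\<in>?X. ?g \<epsilon> \<delta> Q)"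
    proof (rule INF_greatest, clarify)
      fix \<delta> :: real and Q assume "0 < \<delta>" "finite Q" "Q \<subseteq> ncpolys I"
      then have "(INF (\<delta>, Q)\<in>?X. ?f \<delta> Q) \<le> ?f \<delta> Q"
        by (intro INF_lower2[of "(\<delta>, Q)"]) auto
      also have "\<dots> \<le> ?g \<epsilon> \<delta> Q + ereal \<zeta>" by (rule main)
      finally show "(INF (\<delta>, Q)\<in>?X. ?f \<delta> Q) - ereal \<zeta> \<le> ?g \<epsilon> \<delta> Q"
        by (simp add: ereal_minus_le)
    qed
    also have "\<dots> \<le> size_entropy mat_norm2 abs_ntr R I a"
      unfolding size_entropy_def by (rule SUP_upper2[of "(F, \<epsilon>)"]) (use F \<epsilon> in auto)
    finally show "(INF (\<delta>, Q)\<in>?X. ?f \<delta> Q) \<le> size_entropy mat_norm2 abs_ntr R I a + ereal \<zeta>"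
      by (simp add: ereal_minus_le)
  qed
qed

section \<open>The entropy of the algebra\<close>

text \<open>The entropies of the algebra are common values over tuples indexed by sets of natural numbers;
  for them to be determined, at least one such tuple has to generate.\<close>

lemma generating_reindex:
  fixes a :: "'i \<Rightarrow> 'a::cstar_algebra"
  assumes "countable I" "generating I a" "R_bounded R I a"
  obtains J :: "nat set" and b :: "nat \<Rightarrow> 'a" where "generating J b" "R_bounded R J b"
proof
  have "(a \<circ> from_nat_into I) ` to_nat_on I ` I = a ` I"
    unfolding image_image using assms(1) by (intro image_cong) auto
  then show "generating (to_nat_on I ` I) (a \<circ> from_nat_into I)"
    using assms(2) by (simp add: generating_def)
  show "R_bounded R (to_nat_on I ` I) (a \<circ> from_nat_into I)"
    using assms(1,3) by (auto simp: R_bounded_def)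
qed

theorem theorem8p1:
  fixes I :: "'i set" and a :: "'i \<Rightarrow> 'a::cstar_algebra" and R :: real
  assumes "\<exists>\<tau> :: 'a \<Rightarrow> complex. tracial_state \<tau>"
    and "separable_space (euclidean :: 'a topology)"
    and "countable I"
    and "generating I a"
    and "\<forall>i\<in>I. norm (a i) < R"
  shows "h_top_alg TYPE('a) = h_top R I a \<and>
         h_top R I a \<le> h_laws R I (trace_laws I a) \<and>
         h_laws R I (trace_laws I a) = h_alg TYPE('a)"
proof -
  have R: "R_bounded R I a" using assms(5) by (auto simp: R_bounded_def intro: less_imp_le)
  obtain J :: "nat set" and b :: "nat \<Rightarrow> 'a" where b: "generating J b" "R_bounded R J b"
    using generating_reindex[OF assms(3,4) R] by blast
  have top: "h_top S J b = h_top R I a" if "generating J b" "R_bounded S J b"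
    for S and J :: "nat set" and b :: "nat \<Rightarrow> 'a"
    unfolding h_top_eq_size_entropy by (rule opnorm.size_entropy_independent[OF that assms(4) R])
  have laws: "h_laws S J (trace_laws J b) = h_laws R I (trace_laws I a)"
    if "generating J b" "R_bounded S J b" for S and J :: "nat set" and b :: "nat \<Rightarrow> 'a"
    unfolding h_laws_eq_size_entropy[OF that] h_laws_eq_size_entropy[OF assms(4) R]
    by (rule norm2.size_entropy_independent[OF that assms(4) R])
  have "h_top_alg TYPE('a) = h_top R I a"
    unfolding h_top_alg_def by (rule the_equality) (use top b in metis)+
  moreover have "h_laws R I (trace_laws I a) = h_alg TYPE('a)"
    unfolding h_alg_def by (rule the_equality[symmetric]) (use laws b in metis)+
  moreover have "h_top R I a \<le> h_laws R I (trace_laws I a)"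
    unfolding h_laws_eq_size_entropy[OF assms(4) R] h_top_eq_size_entropy
    by (rule size_entropy_opnorm_le_norm2)
  ultimately show ?thesis by blast
qed

end
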